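(* Let $P$ be a fractal distribution on $\mathcal{M}^{*}$ with ergodic decomposition $P=\int P_{\mu}\,dP(\mu)$ with respect to $S^{*}$. Then $P$-a.e. $\mu$ is a uniformly scaling measure generating the ergodic component $P_\mu$ of $P$ to which $\mu$ belongs; i.e. for $P$-a.e. $\mu$ and $\mu$-a.e. $x$, $\langle\mu\rangle^{\square}_{x,T}\to (P_\mu)^{\square}$ as $T\to\infty$.
   Context: Fix $d\ge 1$. $\mathbb{R}^d$ carries the sup-norm; $B_r(x)$ is the closed ball, $B_r=B_r(0)$, so $B_1=[-1,1]^d$. $\mathcal{M}$ is the space of Radon measures on $\mathbb{R}^d$ with the weak topology (tested against continuous compactly supported functions). "Distribution" means a Borel probability measure on a space of measures. For $\mu\in\mathcal{M}$ with $\mu(B_1)>0$ put $\mu^*=\frac{1}{\mu(B_1)}\mu$, $\mu^{\square}=\mu^*|_{B_1}$ (restriction), $\mathcal{M}^*=\{\mu:\mu(B_1)=1\}$, $\mathcal{M}^{\square}=\mathcal{P}(B_1)$; for a distribution $P$, $P^{\square}$ is its push-forward under $\mu\mapsto\mu^{\square}$. Let $T_x(y)=y-x$ and $S_t(y)=e^t y$, acting on measures by push-forward; $T_x^*\mu=(T_x\mu)^*$, $S_t^*\mu=(S_t\mu)^*$, $S^{\square}_t\mu=(S_t\mu)^{\square}$. $S^*=(S^*_t)_{t\in\mathbb{R}}$ is an $\mathbb{R}$-action on $\{\mu\in\mathcal{M}^*:0\in\operatorname{supp}\mu\}$; $S^*$-invariant distributions are understood to be concentrated on this set. For $U\subseteq\mathbb{R}^d$,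 $\langle\mu\rangle_U^*=\int_U\delta_{T_x^*\mu}\,d\mu(x)$. A distribution $P$ on $\mathcal{M}^*$ is quasi-Palm if for every bounded open neighborhood $U$ of $0$, $P\sim\int\langle\mu\rangle^*_U\,dP(\mu)$ ($\sim$: same null sets). A fractal distribution (FD) is a probability distribution on $\mathcal{M}^*$ that is $S^*$-invariant and quasi-Palm. For $\mu\in\mathcal{M}$ and $x\in\operatorname{supp}\mu$ let $\mu^{\square}_{x,t}=S^{\square}_t(T_x\mu)$ and $\langle\mu\rangle^{\square}_{x,T}=\frac1T\int_0^T\delta_{\mu^{\square}_{x,t}}\,dt\in\mathcal{P}(\mathcal{M}^{\square})$, where $\mathcal{P}(\mathcal{M}^{\square})$ has the weak topology. $\mu$ generates a distribution at $x$ if $\langle\mu\rangle^{\square}_{x,T}$ converges to it as $T\to\infty$ (for an $S^*$-invariant distribution $P$ on $\mathcal{M}^*$, "generates $P$" means convergence to $P^{\square}$). $\mu$ is a uniformly scaling measure (USM) generating $P$ if it generates the same $P$ at $\mu$-a.e. $x$. *)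

theory Defs
  imports "HOL-Probability.Probability"
begin

section \<open>Weak topologies and mixtures of measures\<close>

definition borel_of :: "'a topology \<Rightarrow> 'a measure" where
  "borel_of X = sigma (topspace X) {U. openin X U}"

text \<open>The coarsest topology on the set \<open>A\<close> of measures that makes \<open>\<nu> \<mapsto> \<integral> f d\<nu>\<close>
  continuous for every test function \<open>f \<in> F\<close>.\<close>

definition weak_topology :: "'a measure set \<Rightarrow> ('a \<Rightarrow> real) set \<Rightarrow> 'a measure topology" where
  "weak_topology A F =
     pullback_topology A (\<lambda>\<nu>. \<lambda>f\<in>F. integral\<^sup>L \<nu> f) (powertop_real F)"

text \<open>\<open>prob_topology X\<close> is \<open>\<P>(X)\<close>: the Borel probability measures on \<open>X\<close> with the weak
  topology.\<close>

definition prob_topology :: "'a topology \<Rightarrow> 'a measure topology" where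
  "prob_topology X =
     weak_topology {\<nu>. prob_space \<nu> \<and> sets \<nu> = sets (borel_of X)}
       {f. continuous_map X euclideanreal f \<and> bounded (f ` topspace X)}"

text \<open>\<open>mixture N M K\<close> is the measure \<open>\<integral> K x dM(x)\<close> on the measurable space \<open>N\<close>. Unlike
  \<^const>\<open>Giry_Monad.bind\<close> it does not require the \<open>K x\<close> to be subprobability measures.\<close>

definition mixture :: "'b measure \<Rightarrow> 'a measure \<Rightarrow> ('a \<Rightarrow> 'b measure) \<Rightarrow> 'b measure" where
  "mixture N M K = measure_of (space N) (sets N) (\<lambda>A. \<integral>\<^sup>+x. emeasure (K x) A \<partial>M)"


section \<open>Measures on Euclidean space\<close>

text \<open>The unit ball of the sup-norm, i.e. \<open>[-1,1]\<^sup>d\<close>; here \<open>1\<close> is the all-ones vector.\<close>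

definition B1 :: "(real^'n) set" where
  "B1 = cbox (- 1) 1"

text \<open>On \<open>\<real>\<^sup>d\<close> every locally finite Borel measure is regular, so no regularity clause is
  needed.\<close>

definition radon :: "(real^'n) measure set" where
  "radon = {\<mu>. sets \<mu> = sets borel \<and> (\<forall>K. compact K \<longrightarrow> emeasure \<mu> K < \<infinity>)}"

definition vague_topology :: "(real^'n) measure topology" where
  "vague_topology =
     weak_topology radon {f. continuous_on UNIV f \<and> compact (closure {x. f x \<noteq> 0})}"

definition supp :: "(real^'n) measure \<Rightarrow> (real^'n) set" where
  "supp \<mu> = {x. \<forall>U. open U \<longrightarrow> x \<in> U \<longrightarrow> emeasure \<mu> U > 0}"

text \<open>\<open>normalized \<mu>\<close> is \<open>\<mu>\<^sup>*\<close>. If \<open>\<mu>(B\<^sub>1) = 0\<close>, where \<open>\<mu>\<^sup>*\<close> is undefined, the result also gives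
  \<open>B\<^sub>1\<close> mass \<open>0\<close> (as \<open>\<infinity> * 0 = 0\<close>) and hence lies outside \<open>Mstar\<close>.\<close>

definition normalized :: "(real^'n) measure \<Rightarrow> (real^'n) measure" where
  "normalized \<mu> = scale_measure (1 / emeasure \<mu> B1) \<mu>"

definition Mstar :: "(real^'n) measure set" where
  "Mstar = {\<mu> \<in> radon. emeasure \<mu> B1 = 1}"

definition Mstar_borel :: "(real^'n) measure measure" where
  "Mstar_borel = borel_of (subtopology vague_topology Mstar)"

text \<open>Elements of \<open>\<M>\<^sup>\<box> = \<P>(B\<^sub>1)\<close> are measures whose underlying space is \<open>B1\<close>.\<close>

definition Msquare :: "(real^'n) measure topology" where
  "Msquare = prob_topology (top_of_set B1)"

definition square :: "(real^'n) measure \<Rightarrow> (real^'n) measure" where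
  "square \<mu> = restrict_space (normalized \<mu>) B1"

definition translate :: "real^'n \<Rightarrow> (real^'n) measure \<Rightarrow> (real^'n) measure" where
  "translate x \<mu> = distr \<mu> borel (\<lambda>y. y - x)"

definition dilate :: "real \<Rightarrow> (real^'n) measure \<Rightarrow> (real^'n) measure" where
  "dilate t \<mu> = distr \<mu> borel (\<lambda>y. exp t *\<^sub>R y)"

definition translate_star :: "real^'n \<Rightarrow> (real^'n) measure \<Rightarrow> (real^'n) measure" where
  "translate_star x \<mu> = normalized (translate x \<mu>)"

definition dilate_star :: "real \<Rightarrow> (real^'n) measure \<Rightarrow> (real^'n) measure" where
  "dilate_star t \<mu> = normalized (dilate t \<mu>)"

definition dilate_square :: "real \<Rightarrow> (real^'n) measure \<Rightarrow> (real^'n) measure" where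
  "dilate_square t \<mu> = square (dilate t \<mu>)"


section \<open>Fractal distributions\<close>

definition distribution :: "(real^'n) measure measure \<Rightarrow> bool" where
  "distribution P \<longleftrightarrow> prob_space P \<and> sets P = sets Mstar_borel"

text \<open>The set on which \<open>S\<^sup>*\<close> is an action of \<open>\<real>\<close>.\<close>

definition Mstar0 :: "(real^'n) measure set" where
  "Mstar0 = {\<mu> \<in> Mstar. 0 \<in> supp \<mu>}"

definition S_invariant :: "(real^'n) measure measure \<Rightarrow> bool" where
  "S_invariant P \<longleftrightarrow>
     (AE \<mu> in P. \<mu> \<in> Mstar0) \<and>
     (\<forall>t. distr (restrict_space P Mstar0) P (dilate_star t) = P)"

definition S_ergodic :: "(real^'n) measure measure \<Rightarrow> bool" where
  "S_ergodic P \<longleftrightarrow>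
     S_invariant P \<and>
     (\<forall>A \<in> sets P. A \<subseteq> Mstar0 \<longrightarrow> (\<forall>t. {\<mu> \<in> Mstar0. dilate_star t \<mu> \<in> A} = A) \<longrightarrow>
        emeasure P A = 0 \<or> emeasure P A = 1)"

text \<open>\<open>palm_average U \<mu>\<close> is \<open>\<langle>\<mu>\<rangle>\<^sup>*\<^sub>U\<close>; \<^const>\<open>return\<close> is the Dirac measure.\<close>

definition palm_average :: "(real^'n) set \<Rightarrow> (real^'n) measure \<Rightarrow> (real^'n) measure measure" where
  "palm_average U \<mu> =
     mixture Mstar_borel (restrict_space \<mu> U) (\<lambda>x. return Mstar_borel (translate_star x \<mu>))"

definition quasi_palm :: "(real^'n) measure measure \<Rightarrow> bool" where
  "quasi_palm P \<longleftrightarrow>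
     (\<forall>U. open U \<longrightarrow> bounded U \<longrightarrow> 0 \<in> U \<longrightarrow>
        null_sets P = null_sets (mixture Mstar_borel P (palm_average U)))"

definition fractal_distribution :: "(real^'n) measure measure \<Rightarrow> bool" where
  "fractal_distribution P \<longleftrightarrow> distribution P \<and> S_invariant P \<and> quasi_palm P"

text \<open>An ergodic decomposition of \<open>P\<close> is a measurable family \<open>\<mu> \<mapsto> P\<^sub>\<mu> = K \<mu>\<close> of distributions
  with \<open>P = \<integral> P\<^sub>\<mu> dP(\<mu>)\<close>, almost all of them ergodic, such that \<open>P\<^sub>\<mu>\<close> is carried by the component
  \<open>{\<nu>. P\<^sub>\<nu> = P\<^sub>\<mu>}\<close> containing \<open>\<mu>\<close>. The last clause is what ties \<open>P\<^sub>\<mu>\<close> to the point \<open>\<mu>\<close>: without it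
  the ergodic components could be permuted among the points.\<close>

definition ergodic_decomposition ::
    "(real^'n) measure measure \<Rightarrow> ((real^'n) measure \<Rightarrow> (real^'n) measure measure) \<Rightarrow> bool" where
  "ergodic_decomposition P K \<longleftrightarrow>
     K \<in> P \<rightarrow>\<^sub>M prob_algebra Mstar_borel \<and>
     (AE \<mu> in P. S_ergodic (K \<mu>)) \<and>
     P = mixture Mstar_borel P K \<and>
     (AE \<mu> in P. AE \<nu> in K \<mu>. K \<nu> = K \<mu>)"


section \<open>Uniformly scaling measures\<close>

definition square_distr :: "(real^'n) measure measure \<Rightarrow> (real^'n) measure measure" where
  "square_distr P = distr P (borel_of Msquare) square"

definition scenery :: "(real^'n) measure \<Rightarrow> real^'n \<Rightarrow> real \<Rightarrow> (real^'n) measure" where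
  "scenery \<mu> x t = dilate_square t (translate x \<mu>)"

definition scenery_average ::
    "(real^'n) measure \<Rightarrow> real^'n \<Rightarrow> real \<Rightarrow> (real^'n) measure measure" where
  "scenery_average \<mu> x T =
     scale_measure (ennreal (1 / T))
       (mixture (borel_of Msquare) (restrict_space lborel {0..T})
         (\<lambda>t. return (borel_of Msquare) (scenery \<mu> x t)))"

definition generates_at ::
    "(real^'n) measure \<Rightarrow> real^'n \<Rightarrow> (real^'n) measure measure \<Rightarrow> bool" where
  "generates_at \<mu> x P \<longleftrightarrow>
     x \<in> supp \<mu> \<and>
     limitin (prob_topology Msquare) (scenery_average \<mu> x) (square_distr P) at_top"

definition USM_generating :: "(real^'n) measure \<Rightarrow> (real^'n) measure measure \<Rightarrow> bool" where
  "USM_generating \<mu> P \<longleftrightarrow> \<mu> \<in> radon \<and> (AE x in \<mu>. generates_at \<mu> x P)"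

end

theory Submission
  imports Defs
begin

text \<open>
Let \<open>E\<close> be an \<open>S\<^sup>*\<close>-invariant set of measures and let \<open>g(\<mu>)\<close> be the \<open>\<mu>\<close>-mass of the points
\<open>y \<in> B\<^sub>1\<close> at which \<open>T\<^sub>y\<^sup>*\<mu> \<in> E\<close> and \<open>\<mu> \<in> E\<close> disagree. By invariance of \<open>E\<close>, \<open>g(S\<^sub>t\<^sup>*T\<^sub>x\<^sup>*\<mu>)\<close> is the
fraction of \<open>\<mu>\<close> near \<open>x\<close>, at scale \<open>e\<^sup>-\<^sup>t\<close>, lying on the wrong side of \<open>{z. T\<^sub>z\<^sup>*\<mu> \<in> E}\<close>. Its
\<open>\<mu>\<close>-integral over \<open>x\<close> tends to \<open>0\<close>; for this mean form of the density theorem a covering of \<open>B\<^sub>1\<close>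
by finitely many sets of small diameter replaces the Besicovitch theorem. By the quasi-Palm property
\<open>g \<circ> S\<^sub>n\<^sup>* \<longlonglongrightarrow> 0\<close> along a subsequence \<open>P\<close>-a.e., whereas all \<open>g \<circ> S\<^sub>n\<^sup>*\<close> have the same law under \<open>P\<close>.
Hence \<open>g = 0\<close> a.e., and zooming out, \<open>\<mu> \<in> E\<close> iff \<open>T\<^sub>x\<^sup>*\<mu> \<in> E\<close> for \<open>\<mu>\<close>-a.e. \<open>x\<close>.

Apply this to the sets \<open>E\<close> of measures whose scenery at \<open>0\<close> visits an open set \<open>V\<close> of a countable base
with lower frequency at least \<open>q\<close>. A one-sided ergodic theorem, from the maximal inequality, gives
\<open>\<mu> \<in> E\<close> for \<open>P\<close>-a.e. \<open>\<mu>\<close> with \<open>q < P\<^sub>\<mu>\<^sup>\<box>(V)\<close>, hence the same lower bounds for the scenery at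
\<open>\<mu>\<close>-a.e. \<open>x\<close>. Lower bounds on the open sets of the base suffice for weak convergence.
\<close>


section \<open>Second countability of weak topologies\<close>

text \<open>The ergodic theorem controls the scenery of a \<open>P\<close>-typical measure at the
  point \<open>0\<close> only; the difficulty is to move this to almost every other point. The
  quasi-Palm property links \<open>P\<close> to the randomly recentred measure through null sets
  alone: it carries over almost sure statements but no rates. So smallness in mean must become
  almost sure convergence along a subsequence before it can cross, and nothing stronger is wanted
  from the density theorem, because under \<open>P\<close> the time \<open>n\<close> does not matter
  and one subsequence decides. Only lower frequency bounds are pursued since weak convergence tests
  \<open>f\<close> and \<open>- f\<close> alike: a lower bound for one is an upper bound for the
  other. Half of the pointwise ergodic theorem is then enough. Exceptional null sets may be
  discarded only countably often, which forces a countable base and rational \<open>q\<close>.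
  Countability is needed for measurability too: the weak topologies are generated by uncountably
  many integrals, and the preimage of an open set has to be reduced to countably many of
  them.\<close>

abbreviation Cc :: "('a::euclidean_space \<Rightarrow> real) set" where
  "Cc \<equiv> {f. continuous_on UNIV f \<and> compact (closure {x. f x \<noteq> 0})}"

abbreviation Cb :: "'a topology \<Rightarrow> ('a \<Rightarrow> real) set" where
  "Cb X \<equiv> {f. continuous_map X euclideanreal f \<and> bounded (f ` topspace X)}"

lemma topspace_weak_topology [simp]: "topspace (weak_topology A F) = A"
  by (auto simp: weak_topology_def topspace_pullback_topology)

lemma continuous_map_weak_topology:
  assumes "f \<in> F"
  shows "continuous_map (weak_topology A F) euclideanreal (\<lambda>\<nu>. integral\<^sup>L \<nu> f)"
proof -
  have "continuous_map (powertop_real F) euclideanreal (\<lambda>h. h f)"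
    using assms by (rule continuous_map_product_projection)
  from continuous_map_pullback[OF this, of A "\<lambda>\<nu>. \<lambda>f\<in>F. integral\<^sup>L \<nu> f"]
  show ?thesis
    using assms by (simp add: weak_topology_def o_def)
qed

text \<open>An upper bound on an integral is a lower bound for \<open>- f\<close>, so closure of
  \<open>F\<close> under negation lets the one-sided \<open>low\<close> capture whole
  neighbourhoods. Openness of the members of \<open>\<C>\<close> is left to the uses that want a
  base.\<close>

lemma weak_topology_base:
  assumes F: "\<And>f. f \<in> F \<Longrightarrow> (\<lambda>x. - f x) \<in> F"
    and low: "\<And>f \<nu> a. f \<in> F \<Longrightarrow> \<nu> \<in> A \<Longrightarrow> a < integral\<^sup>L \<nu> f \<Longrightarrow>
      \<exists>C\<in>\<C>. \<nu> \<in> C \<and> (\<forall>\<nu>'\<in>C. a < integral\<^sup>L \<nu>' f)"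
    and S: "openin (weak_topology A F) S" "\<nu> \<in> S"
  shows "\<exists>\<D>. finite \<D> \<and> \<D> \<subseteq> \<C> \<and> \<nu> \<in> A \<inter> \<Inter>\<D> \<and> A \<inter> \<Inter>\<D> \<subseteq> S"
proof -
  have \<nu>A: "\<nu> \<in> A"
    using S openin_subset by fastforce
  have nbh: "\<exists>\<D>. finite \<D> \<and> \<D> \<subseteq> \<C> \<and> \<nu> \<in> \<Inter>\<D> \<and> (\<forall>\<nu>'\<in>A \<inter> \<Inter>\<D>. integral\<^sup>L \<nu>' f \<in> V)"
    if f: "f \<in> F" and V: "open V" "integral\<^sup>L \<nu> f \<in> V" for f V
  proof -
    obtain e where e: "e > 0" "\<And>y. dist y (integral\<^sup>L \<nu> f) < e \<Longrightarrow> y \<in> V"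
      using V by (auto simp: open_dist)
    obtain C where C: "C \<in> \<C>" "\<nu> \<in> C" "\<forall>\<nu>'\<in>C. integral\<^sup>L \<nu> f - e < integral\<^sup>L \<nu>' f"
      using low[OF f \<nu>A, of "integral\<^sup>L \<nu> f - e"] e(1) by auto
    obtain C' where C': "C' \<in> \<C>" "\<nu> \<in> C'"
        "\<forall>\<nu>'\<in>C'. integral\<^sup>L \<nu> (\<lambda>x. - f x) - e < integral\<^sup>L \<nu>' (\<lambda>x. - f x)"
      using low[OF F[OF f] \<nu>A, of "integral\<^sup>L \<nu> (\<lambda>x. - f x) - e"] e(1) by auto
    have "integral\<^sup>L \<nu>' f \<in> V" if "\<nu>' \<in> C" "\<nu>' \<in> C'" for \<nu>'
      using C(3) C'(3) that by (intro e(2)) (auto simp: dist_real_def abs_less_iff)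
    then show ?thesis
      using C C' by (intro exI[of _ "{C, C'}"]) auto
  qed
  obtain U where U: "openin (powertop_real F) U" "S = (\<lambda>\<nu>. \<lambda>f\<in>F. integral\<^sup>L \<nu> f) -` U \<inter> A"
    using S(1) by (auto simp: weak_topology_def openin_pullback_topology)
  have "(\<lambda>f\<in>F. integral\<^sup>L \<nu> f) \<in> U"
    using S(2) U(2) by auto
  then obtain V where V: "finite {f \<in> F. V f \<noteq> UNIV}" "\<And>f. f \<in> F \<Longrightarrow> open (V f)"
      "(\<lambda>f\<in>F. integral\<^sup>L \<nu> f) \<in> Pi\<^sub>E F V" "Pi\<^sub>E F V \<subseteq> U"
    using U(1) unfolding openin_product_topology_alt by auto
  have "\<forall>f. \<exists>\<D>. f \<in> F \<longrightarrow> finite \<D> \<and> \<D> \<subseteq> \<C> \<and> \<nu> \<in> \<Inter>\<D> \<and> (\<forall>\<nu>'\<in>A \<inter> \<Inter>\<D>. integral\<^sup>L \<nu>' f \<in> V f)"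
    using nbh V(2,3) by (metis PiE_mem restrict_apply')
  then obtain \<D> where \<D>: "\<And>f. f \<in> F \<Longrightarrow> finite (\<D> f)" "\<And>f. f \<in> F \<Longrightarrow> \<D> f \<subseteq> \<C>"
    "\<And>f. f \<in> F \<Longrightarrow> \<nu> \<in> \<Inter>(\<D> f)" "\<And>f \<nu>'. f \<in> F \<Longrightarrow> \<nu>' \<in> A \<inter> \<Inter>(\<D> f) \<Longrightarrow> integral\<^sup>L \<nu>' f \<in> V f"
    by metis
  \<comment> \<open>Only the finitely many coordinates that the product neighbourhood restricts
    contribute sets.\<close>
  let ?D = "\<Union>(\<D> ` {f \<in> F. V f \<noteq> UNIV})"
  have "\<nu>' \<in> S" if "\<nu>' \<in> A \<inter> \<Inter>?D" for \<nu>'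
  proof -
    have "integral\<^sup>L \<nu>' f \<in> V f" if f: "f \<in> F" for f
    proof (cases "V f = UNIV")
      case False
      then show ?thesis
        using \<open>\<nu>' \<in> A \<inter> \<Inter>?D\<close> f by (intro \<D>(4)) auto
    qed simp
    then have "(\<lambda>f\<in>F. integral\<^sup>L \<nu>' f) \<in> U"
      using V(4) by auto
    then show ?thesis
      using that U(2) by auto
  qed
  moreover have "finite ?D" "?D \<subseteq> \<C>" "\<nu> \<in> A \<inter> \<Inter>?D"
    using V(1) \<D> \<nu>A by auto
  ultimately show ?thesis
    by (intro exI[of _ ?D]) auto
qed

lemma sets_borel_of: "sets (borel_of X) = sigma_sets (topspace X) {U. openin X U}"
  unfolding borel_of_def by (rule sets_measure_of) (auto dest: openin_subset)

lemma space_borel_of [simp]: "space (borel_of X) = topspace X"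
  unfolding borel_of_def by (rule space_measure_of) (auto dest: openin_subset)

lemma openin_in_borel_of: "openin X U \<Longrightarrow> U \<in> sets (borel_of X)"
  by (auto simp: sets_borel_of)

lemma measurable_borel_ofI:
  assumes "\<And>x. x \<in> space N \<Longrightarrow> h x \<in> topspace X"
    and "\<And>U. openin X U \<Longrightarrow> h -` U \<inter> space N \<in> sets N"
  shows "h \<in> N \<rightarrow>\<^sub>M borel_of X"
  unfolding borel_of_def
  by (rule measurable_measure_of) (use assms in \<open>auto dest: openin_subset\<close>)

lemma borel_measurable_continuous_map:
  assumes "continuous_map X euclideanreal f"
  shows "f \<in> borel_measurable (borel_of X)"
proof (rule borel_measurableI)
  fix S :: "real set" assume "open S"
  then have "openin X {x \<in> topspace X. f x \<in> S}"
    using assms by (auto simp: continuous_map_def)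
  moreover have "f -` S \<inter> space (borel_of X) = {x \<in> topspace X. f x \<in> S}"
    by auto
  ultimately show "f -` S \<inter> space (borel_of X) \<in> sets (borel_of X)"
    by (simp add: openin_in_borel_of)
qed

text \<open>Every open set is a union of finite intersections of members of \<open>\<C>\<close>, and
  a countable \<open>\<C>\<close> has only countably many finite subfamilies.\<close>

lemma measurable_weak_topologyI:
  assumes F: "\<And>f. f \<in> F \<Longrightarrow> (\<lambda>x. - f x) \<in> F"
    and \<C>: "countable \<C>"
    and low: "\<And>f \<nu> a. f \<in> F \<Longrightarrow> \<nu> \<in> A \<Longrightarrow> a < integral\<^sup>L \<nu> f \<Longrightarrow>
      \<exists>C\<in>\<C>. \<nu> \<in> C \<and> (\<forall>\<nu>'\<in>C. a < integral\<^sup>L \<nu>' f)"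
    and h: "\<And>x. x \<in> space N \<Longrightarrow> h x \<in> A"
    and meas: "\<And>C. C \<in> \<C> \<Longrightarrow> h -` C \<inter> space N \<in> sets N"
  shows "h \<in> N \<rightarrow>\<^sub>M borel_of (weak_topology A F)"
proof (rule measurable_borel_ofI)
  fix S assume S: "openin (weak_topology A F) S"
  define DD where "DD = {\<D>. \<D> \<subseteq> \<C> \<and> finite \<D> \<and> A \<inter> \<Inter>\<D> \<subseteq> S}"
  have fin: "countable DD"
    unfolding DD_def by (rule countable_subset[OF _ countable_Collect_finite_subset[OF \<C>]]) auto
  have S_eq: "S = (\<Union>\<D>\<in>DD. A \<inter> \<Inter>\<D>)"
  proof (intro equalityI subsetI)
    fix \<nu> assume "\<nu> \<in> S"
    have "\<exists>\<D>. finite \<D> \<and> \<D> \<subseteq> \<C> \<and> \<nu> \<in> A \<inter> \<Inter>\<D> \<and> A \<inter> \<Inter>\<D> \<subseteq> S"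
      by (rule weak_topology_base[where F = F and \<C> = \<C>, OF _ _ S \<open>\<nu> \<in> S\<close>]) (erule F, erule (2) low)
    then show "\<nu> \<in> (\<Union>\<D>\<in>DD. A \<inter> \<Inter>\<D>)"
      by (auto simp: DD_def)
  qed (auto simp: DD_def)
  have "h -` S \<inter> space N = (\<Union>\<D>\<in>DD. h -` (A \<inter> \<Inter>\<D>) \<inter> space N)"
    by (subst S_eq) auto
  also have "\<dots> \<in> sets N"
  proof (rule sets.countable_UN''[OF fin])
    fix \<D> assume "\<D> \<in> DD"
    then have "finite \<D>" "\<D> \<subseteq> \<C>"
      by (auto simp: DD_def)
    then show "h -` (A \<inter> \<Inter>\<D>) \<inter> space N \<in> sets N"
    proof (induction)
      case empty
      have "h -` (A \<inter> \<Inter>{}) \<inter> space N = space N"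
        using h by auto
      then show ?case
        by simp
    next
      case (insert C \<D>)
      have "h -` (A \<inter> \<Inter>(insert C \<D>)) \<inter> space N =
          (h -` C \<inter> space N) \<inter> (h -` (A \<inter> \<Inter>\<D>) \<inter> space N)"
        by auto
      also have "\<dots> \<in> sets N"
        by (rule sets.Int[OF meas insert.IH]) (use insert.prems in auto)
      finally show ?case .
    qed
  qed
  finally show "h -` S \<inter> space N \<in> sets N" .
qed (use h in simp)

text \<open>Closing the base under finite unions makes every open set an increasing union of its
  members; continuity of measures from below can then pick one member that carries almost all of the
  mass.\<close>

lemma weak_topology_countable_base:
  assumes F: "\<And>f. f \<in> F \<Longrightarrow> (\<lambda>x. - f x) \<in> F"
    and \<C>: "countable \<C>"
    and low: "\<And>f \<nu> a. f \<in> F \<Longrightarrow> \<nu> \<in> A \<Longrightarrow> a < integral\<^sup>L \<nu> f \<Longrightarrow>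
      \<exists>C\<in>\<C>. \<nu> \<in> C \<and> (\<forall>\<nu>'\<in>C. a < integral\<^sup>L \<nu>' f)"
    and op: "\<And>C. C \<in> \<C> \<Longrightarrow> openin (weak_topology A F) C"
  shows "\<exists>\<B>. countable \<B> \<and> (\<forall>V\<in>\<B>. openin (weak_topology A F) V) \<and>
    (\<forall>S. openin (weak_topology A F) S \<longrightarrow> (\<exists>V. range V \<subseteq> \<B> \<and> incseq V \<and> S = (\<Union>i::nat. V i)))"
proof -
  let ?X = "weak_topology A F"
  let ?I = "(\<lambda>\<D>. A \<inter> \<Inter>\<D>) ` {\<D>. \<D> \<subseteq> \<C> \<and> finite \<D>}"
  let ?B = "\<Union> ` {\<D>. \<D> \<subseteq> ?I \<and> finite \<D>}"
  have cI: "countable ?I"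
    using countable_Collect_finite_subset[OF \<C>] by (intro countable_image) (simp add: conj_commute)
  then have cB: "countable ?B"
    using countable_Collect_finite_subset[OF cI] by (intro countable_image) (simp add: conj_commute)
  have opI: "openin ?X W" if W: "W \<in> ?I" for W
  proof -
    obtain \<D> where \<D>: "\<D> \<subseteq> \<C>" "finite \<D>" "W = A \<inter> \<Inter>\<D>"
      using W by auto
    have "openin ?X (topspace ?X \<inter> \<Inter>\<D>)"
      using \<D>(1) op by (intro openin_Int_Inter[OF \<D>(2) openin_topspace]) auto
    then show ?thesis
      using \<D>(3) by simp
  qed
  have opB: "openin ?X V" if "V \<in> ?B" for V
    using that opI by (auto intro!: openin_Union)
  have main: "\<exists>V. range V \<subseteq> ?B \<and> incseq V \<and> S = (\<Union>i::nat. V i)" if S: "openin ?X S" for S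
  proof -
    \<comment> \<open>\<open>{}\<close> makes \<open>?W\<close> nonempty, as its enumeration
      requires; it may fail to belong to \<open>?I\<close>, so the definition of \<open>V\<close>
      removes it again.\<close>
    let ?W = "insert {} {W \<in> ?I. W \<subseteq> S}"
    have cW: "countable ?W" "?W \<noteq> {}"
      using countable_subset[OF _ cI, of "{W \<in> ?I. W \<subseteq> S}"] by auto
    have W: "range (from_nat_into ?W) = ?W"
      by (rule range_from_nat_into[OF cW(2,1)])
    define V where "V i = \<Union>(from_nat_into ?W ` {..i} - {{}})" for i :: nat
    have "V i \<in> ?B" for i
    proof -
      have "from_nat_into ?W ` {..i} \<subseteq> range (from_nat_into ?W)"
        by (rule image_mono) simp
      then have "from_nat_into ?W ` {..i} \<subseteq> ?W"
        by (simp only: W)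
      then have "from_nat_into ?W ` {..i} - {{}} \<in> {\<D>. \<D> \<subseteq> ?I \<and> finite \<D>}"
        by blast
      then show ?thesis
        unfolding V_def by (rule imageI)
    qed
    moreover have "incseq V"
      unfolding V_def by (intro monoI Union_mono Diff_mono image_mono) auto
    moreover have "S = (\<Union>i. V i)"
    proof -
      have "(\<Union>i. V i) = \<Union>(range (from_nat_into ?W))"
        unfolding V_def by auto
      also have "\<dots> = \<Union>?W"
        by (simp only: W)
      also have "\<dots> = S"
      proof (intro equalityI subsetI)
        fix \<nu> assume "\<nu> \<in> S"
        have "\<exists>\<D>. finite \<D> \<and> \<D> \<subseteq> \<C> \<and> \<nu> \<in> A \<inter> \<Inter>\<D> \<and> A \<inter> \<Inter>\<D> \<subseteq> S"
          by (rule weak_topology_base[where F = F and \<C> = \<C>, OF _ _ S \<open>\<nu> \<in> S\<close>]) (erule F, erule (2) low)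
        then show "\<nu> \<in> \<Union>?W"
          by blast
      qed auto
      finally show ?thesis ..
    qed
    ultimately show ?thesis
      by blast
  qed
  show ?thesis
    by (intro exI[of _ ?B] conjI ballI allI impI) (fact cB, erule opB, erule main)
qed

lemma countable_lower_approximation:
  "\<exists>D :: ('a::euclidean_space \<Rightarrow> real) set. countable D \<and>
     (\<forall>g\<in>D. continuous_on UNIV g \<and> compact (closure {x. g x \<noteq> 0}) \<and> (\<forall>x. 0 \<le> g x)) \<and>
     (\<forall>S f. continuous_on S f \<longrightarrow> (\<forall>x\<in>S. 0 \<le> f x) \<longrightarrow>
       (\<exists>g. range g \<subseteq> D \<and> (\<forall>k::nat. \<forall>x\<in>S. g k x \<le> f x) \<and>
            (\<forall>x\<in>S. (\<lambda>k. g k x) \<longlonglongrightarrow> f x)))"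
proof -
  obtain C :: "'a set" where C: "countable C" "\<And>U. open U \<Longrightarrow> U \<noteq> {} \<Longrightarrow> \<exists>d\<in>C. d \<in> U"
    by (rule countable_dense_setE) blast
  define tent where "tent q k c = (\<lambda>x. max 0 (q - real (Suc k) * dist x c))" for q k and c :: 'a
  define D0 where "D0 = (\<lambda>(q, k, c). tent q k c) ` ((\<rat> \<inter> {0..}) \<times> UNIV \<times> C)"
  define D where "D = (\<lambda>W x. Max ((\<lambda>\<tau>. \<tau> x) ` W)) ` {W. W \<subseteq> D0 \<and> finite W \<and> W \<noteq> {}}"
  have cD0: "countable D0"
    unfolding D0_def using C(1) countable_rat by (intro countable_image countable_SIGMA) auto
  have "countable {W. W \<subseteq> D0 \<and> finite W \<and> W \<noteq> {}}"
    by (rule countable_subset[OF _ countable_Collect_finite_subset[OF cD0]]) auto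
  then have cD: "countable D"
    unfolding D_def by (rule countable_image)
  have cont0: "continuous_on UNIV \<tau>" if "\<tau> \<in> D0" for \<tau>
    using that by (auto simp: D0_def tent_def intro!: continuous_intros)
  have pos0: "0 \<le> \<tau> x" if "\<tau> \<in> D0" for \<tau> x
    using that by (auto simp: D0_def tent_def)
  have bdd0: "bounded {x. \<tau> x \<noteq> 0}" if \<tau>D: "\<tau> \<in> D0" for \<tau>
  proof -
    obtain q k c where \<tau>: "\<tau> = tent q k c"
      using \<tau>D by (auto simp: D0_def)
    have "x \<in> cball c q" if "\<tau> x \<noteq> 0" for x
    proof -
      have "real (Suc k) * dist x c < q"
        using that by (auto simp: \<tau> tent_def max_def split: if_splits)
      moreover have "dist x c * 1 \<le> dist x c * real (Suc k)"
        by (intro mult_left_mono) auto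
      ultimately show ?thesis
        by (simp add: dist_commute mult.commute)
    qed
    then show ?thesis
      by (intro bounded_subset[OF bounded_cball]) auto
  qed
  have D: "continuous_on UNIV g \<and> compact (closure {x. g x \<noteq> 0}) \<and> (\<forall>x. 0 \<le> g x)" if gD: "g \<in> D" for g
  proof -
    obtain W where W: "W \<subseteq> D0" "finite W" "W \<noteq> {}" and g: "g = (\<lambda>x. Max ((\<lambda>\<tau>. \<tau> x) ` W))"
      using gD by (auto simp: D_def)
    have cont: "continuous_on UNIV (\<lambda>x. Max ((\<lambda>\<tau>. \<tau> x) ` W))"
      using W(2,3,1)
    proof (induction rule: finite_ne_induct)
      case (insert \<tau> W)
      then have "(\<lambda>x. Max ((\<lambda>\<tau>. \<tau> x) ` insert \<tau> W)) = (\<lambda>x. max (\<tau> x) (Max ((\<lambda>\<tau>. \<tau> x) ` W)))"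
        by (simp add: fun_eq_iff)
      then show ?case
        using insert cont0 by (auto intro!: continuous_intros)
    qed (auto intro: cont0)
    moreover have mem: "\<exists>\<tau>\<in>W. g x = \<tau> x" for x
    proof -
      have "Max ((\<lambda>\<tau>. \<tau> x) ` W) \<in> (\<lambda>\<tau>. \<tau> x) ` W"
        using W by (intro Max_in) auto
      then show ?thesis
        by (auto simp: g)
    qed
    have "0 \<le> g x" for x
      using mem[of x] pos0 W(1) by auto
    moreover have "bounded {x. g x \<noteq> 0}"
    proof (rule bounded_subset)
      show "bounded (\<Union>\<tau>\<in>W. {x. \<tau> x \<noteq> 0})"
        using W by (auto intro!: bounded_UN bdd0)
      show "{x. g x \<noteq> 0} \<subseteq> (\<Union>\<tau>\<in>W. {x. \<tau> x \<noteq> 0})"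
      proof
        fix x assume "x \<in> {x. g x \<noteq> 0}"
        with mem[of x] show "x \<in> (\<Union>\<tau>\<in>W. {x. \<tau> x \<noteq> 0})"
          by auto
      qed
    qed
    ultimately show ?thesis
      unfolding g by simp
  qed
  have approx: "\<exists>\<tau>\<in>D0. (\<forall>y\<in>S. \<tau> y \<le> f y) \<and> s < \<tau> x"
    if f: "continuous_on S f" "\<forall>x\<in>S. 0 \<le> f x" and x: "x \<in> S" "s < f x" for S f x s
  proof (cases "s < 0")
    case True
    \<comment> \<open>A negative level is exceeded by the zero function, which is a tent of height
      \<open>0\<close>.\<close>
    obtain c where "c \<in> C"
      using C(2)[of UNIV] by auto
    then have "tent 0 0 c \<in> D0"
      by (force simp: D0_def)
    moreover have "tent 0 0 c = (\<lambda>x. 0)"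
      by (auto simp: tent_def)
    ultimately show ?thesis
      using f True by force
  next
    case False
    obtain q where q: "q \<in> \<rat>" "s < q" "q < f x"
      using Rats_dense_in_real[OF x(2)] by auto
    obtain d where d: "d > 0" "\<And>y. y \<in> S \<Longrightarrow> dist y x < d \<Longrightarrow> dist (f y) (f x) < f x - q"
      using f(1) x(1) q(3) unfolding continuous_on_iff by (metis diff_gt_0_iff_gt)
    obtain k where k: "2 * q / d < real k"
      using reals_Archimedean2 by blast
    \<comment> \<open>The slope \<open>Suc k\<close> is steep enough for a tent of height
      \<open>q\<close> to vanish at distance \<open>d / 2\<close> from its centre.\<close>
    have k': "q < real (Suc k) * (d / 2)"
      using k d(1) by (simp add: field_simps)
    \<comment> \<open>The first bound keeps the tent positive only within distance \<open>d\<close>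
      of \<open>x\<close>, where \<open>f\<close> exceeds \<open>q\<close>; the second keeps its
      value at \<open>x\<close> above \<open>s\<close>.\<close>
    let ?e = "min (d / 2) ((q - s) / real (Suc k))"
    have "?e > 0"
      using d q by simp
    then have "ball x ?e \<noteq> {}"
      by (metis centre_in_ball empty_iff)
    then obtain c where "c \<in> C" "c \<in> ball x ?e"
      using C(2)[of "ball x ?e"] by blast
    then have c: "c \<in> C" "dist x c < ?e"
      by (simp_all only: mem_ball)
    have "tent q k c \<in> D0"
      using q False c by (auto simp: D0_def intro!: image_eqI[of _ _ "(q, k, c)"])
    moreover have "tent q k c y \<le> f y" if "y \<in> S" for y
    proof (cases "real (Suc k) * dist y c < q")
      case True
      then have "real (Suc k) * dist y c < real (Suc k) * (d / 2)"
        using k' by linarith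
      then have "dist y c < d / 2"
        by (subst (asm) mult_less_cancel_left_pos) simp_all
      moreover have "dist y x \<le> dist y c + dist x c"
        by (rule dist_triangle2)
      ultimately have "dist y x < d"
        using c by simp
      then have "dist (f y) (f x) < f x - q"
        using d that by blast
      then have "q < f y"
        by (simp add: dist_real_def)
      moreover have "tent q k c y \<le> q"
        using False q by (auto simp: tent_def)
      ultimately show ?thesis
        by simp
    next
      case False
      then show ?thesis
        using f that by (auto simp: tent_def)
    qed
    moreover have "s < tent q k c x"
    proof -
      have "dist x c < (q - s) / real (Suc k)"
        using c by simp
      then have "real (Suc k) * dist x c < q - s"
        by (simp add: field_simps)
      then show ?thesis
        by (simp add: tent_def)
    qed
    ultimately show ?thesis
      by blast
  qed
  have lower: "\<exists>g. range g \<subseteq> D \<and> (\<forall>k::nat. \<forall>x\<in>S. g k x \<le> f x) \<and>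
            (\<forall>x\<in>S. (\<lambda>k. g k x) \<longlonglongrightarrow> f x)"
    if f: "continuous_on S f" "\<forall>x\<in>S. 0 \<le> f x" for S f
  proof (cases "S = {}")
    case True
    obtain c where "c \<in> C"
      using C(2)[of UNIV] by auto
    then have "tent 0 0 c \<in> D0"
      by (force simp: D0_def)
    then have "{tent 0 0 c} \<in> {W. W \<subseteq> D0 \<and> finite W \<and> W \<noteq> {}}"
      by simp
    then have "(\<lambda>x. Max ((\<lambda>\<tau>. \<tau> x) ` {tent 0 0 c})) \<in> D" (is "?g \<in> D")
      unfolding D_def by (rule imageI)
    then have "range (\<lambda>_::nat. ?g) \<subseteq> D"
      by (simp only: image_subset_iff) simp
    then show ?thesis
      using True by (intro exI[of _ "\<lambda>_. ?g"]) simp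
  next
    case False
    define T where "T = {\<tau> \<in> D0. \<forall>y\<in>S. \<tau> y \<le> f y}"
    obtain x0 where "x0 \<in> S"
      using False by auto
    then have T: "T \<noteq> {}" "countable T"
      using approx[OF f, of x0 "f x0 - 1"] countable_subset[OF _ cD0, of T] by (auto simp: T_def)
    define \<tau> where "\<tau> = from_nat_into T"
    have \<tau>: "range \<tau> = T"
      unfolding \<tau>_def by (rule range_from_nat_into[OF T])
    define g where "g k = (\<lambda>x. Max ((\<lambda>\<tau>. \<tau> x) ` (\<tau> ` {..k})))" for k :: nat
    have gD: "range g \<subseteq> D"
    proof
      fix h assume "h \<in> range g"
      then obtain k where h: "h = g k"
        by auto
      have "\<tau> ` {..k} \<in> {W. W \<subseteq> D0 \<and> finite W \<and> W \<noteq> {}}"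
        using \<tau> by (auto simp: T_def)
      then show "h \<in> D"
        unfolding D_def h g_def by (rule image_eqI[rotated]) simp
    qed
    have le: "g k x \<le> f x" if "x \<in> S" for k x
      unfolding g_def using \<tau> that by (subst Max_le_iff) (auto simp: T_def)
    have "(\<lambda>k. g k x) \<longlonglongrightarrow> f x" if x: "x \<in> S" for x
    proof (rule order_tendstoI)
      fix a assume "a < f x"
      then obtain \<tau>' where \<tau>': "\<tau>' \<in> T" "a < \<tau>' x"
        using approx[OF f x] by (auto simp: T_def)
      then obtain i where i: "\<tau>' = \<tau> i"
        using \<tau> by (auto simp: image_iff)
      have "a < g k x" if "i \<le> k" for k
        using \<tau>'(2) that unfolding g_def i by (subst Max_gr_iff) auto
      then show "\<forall>\<^sub>F k in sequentially. a < g k x"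
        by (auto simp: eventually_sequentially)
    next
      fix a assume "f x < a"
      then show "\<forall>\<^sub>F k in sequentially. g k x < a"
        by (intro always_eventually allI le_less_trans[OF le[OF x]])
    qed
    then show ?thesis
      using gD le by (intro exI[of _ g] conjI allI ballI)
  qed
  show ?thesis
    by (intro exI[of _ D] conjI[OF cD] conjI ballI allI impI) (erule D[THEN conjunct1], erule D[THEN conjunct2, THEN conjunct1], use D in blast, erule (1) lower)
qed

text \<open>Covers the two cases at hand: Radon measures tested on \<open>Cc\<close>, and
  probability measures on \<open>S\<close> tested on \<open>Cb\<close>. Adding a multiple of some
  \<open>h\<close> from the countable \<open>H\<close> makes a test function nonnegative, so that it
  can be approximated from below.\<close>

locale test_functions =
  fixes S :: "'a::euclidean_space set" and A :: "'a measure set" and F H :: "('a \<Rightarrow> real) set"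
  assumes countable_H: "countable H" and H_F: "H \<subseteq> F"
    and continuous_F: "f \<in> F \<Longrightarrow> continuous_on S f"
    and Cc_F: "continuous_on UNIV f \<Longrightarrow> compact (closure {x. f x \<noteq> 0}) \<Longrightarrow> f \<in> F"
    and diff_F: "f \<in> F \<Longrightarrow> g \<in> F \<Longrightarrow> (\<lambda>x. f x - c * g x) \<in> F"
    and dominated: "f \<in> F \<Longrightarrow> \<exists>h\<in>H. \<exists>m::nat. \<forall>x\<in>S. \<bar>f x\<bar> \<le> real m * h x"
    and integrable_F: "\<nu> \<in> A \<Longrightarrow> f \<in> F \<Longrightarrow> integrable \<nu> f"
    and space_A: "\<nu> \<in> A \<Longrightarrow> space \<nu> = S"
begin

lemma uminus_F: "f \<in> F \<Longrightarrow> (\<lambda>x. - f x) \<in> F"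
  using diff_F[of "\<lambda>_. 0" f 1] Cc_F[of "\<lambda>_. 0"] by simp

text \<open>With \<open>f + m * h \<ge> 0\<close> on \<open>S\<close>, let functions
  \<open>g k\<close> of the countable family converge to it from below. Then
  \<open>g k - m * h \<le> f\<close> there, and for large \<open>k\<close> its integral exceeds any
  \<open>a\<close> below that of \<open>f\<close>. Rational thresholds leave countably many
  half-spaces.\<close>

lemma countable_subbase:
  obtains \<C> where "countable \<C>"
    and "\<And>C. C \<in> \<C> \<Longrightarrow> \<exists>g\<in>F. \<exists>q. C = {\<nu> \<in> A. q < integral\<^sup>L \<nu> g}"
    and "\<And>f \<nu> a. f \<in> F \<Longrightarrow> \<nu> \<in> A \<Longrightarrow> a < integral\<^sup>L \<nu> f \<Longrightarrow>
      \<exists>C\<in>\<C>. \<nu> \<in> C \<and> (\<forall>\<nu>'\<in>C. a < integral\<^sup>L \<nu>' f)"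
proof -
  obtain D :: "('a \<Rightarrow> real) set" where cD: "countable D"
    and D: "\<And>g. g \<in> D \<Longrightarrow> continuous_on UNIV g"
      "\<And>g. g \<in> D \<Longrightarrow> compact (closure {x. g x \<noteq> 0})"
      "\<And>g x. g \<in> D \<Longrightarrow> 0 \<le> g x"
    and lower: "\<And>S f. continuous_on S f \<Longrightarrow> \<forall>x\<in>S. 0 \<le> f x \<Longrightarrow>
       (\<exists>g. range g \<subseteq> D \<and> (\<forall>k::nat. \<forall>x\<in>S. g k x \<le> f x) \<and>
            (\<forall>x\<in>S. (\<lambda>k. g k x) \<longlonglongrightarrow> f x))"
    using countable_lower_approximation[where 'a = 'a] by metis
  have D_F: "g \<in> F" if "g \<in> D" for g
    by (rule Cc_F[OF D(1)[OF that] D(2)[OF that]])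
  define G where "G g m h = (\<lambda>x. g x - real m * h x)" for g h :: "'a \<Rightarrow> real" and m
  define \<C> where "\<C> = (\<lambda>(g, m, h, q). {\<nu> \<in> A. q < integral\<^sup>L \<nu> (G g m h)}) ` (D \<times> UNIV \<times> H \<times> \<rat>)"
  have G_F: "G g m h \<in> F" if "g \<in> D" "h \<in> H" for g m h
    unfolding G_def using D_F[OF that(1)] H_F that(2) by (intro diff_F) auto
  show thesis
  proof (rule that[of \<C>])
    show "countable \<C>"
      unfolding \<C>_def by (intro countable_image countable_SIGMA cD countable_rat countable_H) auto
    show "\<exists>g\<in>F. \<exists>q. C = {\<nu> \<in> A. q < integral\<^sup>L \<nu> g}" if C: "C \<in> \<C>" for C
    proof -
      obtain g m h q where "g \<in> D" "h \<in> H" "C = {\<nu> \<in> A. q < integral\<^sup>L \<nu> (G g m h)}"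
        using C by (auto simp: \<C>_def)
      then show ?thesis
        using G_F[of g h m] by blast
    qed
    fix f \<nu> a assume f: "f \<in> F" and \<nu>: "\<nu> \<in> A" and a: "a < integral\<^sup>L \<nu> f"
    obtain h m where h: "h \<in> H" and m: "\<And>x. x \<in> S \<Longrightarrow> \<bar>f x\<bar> \<le> real m * h x"
      using dominated[OF f] by blast
    have hF: "h \<in> F"
      using h H_F by auto
    let ?f = "\<lambda>x. f x + real m * h x"
    have cont: "continuous_on S ?f"
      by (intro continuous_intros continuous_F f hF)
    have nonneg: "\<forall>x\<in>S. 0 \<le> ?f x"
    proof
      fix x assume "x \<in> S"
      from m[OF this] show "0 \<le> ?f x"
        by linarith
    qed
    obtain g where g: "range g \<subseteq> D" "\<And>k x. x \<in> S \<Longrightarrow> g k x \<le> ?f x"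
        "\<And>x. x \<in> S \<Longrightarrow> (\<lambda>k. g k x) \<longlonglongrightarrow> ?f x"
      using lower[OF cont nonneg] by auto
    have gD: "g k \<in> D" for k
      using g(1) by auto
    have int_h: "integrable \<nu>' (\<lambda>x. real m * h x)" if "\<nu>' \<in> A" for \<nu>'
      using integrable_F[OF that hF] by simp
    have int_f: "integrable \<nu> ?f"
      by (intro Bochner_Integration.integrable_add integrable_F[OF \<nu> f] int_h[OF \<nu>])
    have int_g: "integrable \<nu>' (g k)" if "\<nu>' \<in> A" for \<nu>' k
      by (rule integrable_F[OF that D_F[OF gD]])
    \<comment> \<open>The nonnegative \<open>g k\<close> are dominated by their own limit.\<close>
    have "(\<lambda>k. integral\<^sup>L \<nu> (g k)) \<longlonglongrightarrow> integral\<^sup>L \<nu> ?f"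
    proof (rule integral_dominated_convergence[where w = ?f])
      show "AE x in \<nu>. norm (g k x) \<le> ?f x" for k
        using g(2)[of _ k] D(3)[OF gD] by (intro AE_I2) (simp add: space_A[OF \<nu>])
      show "AE x in \<nu>. (\<lambda>k. g k x) \<longlonglongrightarrow> ?f x"
        using g(3) by (intro AE_I2) (simp add: space_A[OF \<nu>])
      show "?f \<in> borel_measurable \<nu>" "g k \<in> borel_measurable \<nu>" for k
        using int_f int_g[OF \<nu>] by (auto intro: borel_measurable_integrable)
    qed (rule int_f)
    moreover have "integral\<^sup>L \<nu> ?f = integral\<^sup>L \<nu> f + integral\<^sup>L \<nu> (\<lambda>x. real m * h x)"
      by (rule Bochner_Integration.integral_add[OF integrable_F[OF \<nu> f] int_h[OF \<nu>]])
    then have "a + integral\<^sup>L \<nu> (\<lambda>x. real m * h x) < integral\<^sup>L \<nu> ?f"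
      using a by simp
    ultimately have "\<forall>\<^sub>F k in sequentially. a + integral\<^sup>L \<nu> (\<lambda>x. real m * h x) < integral\<^sup>L \<nu> (g k)"
      by (rule order_tendstoD(1))
    then obtain k where k: "a + integral\<^sup>L \<nu> (\<lambda>x. real m * h x) < integral\<^sup>L \<nu> (g k)"
      by (auto simp: eventually_sequentially)
    have "integral\<^sup>L \<nu> (G (g k) m h) = integral\<^sup>L \<nu> (g k) - integral\<^sup>L \<nu> (\<lambda>x. real m * h x)"
      unfolding G_def by (rule Bochner_Integration.integral_diff[OF int_g[OF \<nu>] int_h[OF \<nu>]])
    then obtain q where q: "q \<in> \<rat>" "a < q" "q < integral\<^sup>L \<nu> (G (g k) m h)"
      using k Rats_dense_in_real[of a "integral\<^sup>L \<nu> (G (g k) m h)"] by auto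
    show "\<exists>C\<in>\<C>. \<nu> \<in> C \<and> (\<forall>\<nu>'\<in>C. a < integral\<^sup>L \<nu>' f)"
    proof (intro bexI[of _ "{\<nu> \<in> A. q < integral\<^sup>L \<nu> (G (g k) m h)}"] conjI ballI)
      fix \<nu>' assume \<nu>': "\<nu>' \<in> {\<nu> \<in> A. q < integral\<^sup>L \<nu> (G (g k) m h)}"
      then have A: "\<nu>' \<in> A"
        by simp
      have "integral\<^sup>L \<nu>' (G (g k) m h) \<le> integral\<^sup>L \<nu>' f"
      proof (rule integral_mono[OF integrable_F[OF A G_F[OF gD h]] integrable_F[OF A f]])
        fix x assume "x \<in> space \<nu>'"
        then show "G (g k) m h x \<le> f x"
          using g(2)[of x k] by (simp add: G_def space_A[OF A])
      qed
      then show "a < integral\<^sup>L \<nu>' f"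
        using \<nu>' q(2) by simp
    next
      show "{\<nu> \<in> A. q < integral\<^sup>L \<nu> (G (g k) m h)} \<in> \<C>"
        unfolding \<C>_def using gD h q(1) by (intro image_eqI[of _ _ "(g k, m, h, q)"]) auto
    qed (use \<nu> q in auto)
  qed
qed

lemma measurable_borel_of_weak_topologyI:
  assumes h: "\<And>x. x \<in> space N \<Longrightarrow> h x \<in> A"
    and [measurable]: "\<And>f. f \<in> F \<Longrightarrow> (\<lambda>x. integral\<^sup>L (h x) f) \<in> borel_measurable N"
  shows "h \<in> N \<rightarrow>\<^sub>M borel_of (weak_topology A F)"
proof -
  obtain \<C> where \<C>: "countable \<C>"
    and C: "\<And>C. C \<in> \<C> \<Longrightarrow> \<exists>g\<in>F. \<exists>q. C = {\<nu> \<in> A. q < integral\<^sup>L \<nu> g}"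
    and low: "\<And>f \<nu> a. f \<in> F \<Longrightarrow> \<nu> \<in> A \<Longrightarrow> a < integral\<^sup>L \<nu> f \<Longrightarrow>
      \<exists>C\<in>\<C>. \<nu> \<in> C \<and> (\<forall>\<nu>'\<in>C. a < integral\<^sup>L \<nu>' f)"
    by (rule countable_subbase) blast
  show ?thesis
  proof (rule measurable_weak_topologyI[OF uminus_F \<C> low h])
    fix C assume "C \<in> \<C>"
    then obtain g q where g [measurable]: "g \<in> F" and C_eq: "C = {\<nu> \<in> A. q < integral\<^sup>L \<nu> g}"
      using C by blast
    have "h -` C \<inter> space N = {x \<in> space N. q < integral\<^sup>L (h x) g}"
      using h by (auto simp: C_eq)
    also have "\<dots> \<in> sets N"
      using assms(2)[OF g] by measurable
    finally show "h -` C \<inter> space N \<in> sets N" .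
  qed
qed

lemma countable_base:
  "\<exists>\<B>. countable \<B> \<and> (\<forall>V\<in>\<B>. openin (weak_topology A F) V) \<and>
    (\<forall>U. openin (weak_topology A F) U \<longrightarrow> (\<exists>V. range V \<subseteq> \<B> \<and> incseq V \<and> U = (\<Union>i::nat. V i)))"
proof -
  obtain \<C> where \<C>: "countable \<C>"
    and C: "\<And>C. C \<in> \<C> \<Longrightarrow> \<exists>g\<in>F. \<exists>q. C = {\<nu> \<in> A. q < integral\<^sup>L \<nu> g}"
    and low: "\<And>f \<nu> a. f \<in> F \<Longrightarrow> \<nu> \<in> A \<Longrightarrow> a < integral\<^sup>L \<nu> f \<Longrightarrow>
      \<exists>C\<in>\<C>. \<nu> \<in> C \<and> (\<forall>\<nu>'\<in>C. a < integral\<^sup>L \<nu>' f)"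
    by (rule countable_subbase) blast
  show ?thesis
  proof (rule weak_topology_countable_base[OF uminus_F \<C> low])
    fix C assume "C \<in> \<C>"
    then obtain g q where g: "g \<in> F" and C_eq: "C = {\<nu> \<in> A. q < integral\<^sup>L \<nu> g}"
      using C by blast
    have "openin (weak_topology A F) {\<nu> \<in> topspace (weak_topology A F). integral\<^sup>L \<nu> g \<in> {q<..}}"
      by (rule openin_continuous_map_preimage[OF continuous_map_weak_topology[OF g]]) simp
    then show "openin (weak_topology A F) C"
      by (simp add: C_eq)
  qed
qed

end

section \<open>Measurable families of Radon measures\<close>

lemma emeasure_radon_bounded:
  assumes "\<mu> \<in> radon" "bounded A"
  shows "emeasure \<mu> A < \<infinity>"
proof -
  have "emeasure \<mu> A \<le> emeasure \<mu> (closure A)"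
    using assms(1) by (intro emeasure_mono closure_subset) (auto simp: radon_def)
  also have "\<dots> < \<infinity>"
    using assms by (auto simp: radon_def compact_closure)
  finally show ?thesis .
qed

lemma measurable_congI:
  assumes "g \<in> M \<rightarrow>\<^sub>M N" "\<And>x. x \<in> space M \<Longrightarrow> f x = g x"
  shows "f \<in> M \<rightarrow>\<^sub>M N"
  using assms measurable_cong[of M f g N] by blast

lemma integrable_Cc:
  assumes \<mu>: "\<mu> \<in> radon" and f: "continuous_on UNIV f" "compact (closure {x. f x \<noteq> 0})"
  shows "integrable \<mu> (f :: real^'n \<Rightarrow> real)"
proof -
  let ?K = "closure {x. f x \<noteq> 0}"
  have "bounded (f ` ?K)"
    using f by (intro compact_imp_bounded compact_continuous_image) (auto intro: continuous_on_subset)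
  then obtain B where B: "\<And>x. x \<in> ?K \<Longrightarrow> norm (f x) \<le> B"
    by (auto simp: bounded_iff)
  have 0: "f x = 0" if "x \<notin> ?K" for x
    using that closure_subset[of "{x. f x \<noteq> 0}"] by auto
  have [measurable]: "f \<in> borel_measurable \<mu>"
    using borel_measurable_continuous_onI[OF f(1)] \<mu>
    by (simp add: radon_def cong: measurable_cong_sets)
  show ?thesis
  proof (rule integrableI_bounded_set[of ?K _ _ B])
    show "?K \<in> sets \<mu>" "emeasure \<mu> ?K < \<infinity>"
      using \<mu> f(2) by (auto simp: radon_def)
  qed (auto intro!: AE_I2 0 simp: B[simplified])
qed

context
  fixes h :: "'x \<Rightarrow> (real^'n) measure" and N
  assumes rad: "\<And>x. x \<in> space N \<Longrightarrow> h x \<in> radon"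
    and ev: "\<And>W. open W \<Longrightarrow> bounded W \<Longrightarrow> (\<lambda>x. emeasure (h x) W) \<in> borel_measurable N"
begin

text \<open>Cutting off outside the ball of radius \<open>k\<close> and scaling turns
  \<open>h\<close> into a subprobability kernel \<open>J k\<close>, whose measurability need only be
  tested on open sets, an intersection-stable generator. Scaling back and letting \<open>k\<close>
  grow recovers \<open>h\<close>.\<close>

lemma nn_integral_radon_measurable:
  assumes \<phi>: "(\<lambda>(x, z). \<phi> x z) \<in> borel_measurable (N \<Otimes>\<^sub>M borel)"
  shows "(\<lambda>x. \<integral>\<^sup>+z. \<phi> x z \<partial>h x) \<in> borel_measurable N"
proof -
  define B where "B k = ball (0 :: real^'n) (real k)" for k
  \<comment> \<open>The \<open>1 +\<close> keeps the factor finite and invertible even when the ball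
    is a null set.\<close>
  define c where "c k x = inverse (1 + emeasure (h x) (B k))" for k x
  define J where "J k x = scale_measure (c k x) (density (h x) (indicator (B k)))" for k x
  have B[measurable]: "B k \<in> sets borel" for k
    by (simp add: B_def)
  have sets_h: "sets (h x) = sets borel" if "x \<in> space N" for x
    using rad[OF that] by (simp add: radon_def)
  have sp_h: "space (h x) = UNIV" if "x \<in> space N" for x
    using sets_eq_imp_space_eq[OF sets_h[OF that]] by simp
  have fin: "emeasure (h x) (B k) < \<infinity>" if "x \<in> space N" for x k
    using rad[OF that] by (intro emeasure_radon_bounded) (auto simp: B_def)
  have J_eq: "emeasure (J k x) A = c k x * emeasure (h x) (B k \<inter> A)"
    if "x \<in> space N" "A \<in> sets borel" for k x A
    using that sets_h[of x] by (simp add: J_def emeasure_restricted)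
  have c_mult: "(1 + emeasure (h x) (B k)) * c k x = 1" if "x \<in> space N" for k x
    unfolding c_def divide_ennreal_def[symmetric]
    using fin[OF that, of k] by (intro ennreal_divide_self) auto
  have c_meas: "c k \<in> borel_measurable N" for k
    unfolding c_def using ev[of "B k"] by (auto simp: B_def)
  have "J k \<in> N \<rightarrow>\<^sub>M subprob_algebra borel" for k
  proof (rule measurable_subprob_algebra_generated[where G = "{S. open S}" and \<Omega> = UNIV])
    show "sets (borel :: (real^'n) measure) = sigma_sets UNIV {S. open S}"
      by (simp add: borel_def)
    show "Int_stable {S :: (real^'n) set. open S}"
      by (auto simp: Int_stable_def)
    show "subprob_space (J k x)" if "x \<in> space N" for x
    proof
      have sp: "space (J k x) = UNIV"
        by (simp add: J_def space_scale_measure sp_h[OF that])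
      have "emeasure (J k x) (space (J k x)) = emeasure (h x) (B k) * c k x"
        unfolding sp using that by (simp add: J_eq mult.commute)
      also have "\<dots> \<le> (1 + emeasure (h x) (B k)) * c k x"
        by (intro mult_right_mono) auto
      also have "\<dots> = 1"
        by (rule c_mult[OF that])
      finally show "emeasure (J k x) (space (J k x)) \<le> 1" .
      show "space (J k x) \<noteq> {}"
        by (simp add: sp)
    qed
    show "sets (J k x) = sets borel" if "x \<in> space N" for x
      by (simp add: J_def sets_h[OF that])
    have "(\<lambda>x. emeasure (J k x) A) \<in> borel_measurable N" if "open A" for A
    proof -
      have "open (B k \<inter> A)" "bounded (B k \<inter> A)"
        using that by (auto simp: B_def)
      then have [measurable]: "(\<lambda>x. emeasure (h x) (B k \<inter> A)) \<in> borel_measurable N"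
        by (rule ev)
      have "(\<lambda>x. c k x * emeasure (h x) (B k \<inter> A)) \<in> borel_measurable N"
        using c_meas[of k] by measurable
      moreover have "(\<lambda>x. emeasure (J k x) A) \<in> borel_measurable N \<longleftrightarrow>
          (\<lambda>x. c k x * emeasure (h x) (B k \<inter> A)) \<in> borel_measurable N"
        by (rule measurable_cong) (simp add: J_eq that)
      ultimately show ?thesis
        by simp
    qed
    then show "(\<lambda>x. emeasure (J k x) UNIV) \<in> borel_measurable N"
      "\<And>A. A \<in> {S. open S} \<Longrightarrow> (\<lambda>x. emeasure (J k x) A) \<in> borel_measurable N"
      by auto
  qed auto
  then have [measurable]: "(\<lambda>x. \<integral>\<^sup>+z. \<phi> x z \<partial>J k x) \<in> borel_measurable N" for k
    by (rule nn_integral_measurable_subprob_algebra2[OF \<phi>])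
  have [measurable]: "(\<lambda>x. emeasure (h x) (B k)) \<in> borel_measurable N" for k
    by (rule ev) (auto simp: B_def)
  have "(\<lambda>x. SUP k. (1 + emeasure (h x) (B k)) * (\<integral>\<^sup>+z. \<phi> x z \<partial>J k x)) \<in> borel_measurable N"
    by measurable
  moreover have "(\<integral>\<^sup>+z. \<phi> x z \<partial>h x) = (SUP k. (1 + emeasure (h x) (B k)) * (\<integral>\<^sup>+z. \<phi> x z \<partial>J k x))"
    if x: "x \<in> space N" for x
  proof -
    have "(\<lambda>z. \<phi> x z) \<in> borel_measurable borel"
      using measurable_Pair2[OF \<phi> x] by simp
    then have [measurable]: "(\<lambda>z. \<phi> x z) \<in> borel_measurable (h x)"
      by (simp add: measurable_cong_sets[OF sets_h[OF x] refl])
    have [measurable]: "B k \<in> sets (h x)" for k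
      using B by (simp add: sets_h[OF x])
    have SUP: "(SUP k. indicator (B k) z * \<phi> x z) = \<phi> x z" for z
    proof (rule antisym)
      show "(SUP k. indicator (B k) z * \<phi> x z) \<le> \<phi> x z"
        by (auto intro!: SUP_least split: split_indicator)
      obtain k where "norm z < real k"
        using reals_Archimedean2 by blast
      then have "\<phi> x z \<le> indicator (B k) z * \<phi> x z"
        by (simp add: B_def)
      then show "\<phi> x z \<le> (SUP k. indicator (B k) z * \<phi> x z)"
        by (rule SUP_upper2[OF UNIV_I])
    qed
    have "(1 + emeasure (h x) (B k)) * (\<integral>\<^sup>+z. \<phi> x z \<partial>J k x) =
        (\<integral>\<^sup>+z. indicator (B k) z * \<phi> x z \<partial>h x)" for k
    proof -
      have "(\<integral>\<^sup>+z. \<phi> x z \<partial>J k x) = c k x * (\<integral>\<^sup>+z. indicator (B k) z * \<phi> x z \<partial>h x)"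
        unfolding J_def by (subst nn_integral_scale_measure) (auto simp: nn_integral_density)
      then show ?thesis
        by (simp only: mult.assoc[symmetric] c_mult[OF x] mult_1_left)
    qed
    then have "(SUP k. (1 + emeasure (h x) (B k)) * (\<integral>\<^sup>+z. \<phi> x z \<partial>J k x)) =
        (SUP k. \<integral>\<^sup>+z. indicator (B k) z * \<phi> x z \<partial>h x)"
      by simp
    also have "\<dots> = (\<integral>\<^sup>+z. (SUP k. indicator (B k) z * \<phi> x z) \<partial>h x)"
    proof (rule nn_integral_monotone_convergence_SUP[symmetric])
      show "incseq (\<lambda>k z. indicator (B k) z * \<phi> x z)"
        by (auto simp: incseq_def le_fun_def B_def intro!: mult_right_mono split: split_indicator)
      show "(\<lambda>z. indicator (B k) z * \<phi> x z) \<in> borel_measurable (h x)" for k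
        by measurable
    qed
    also have "\<dots> = (\<integral>\<^sup>+z. \<phi> x z \<partial>h x)"
      by (simp add: SUP)
    finally show ?thesis
      by (rule sym)
  qed
  ultimately show ?thesis
    by (rule measurable_congI)
qed

text \<open>The set may move with \<open>x\<close>, as the windows and the sections of invariant
  sets later do.\<close>

lemma emeasure_radon_measurable:
  assumes A: "{p \<in> space (N \<Otimes>\<^sub>M borel). snd p \<in> A (fst p)} \<in> sets (N \<Otimes>\<^sub>M borel)"
  shows "(\<lambda>x. emeasure (h x) (A x)) \<in> borel_measurable N"
proof -
  let ?S = "{p \<in> space (N \<Otimes>\<^sub>M borel). snd p \<in> A (fst p)}"
  have "(\<lambda>p. indicator ?S p :: ennreal) \<in> borel_measurable (N \<Otimes>\<^sub>M borel)"
    by (rule borel_measurable_indicator[OF A])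
  then have "(\<lambda>(x, z). indicator ?S (x, z) :: ennreal) \<in> borel_measurable (N \<Otimes>\<^sub>M borel)"
    by simp
  from nn_integral_radon_measurable[OF this]
  have "(\<lambda>x. \<integral>\<^sup>+z. indicator ?S (x, z) \<partial>h x) \<in> borel_measurable N" .
  moreover have "emeasure (h x) (A x) = (\<integral>\<^sup>+z. indicator ?S (x, z) \<partial>h x)" if x: "x \<in> space N" for x
  proof -
    have "Pair x -` ?S = A x"
      using x by (auto simp: space_pair_measure)
    then have "A x \<in> sets (h x)"
      using sets_Pair1[OF A, of x] rad[OF x] by (simp add: radon_def)
    moreover have "indicator ?S (x, z) = (indicator (A x) z :: ennreal)" for z
      using x by (auto simp: space_pair_measure indicator_def)
    ultimately show ?thesis
      by simp
  qed
  ultimately show ?thesis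
    by (rule measurable_congI)
qed

lemma integral_radon_measurable:
  fixes f :: "real^'n \<Rightarrow> real"
  assumes f: "continuous_on UNIV f" "compact (closure {x. f x \<noteq> 0})"
  shows "(\<lambda>x. integral\<^sup>L (h x) f) \<in> borel_measurable N"
proof -
  have [measurable]: "f \<in> borel_measurable borel"
    using f(1) by (rule borel_measurable_continuous_onI)
  have 1: "(\<lambda>x. \<integral>\<^sup>+z. ennreal (f z) \<partial>h x) \<in> borel_measurable N"
    by (rule nn_integral_radon_measurable) auto
  have 2: "(\<lambda>x. \<integral>\<^sup>+z. ennreal (- f z) \<partial>h x) \<in> borel_measurable N"
    by (rule nn_integral_radon_measurable) auto
  have "(\<lambda>x. enn2real (\<integral>\<^sup>+z. ennreal (f z) \<partial>h x) - enn2real (\<integral>\<^sup>+z. ennreal (- f z) \<partial>h x))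
      \<in> borel_measurable N"
    using 1 2 by measurable
  moreover have "integral\<^sup>L (h x) f =
      enn2real (\<integral>\<^sup>+z. ennreal (f z) \<partial>h x) - enn2real (\<integral>\<^sup>+z. ennreal (- f z) \<partial>h x)"
    if "x \<in> space N" for x
    by (rule real_lebesgue_integral_def[OF integrable_Cc[OF rad[OF that] f]])
  ultimately show ?thesis
    by (rule measurable_congI)
qed

end

text \<open>The indicator of \<open>W\<close> is the supremum of the compactly supported functions
  \<open>min 1 (k * infdist x (- W))\<close>, whose integrals are continuous by the choice of the
  topology.\<close>

lemma emeasure_Mstar_measurable_open:
  fixes W :: "(real^'n) set"
  assumes W: "open W" "bounded W"
  shows "(\<lambda>\<mu>. emeasure \<mu> W) \<in> borel_measurable Mstar_borel"
proof (cases "W = {}")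
  case False
  \<comment> \<open>\<open>infdist\<close> to the empty set is \<open>0\<close>, so the complement
    has to be nonempty.\<close>
  have "W \<noteq> UNIV"
    using W(2) not_bounded_UNIV by auto
  then have ne: "- W \<noteq> {}"
    by auto
  define f where "f k x = min 1 (real k * infdist x (- W))" for k x
  have cont: "continuous_on UNIV (f k)" for k
    unfolding f_def by (intro continuous_intros)
  have f0: "f k x = 0" if "x \<notin> W" for k x
    using that by (simp add: f_def infdist_zero)
  have cpt: "compact (closure {x. f k x \<noteq> 0})" for k
    unfolding compact_closure using f0 by (intro bounded_subset[OF W(2)]) blast
  have f_nonneg: "0 \<le> f k x" for k x
    by (simp add: f_def infdist_nonneg)
  have SUP: "(SUP k. ennreal (f k x)) = indicator W x" for x
  proof (cases "x \<in> W")
    case True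
    have "closed (- W)"
      using W(1) by (rule closed_Compl)
    then have pos: "infdist x (- W) > 0"
      using in_closed_iff_infdist_zero[OF _ ne] True infdist_nonneg[of x "- W"]
      by (metis ComplD less_eq_real_def)
    obtain k where "1 / infdist x (- W) \<le> real k"
      using real_arch_simple by blast
    then have "f k x = 1"
      using pos by (simp add: f_def field_simps)
    then have "1 \<le> (SUP k. ennreal (f k x))"
      by (intro SUP_upper2[of k]) auto
    moreover have "(SUP k. ennreal (f k x)) \<le> 1"
      by (intro SUP_least) (simp add: f_def)
    ultimately show ?thesis
      using True by (auto intro: antisym)
  qed (simp add: f0)
  have eq: "emeasure \<mu> W = (SUP k. ennreal (integral\<^sup>L \<mu> (f k)))" if \<mu>: "\<mu> \<in> space Mstar_borel" for \<mu>
  proof -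
    have rad: "\<mu> \<in> radon"
      using \<mu> by (auto simp: Mstar_borel_def Mstar_def)
    then have sets: "sets \<mu> = sets borel"
      by (simp add: radon_def)
    have int: "integrable \<mu> (f k)" for k
      by (rule integrable_Cc[OF rad cont cpt])
    have "emeasure \<mu> W = (\<integral>\<^sup>+x. (SUP k. ennreal (f k x)) \<partial>\<mu>)"
      using W(1) by (simp add: SUP sets)
    also have "\<dots> = (SUP k. \<integral>\<^sup>+x. ennreal (f k x) \<partial>\<mu>)"
    proof (rule nn_integral_monotone_convergence_SUP)
      show "incseq (\<lambda>k x. ennreal (f k x))"
        unfolding incseq_def le_fun_def f_def
        by (intro allI impI ennreal_leI min.mono mult_right_mono) (auto simp: infdist_nonneg)
      show "(\<lambda>x. ennreal (f k x)) \<in> borel_measurable \<mu>" for k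
        using borel_measurable_integrable[OF int] by measurable
    qed
    also have "\<dots> = (SUP k. ennreal (integral\<^sup>L \<mu> (f k)))"
      using f_nonneg by (subst nn_integral_eq_integral[OF int]) auto
    finally show ?thesis .
  qed
  have [measurable]: "(\<lambda>\<mu>. integral\<^sup>L \<mu> (f k)) \<in> borel_measurable Mstar_borel" for k
    unfolding Mstar_borel_def vague_topology_def
    by (intro borel_measurable_continuous_map continuous_map_from_subtopology
        continuous_map_weak_topology) (use cont cpt in simp)
  have "(\<lambda>\<mu>. SUP k. ennreal (integral\<^sup>L \<mu> (f k))) \<in> borel_measurable Mstar_borel"
    by measurable
  then show ?thesis
    by (rule measurable_congI) (rule eq)
qed simp

lemma space_Mstar_borel [simp]: "space Mstar_borel = Mstar"
  by (auto simp: Mstar_borel_def vague_topology_def Mstar_def)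

lemma Mstar_radon: "\<mu> \<in> Mstar \<Longrightarrow> \<mu> \<in> radon"
  by (simp add: Mstar_def)

lemma test_functions_vague:
  "test_functions UNIV (radon :: (real^'n) measure set)
    Cc
    (range (\<lambda>R::nat. \<lambda>x. max 0 (real R - norm x)))"
proof
  show "range (\<lambda>R::nat. \<lambda>x::real^'n. max 0 (real R - norm x)) \<subseteq>
      Cc"
  proof safe
    fix R :: nat
    show "continuous_on UNIV (\<lambda>x::real^'n. max 0 (real R - norm x))"
      by (intro continuous_intros)
    show "compact (closure {x::real^'n. max 0 (real R - norm x) \<noteq> 0})"
      unfolding compact_closure by (rule bounded_subset[OF bounded_ball[of 0 "real R"]]) auto
  qed
next
  fix f g :: "real^'n \<Rightarrow> real" and c
  assume fg: "f \<in> Cc"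
    "g \<in> Cc"
  have "bounded ({x. f x \<noteq> 0} \<union> {x. g x \<noteq> 0})"
    using fg by (simp add: compact_closure)
  then have "bounded {x. f x - c * g x \<noteq> 0}"
    by (rule bounded_subset) auto
  then show "(\<lambda>x. f x - c * g x) \<in> Cc"
    using fg by (auto simp: compact_closure intro!: continuous_intros)
next
  fix f :: "real^'n \<Rightarrow> real"
  assume "f \<in> Cc"
  then have f: "continuous_on UNIV f" "compact (closure {x. f x \<noteq> 0})"
    by auto
  let ?K = "closure {x. f x \<noteq> 0}"
  have "bounded (f ` ?K)"
    by (rule compact_imp_bounded[OF compact_continuous_image[OF continuous_on_subset[OF f(1)] f(2)]]) simp
  moreover have "bounded ?K"
    by (rule compact_imp_bounded[OF f(2)])
  ultimately obtain r s where r: "\<And>x. x \<in> ?K \<Longrightarrow> \<bar>f x\<bar> \<le> r" and s: "\<And>x. x \<in> ?K \<Longrightarrow> norm x \<le> s"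
    unfolding bounded_iff by (metis imageI real_norm_def)
  obtain m :: nat where m: "r \<le> real m"
    using real_arch_simple by blast
  \<comment> \<open>The cone \<open>max 0 (R - norm x)\<close> is then at least \<open>1\<close> on
    the support of \<open>f\<close>, and \<open>m\<close> times it dominates
    \<open>f\<close>.\<close>
  obtain R :: nat where R: "s + 1 \<le> real R"
    using real_arch_simple by blast
  have "\<bar>f x\<bar> \<le> real m * max 0 (real R - norm x)" for x
  proof (cases "x \<in> ?K")
    case True
    then have "real m * 1 \<le> real m * max 0 (real R - norm x)"
      using s[of x] R by (intro mult_left_mono) auto
    then show ?thesis
      using r[OF True] m by simp
  next
    case False
    then have "f x = 0"
      using closure_subset[of "{x. f x \<noteq> 0}"] by auto
    then show ?thesis
      by simp
  qed
  then show "\<exists>h\<in>range (\<lambda>R::nat. \<lambda>x. max 0 (real R - norm x)). \<exists>m::nat. \<forall>x\<in>UNIV. \<bar>f x\<bar> \<le> real m * h x"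
    by (intro bexI[of _ "\<lambda>x. max 0 (real R - norm x)"] exI[of _ m]) auto
next
  fix \<nu> :: "(real^'n) measure" and f :: "real^'n \<Rightarrow> real"
  assume "\<nu> \<in> radon" "f \<in> Cc"
  then show "integrable \<nu> f"
    by (intro integrable_Cc) auto
next
  fix \<nu> :: "(real^'n) measure" assume "\<nu> \<in> radon"
  then show "space \<nu> = UNIV"
    using sets_eq_imp_space_eq[of \<nu> borel] by (simp add: radon_def)
qed auto

lemma measurable_borel_of_subtopology:
  assumes "h \<in> N \<rightarrow>\<^sub>M borel_of X" "\<And>x. x \<in> space N \<Longrightarrow> h x \<in> S"
  shows "h \<in> N \<rightarrow>\<^sub>M borel_of (subtopology X S)"
proof (rule measurable_borel_ofI)
  fix U assume "openin (subtopology X S) U"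
  then obtain T where T: "openin X T" "U = T \<inter> S"
    by (auto simp: openin_subtopology)
  have "h -` U \<inter> space N = h -` T \<inter> space N"
    using T(2) assms(2) by auto
  then show "h -` U \<inter> space N \<in> sets N"
    using measurable_sets[OF assms(1) openin_in_borel_of[OF T(1)]] by simp
next
  fix x assume "x \<in> space N"
  then show "h x \<in> topspace (subtopology X S)"
    using measurable_space[OF assms(1)] assms(2) by auto
qed

text \<open>Together with \<open>emeasure_Mstar_measurable\<close> this lets the Borel sets of
  \<open>Mstar\<close> be handled through masses of bounded open sets, without returning to test
  functions.\<close>

lemma measurable_Mstar_borelI:
  fixes h :: "'x \<Rightarrow> (real^'n) measure"
  assumes Mstar: "\<And>x. x \<in> space N \<Longrightarrow> h x \<in> Mstar"
    and ev: "\<And>W. open W \<Longrightarrow> bounded W \<Longrightarrow> (\<lambda>x. emeasure (h x) W) \<in> borel_measurable N"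
  shows "h \<in> N \<rightarrow>\<^sub>M Mstar_borel"
proof -
  have rad: "h x \<in> radon" if "x \<in> space N" for x
    using Mstar[OF that] by (rule Mstar_radon)
  have "h \<in> N \<rightarrow>\<^sub>M borel_of vague_topology"
    unfolding vague_topology_def
    by (rule test_functions.measurable_borel_of_weak_topologyI[OF test_functions_vague rad])
      (auto intro: integral_radon_measurable[OF rad ev])
  then show ?thesis
    unfolding Mstar_borel_def by (rule measurable_borel_of_subtopology[OF _ Mstar])
qed

lemma emeasure_Mstar_measurable:
  fixes h :: "'x \<Rightarrow> (real^'n) measure"
  assumes h: "h \<in> N \<rightarrow>\<^sub>M Mstar_borel"
    and A: "{p \<in> space (N \<Otimes>\<^sub>M borel). snd p \<in> A (fst p)} \<in> sets (N \<Otimes>\<^sub>M borel)"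
  shows "(\<lambda>x. emeasure (h x) (A x)) \<in> borel_measurable N"
proof (rule emeasure_radon_measurable[OF _ _ A])
  fix x assume "x \<in> space N"
  then show "h x \<in> radon"
    using measurable_space[OF h] Mstar_radon by auto
next
  fix W :: "(real^'n) set" assume "open W" "bounded W"
  then show "(\<lambda>x. emeasure (h x) W) \<in> borel_measurable N"
    by (rule measurable_compose[OF h emeasure_Mstar_measurable_open])
qed

section \<open>Probability measures on a subset of Euclidean space\<close>

lemma sets_borel_of_top_of_set:
  "sets (borel_of (top_of_set S)) = sets (restrict_space borel (S :: 'a::topological_space set))"
proof -
  have "{(\<lambda>x. x) -` A \<inter> S |A. A \<in> sigma_sets UNIV {T. open T}} =
      sigma_sets S {(\<lambda>x. x) -` A \<inter> S |A. A \<in> {T. open T}}"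
    by (rule sigma_sets_vimage_commute) auto
  moreover have "{(\<lambda>x. x) -` A \<inter> S |A. A \<in> {T. open T}} = {U. openin (top_of_set S) U}"
    by (auto simp: openin_open Int_commute)
  moreover have "{(\<lambda>x. x) -` A \<inter> S |A. A \<in> sigma_sets UNIV {T. open T}} = sets (restrict_space borel S)"
    by (auto simp: sets_restrict_space sets_borel borel_def image_iff)
  ultimately show ?thesis
    by (simp add: sets_borel_of)
qed

lemma topspace_prob_topology [simp]:
  "topspace (prob_topology X) = {\<nu>. prob_space \<nu> \<and> sets \<nu> = sets (borel_of X)}"
  by (simp add: prob_topology_def)

lemma bounded_continuous_integrable:
  assumes "prob_space \<nu>" "sets \<nu> = sets (borel_of X)"
    and f: "continuous_map X euclideanreal f" "bounded (f ` topspace X)"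
  shows "integrable \<nu> f"
proof -
  interpret prob_space \<nu> by fact
  obtain r where r: "\<And>x. x \<in> topspace X \<Longrightarrow> norm (f x) \<le> r"
    using f(2) by (auto simp: bounded_iff)
  have "space \<nu> = topspace X"
    using sets_eq_imp_space_eq[OF assms(2)] by simp
  moreover have "f \<in> borel_measurable \<nu>"
    using borel_measurable_continuous_map[OF f(1)] by (simp add: measurable_cong_sets[OF assms(2) refl])
  ultimately show ?thesis
    using r by (intro integrable_const_bound[of _ r]) auto
qed

lemma bounded_uminus_image: "bounded (f ` S) \<Longrightarrow> bounded ((\<lambda>x. - f x :: real) ` S)"
  using bounded_uminus[of "f ` S"] by (simp add: image_image)

lemma test_functions_prob:
  fixes S :: "'a::euclidean_space set"
  shows "test_functions S {\<nu>. prob_space \<nu> \<and> sets \<nu> = sets (borel_of (top_of_set S))}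
    (Cb (top_of_set S)) {\<lambda>_. 1}"
proof
  fix f g :: "'a \<Rightarrow> real" and c
  assume fg: "f \<in> Cb (top_of_set S)"
    "g \<in> Cb (top_of_set S)"
  then have "bounded ((\<lambda>x. f x - c *\<^sub>R g x) ` S)"
    by (intro bounded_minus_comp bounded_scaleR_comp) auto
  then show "(\<lambda>x. f x - c * g x) \<in>
      Cb (top_of_set S)"
    using fg by (auto intro!: continuous_intros)
next
  fix f :: "'a \<Rightarrow> real" assume f: "continuous_on UNIV f" "compact (closure {x. f x \<noteq> 0})"
  have "bounded (f ` closure {x. f x \<noteq> 0})"
    by (rule compact_imp_bounded[OF compact_continuous_image[OF continuous_on_subset[OF f(1)] f(2)]]) simp
  then have "bounded (insert 0 (f ` closure {x. f x \<noteq> 0}))"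
    by simp
  moreover have "f x \<in> insert 0 (f ` closure {x. f x \<noteq> 0})" for x
    using closure_subset[of "{x. f x \<noteq> 0}"] by (cases "f x = 0") auto
  ultimately have "bounded (f ` S)"
    by (meson bounded_subset image_subsetI)
  then show "f \<in> Cb (top_of_set S)"
    using continuous_on_subset[OF f(1), of S] by simp
next
  fix f :: "'a \<Rightarrow> real"
  assume "f \<in> Cb (top_of_set S)"
  then obtain r where r: "\<And>x. x \<in> S \<Longrightarrow> \<bar>f x\<bar> \<le> r"
    unfolding bounded_iff by auto
  obtain m :: nat where "r \<le> real m"
    using real_arch_simple by blast
  then have "\<forall>x\<in>S. \<bar>f x\<bar> \<le> real m"
    using r by (meson order_trans)
  then show "\<exists>h\<in>{\<lambda>_. 1}. \<exists>m::nat. \<forall>x\<in>S. \<bar>f x\<bar> \<le> real m * h x"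
    by auto
next
  fix \<nu> :: "'a measure" assume "\<nu> \<in> {\<nu>. prob_space \<nu> \<and> sets \<nu> = sets (borel_of (top_of_set S))}"
  then show "space \<nu> = S"
    using sets_eq_imp_space_eq[of \<nu> "borel_of (top_of_set S)"] by simp
qed (auto intro: bounded_continuous_integrable simp: image_constant_conv)

text \<open>Bridge from \<open>prob_algebra\<close>, where kernels are checked set by set, to the
  Borel sets of the weak topology.\<close>

lemma measurable_prob_topologyI:
  fixes S :: "'a::euclidean_space set"
  assumes h: "h \<in> N \<rightarrow>\<^sub>M prob_algebra (restrict_space borel S)"
  shows "h \<in> N \<rightarrow>\<^sub>M borel_of (prob_topology (top_of_set S))"
  unfolding prob_topology_def
proof (rule test_functions.measurable_borel_of_weak_topologyI[OF test_functions_prob])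
  fix x assume "x \<in> space N"
  then show "h x \<in> {\<nu>. prob_space \<nu> \<and> sets \<nu> = sets (borel_of (top_of_set S))}"
    using measurable_space[OF h] by (simp add: sets_borel_of_top_of_set space_prob_algebra)
next
  fix f :: "'a \<Rightarrow> real"
  assume "f \<in> Cb (top_of_set S)"
  then have "f \<in> borel_measurable (restrict_space borel S)"
    by (intro borel_measurable_continuous_on_restrict) simp
  then show "(\<lambda>x. integral\<^sup>L (h x) f) \<in> borel_measurable N"
    by (intro measurable_compose[OF measurable_prob_algebraD[OF h]] integral_measurable_subprob_algebra)
qed

lemmas prob_topology_countable_base =
  test_functions.countable_base[OF test_functions_prob, folded prob_topology_def]


section \<open>Rescaling and translating measures\<close>

lemma B1_borel [measurable]: "B1 \<in> sets borel"
  by (simp add: B1_def)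

lemma ball_subset_B1: "ball 0 1 \<subseteq> (B1 :: (real^'n) set)"
proof
  fix x :: "real^'n" assume "x \<in> ball 0 1"
  then have "\<bar>x $ i\<bar> \<le> 1" for i
    using component_le_norm_cart[of x i] by simp
  then show "x \<in> B1"
    by (auto simp: B1_def mem_box_cart abs_le_iff minus_le_iff)
qed

text \<open>The points \<open>z\<close> of the cube \<open>x + exp (- t) * B1\<close>, that is,
  those which the scenery of a measure at \<open>x\<close> shows at time \<open>t\<close>.\<close>

abbreviation in_window :: "real \<Rightarrow> real^'n \<Rightarrow> real^'n \<Rightarrow> bool" where
  "in_window t x z \<equiv> exp t *\<^sub>R (z - x) \<in> B1"

lemma sets_dilate [simp]: "sets (dilate t \<mu>) = sets borel"
  by (simp add: dilate_def)

lemma sets_translate [simp]: "sets (translate x \<mu>) = sets borel"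
  by (simp add: translate_def)

lemma sets_normalized [simp]: "sets (normalized \<mu>) = sets \<mu>"
  by (simp add: normalized_def)

lemma sets_radon: "\<mu> \<in> radon \<Longrightarrow> sets \<mu> = sets borel"
  by (simp add: radon_def)

lemma emeasure_distr_radon:
  fixes \<phi> :: "real^'n \<Rightarrow> real^'n"
  assumes "\<mu> \<in> radon" "continuous_on UNIV \<phi>" "A \<in> sets borel"
  shows "emeasure (distr \<mu> borel \<phi>) A = emeasure \<mu> {y. \<phi> y \<in> A}"
proof -
  have sets: "sets \<mu> = sets borel"
    using assms(1) by (rule sets_radon)
  have "\<phi> \<in> \<mu> \<rightarrow>\<^sub>M borel"
    using borel_measurable_continuous_onI[OF assms(2)] by (simp add: measurable_cong_sets[OF sets refl])
  then show ?thesis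
    using assms(3) sets_eq_imp_space_eq[OF sets] by (simp add: emeasure_distr vimage_def)
qed

lemma emeasure_dilate:
  "\<mu> \<in> radon \<Longrightarrow> A \<in> sets borel \<Longrightarrow> emeasure (dilate t \<mu>) A = emeasure \<mu> {y. exp t *\<^sub>R y \<in> A}"
  unfolding dilate_def by (intro emeasure_distr_radon continuous_intros)

lemma emeasure_translate:
  "\<mu> \<in> radon \<Longrightarrow> A \<in> sets borel \<Longrightarrow> emeasure (translate x \<mu>) A = emeasure \<mu> {y. y - x \<in> A}"
  unfolding translate_def by (intro emeasure_distr_radon continuous_intros)

text \<open>Treats translations and dilations at once: \<open>\<psi>\<close> maps compact sets to
  compact sets, which preserves local finiteness, and continuity in both directions matches
  neighbourhoods of \<open>x\<close> with those of \<open>\<phi> x\<close>.\<close>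

lemma distr_homeomorphism:
  fixes \<phi> \<psi> :: "real^'n \<Rightarrow> real^'n"
  assumes \<mu>: "\<mu> \<in> radon" and \<phi>: "continuous_on UNIV \<phi>" and \<psi>: "continuous_on UNIV \<psi>"
    and inv: "\<And>x. \<psi> (\<phi> x) = x" "\<And>y. \<phi> (\<psi> y) = y"
  shows "distr \<mu> borel \<phi> \<in> radon"
    and "\<phi> x \<in> supp (distr \<mu> borel \<phi>) \<longleftrightarrow> x \<in> supp \<mu>"
proof -
  note em = emeasure_distr_radon[OF \<mu> \<phi>]
  have vimage: "{y. \<phi> y \<in> K} = \<psi> ` K" "{y. \<phi> y \<in> {z. \<psi> z \<in> K}} = K" for K
    using inv by (auto simp: image_iff) metis
  have "emeasure (distr \<mu> borel \<phi>) K < \<infinity>" if "compact K" for K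
    using compact_continuous_image[OF continuous_on_subset[OF \<psi>] that] \<mu> that
    by (simp add: em borel_compact vimage radon_def)
  then show "distr \<mu> borel \<phi> \<in> radon"
    by (simp add: radon_def)
  have pre: "open {y. \<phi> y \<in> U}" "open {y. \<psi> y \<in> U}" if "open U" for U
    using open_vimage[OF that \<phi>] open_vimage[OF that \<psi>] by (simp_all add: vimage_def)
  show "\<phi> x \<in> supp (distr \<mu> borel \<phi>) \<longleftrightarrow> x \<in> supp \<mu>"
  proof
    assume x: "\<phi> x \<in> supp (distr \<mu> borel \<phi>)"
    have "0 < emeasure \<mu> U" if "open U" "x \<in> U" for U
    proof -
      have "0 < emeasure (distr \<mu> borel \<phi>) {y. \<psi> y \<in> U}"
        using x that(2) pre(2)[OF that(1)] by (auto simp: supp_def inv)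
      then show ?thesis
        using pre(2)[OF that(1)] by (simp only: em[OF borel_open] vimage(2))
    qed
    then show "x \<in> supp \<mu>"
      by (auto simp: supp_def)
  next
    assume "x \<in> supp \<mu>"
    then show "\<phi> x \<in> supp (distr \<mu> borel \<phi>)"
      using pre(1) by (auto simp: supp_def em)
  qed
qed

lemma emeasure_normalized: "emeasure (normalized \<mu>) A = emeasure \<mu> A / emeasure \<mu> B1"
  by (simp add: normalized_def divide_ennreal_def mult.commute)

lemma dilate_homeomorphism:
  fixes \<mu> :: "(real^'n) measure"
  assumes "\<mu> \<in> radon"
  shows dilate_radon: "dilate t \<mu> \<in> radon"
    and supp_dilate: "0 \<in> supp (dilate t \<mu>) \<longleftrightarrow> 0 \<in> supp \<mu>"
  using distr_homeomorphism(1)[OF assms, of "\<lambda>y. exp t *\<^sub>R y" "\<lambda>y. exp (- t) *\<^sub>R y"]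
    distr_homeomorphism(2)[OF assms, of "\<lambda>y. exp t *\<^sub>R y" "\<lambda>y. exp (- t) *\<^sub>R y" 0]
  by (simp_all add: dilate_def continuous_intros exp_minus)

lemma translate_homeomorphism:
  fixes \<mu> :: "(real^'n) measure"
  assumes "\<mu> \<in> radon"
  shows translate_radon: "translate x \<mu> \<in> radon"
    and supp_translate: "0 \<in> supp (translate x \<mu>) \<longleftrightarrow> x \<in> supp \<mu>"
  using distr_homeomorphism(1)[OF assms, of "\<lambda>y. y - x" "\<lambda>y. y + x"]
    distr_homeomorphism(2)[OF assms, of "\<lambda>y. y - x" "\<lambda>y. y + x" x]
  by (simp_all add: translate_def continuous_intros)

text \<open>The unnormalised form of \<open>Mstar0\<close>. Here \<open>B1\<close>, a neighbourhood
  of \<open>0\<close>, has positive finite mass, so normalisation does not degenerate, and plain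
  dilations stay inside the set.\<close>

definition radon0 :: "(real^'n) measure set" where
  "radon0 = {\<mu> \<in> radon. 0 \<in> supp \<mu>}"

lemma radon0_radon: "\<mu> \<in> radon0 \<Longrightarrow> \<mu> \<in> radon"
  by (simp add: radon0_def)

lemma Mstar0_radon0: "\<mu> \<in> Mstar0 \<Longrightarrow> \<mu> \<in> radon0"
  by (simp add: radon0_def Mstar0_def Mstar_def)

lemma radon0_B1:
  assumes "\<mu> \<in> radon0"
  shows "0 < emeasure \<mu> B1" "emeasure \<mu> B1 < \<infinity>"
proof -
  have "0 < emeasure \<mu> (ball 0 1)"
    using assms by (auto simp: radon0_def supp_def)
  also have "\<dots> \<le> emeasure \<mu> B1"
    using assms B1_borel by (intro emeasure_mono ball_subset_B1) (simp add: radon0_def radon_def)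
  finally show "0 < emeasure \<mu> B1" .
  show "emeasure \<mu> B1 < \<infinity>"
    using assms by (simp add: radon0_def radon_def B1_def)
qed

lemma dilate_radon0: "\<mu> \<in> radon0 \<Longrightarrow> dilate t \<mu> \<in> radon0"
  by (simp add: radon0_def dilate_radon supp_dilate)

lemma translate_radon0_iff: "\<mu> \<in> radon \<Longrightarrow> translate x \<mu> \<in> radon0 \<longleftrightarrow> x \<in> supp \<mu>"
  by (simp add: radon0_def translate_radon supp_translate)

lemma normalized_Mstar:
  assumes "\<mu> \<in> radon" "0 < emeasure \<mu> B1"
  shows "normalized \<mu> \<in> Mstar"
proof -
  have "emeasure \<mu> B1 < \<infinity>"
    using assms by (simp add: radon_def B1_def)
  then show ?thesis
    using assms by (auto simp: Mstar_def radon_def emeasure_normalized ennreal_divide_eq_top_iff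
        less_top[symmetric])
qed

lemma normalized_Mstar_D: "normalized \<mu> \<in> Mstar \<Longrightarrow> 0 < emeasure \<mu> B1"
  by (auto simp: Mstar_def emeasure_normalized zero_less_iff_neq_zero)

lemma normalized_Mstar0:
  assumes "\<mu> \<in> radon0"
  shows "normalized \<mu> \<in> Mstar0"
proof -
  have "normalized \<mu> \<in> Mstar"
    by (rule normalized_Mstar[OF radon0_radon[OF assms] radon0_B1(1)[OF assms]])
  moreover have "0 \<in> supp (normalized \<mu>)"
    using assms radon0_B1[OF assms]
    by (auto simp: radon0_def supp_def emeasure_normalized ennreal_zero_less_divide less_top[symmetric])
  ultimately show ?thesis
    by (simp add: Mstar0_def)
qed

lemma normalized_Mstar0_D:
  assumes "\<mu> \<in> radon" "normalized \<mu> \<in> Mstar0"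
  shows "\<mu> \<in> radon0"
proof -
  have "0 < emeasure \<mu> U" if "open U" "0 \<in> U" for U
  proof -
    have "0 < emeasure (normalized \<mu>) U"
      using assms(2) that by (auto simp: Mstar0_def supp_def)
    then show ?thesis
      by (auto simp: emeasure_normalized zero_less_iff_neq_zero)
  qed
  then show ?thesis
    using assms(1) by (auto simp: radon0_def supp_def)
qed

lemma normalized_id: "\<mu> \<in> Mstar \<Longrightarrow> normalized \<mu> = \<mu>"
  by (intro measure_eqI) (auto simp: emeasure_normalized Mstar_def divide_ennreal_def)

lemma normalized_scale_measure:
  assumes "0 < c" "c < \<infinity>"
  shows "normalized (scale_measure c \<mu>) = normalized \<mu>"
proof -
  have "c * a / (c * m) = a / m" for a m :: ennreal
    using assms divide_mult_eq[of c a m] by (simp add: mult.commute)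
  then show ?thesis
    by (intro measure_eqI) (auto simp: emeasure_normalized)
qed

text \<open>An inner normalisation multiplies by a constant in \<open>(0, \<infinity>)\<close>,
  which the outer one cancels. Identities between the star maps thus follow from identities between
  plain push-forwards.\<close>

lemma normalized_absorb:
  assumes "\<mu> \<in> radon0"
  shows "translate_star x (normalized \<mu>) = translate_star x \<mu>"
    and "dilate_star t (normalized \<mu>) = dilate_star t \<mu>"
    and "dilate_square t (normalized \<mu>) = dilate_square t \<mu>"
    and "square (normalized \<mu>) = square \<mu>"
proof -
  define c where "c = 1 / emeasure \<mu> B1"
  have c: "0 < c" "c < \<infinity>"
    using radon0_B1[OF assms] by (auto simp: c_def ennreal_zero_less_divide ennreal_divide_eq_top_iff less_top[symmetric])
  have \<mu>: "\<mu> \<in> radon"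
    using assms by (rule radon0_radon)
  have n: "normalized \<mu> = scale_measure c \<mu>"
    by (simp add: c_def normalized_def)
  have rad: "scale_measure c \<mu> \<in> radon"
    using normalized_Mstar0[OF assms] by (simp add: n[symmetric] Mstar0_def Mstar_def)
  have d: "dilate t (scale_measure c \<mu>) = scale_measure c (dilate t \<mu>)"
    by (intro measure_eqI) (auto simp: emeasure_dilate \<mu> rad)
  have "translate x (scale_measure c \<mu>) = scale_measure c (translate x \<mu>)"
    by (intro measure_eqI) (auto simp: emeasure_translate \<mu> rad)
  then show "translate_star x (normalized \<mu>) = translate_star x \<mu>"
    by (simp add: n translate_star_def normalized_scale_measure[OF c])
  show "dilate_star t (normalized \<mu>) = dilate_star t \<mu>"
    by (simp add: n dilate_star_def d normalized_scale_measure[OF c])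
  show "dilate_square t (normalized \<mu>) = dilate_square t \<mu>"
    by (simp add: n dilate_square_def square_def d normalized_scale_measure[OF c])
  show "square (normalized \<mu>) = square \<mu>"
    by (simp add: n square_def normalized_scale_measure[OF c])
qed

lemma dilate_dilate: "\<mu> \<in> radon \<Longrightarrow> dilate s (dilate t \<mu>) = dilate (s + t) \<mu>"
  by (intro measure_eqI) (auto simp: emeasure_dilate dilate_radon exp_add)

text \<open>Seen from \<open>x\<close> at time \<open>t\<close>, the point \<open>z\<close> sits at
  \<open>exp t * (z - x)\<close>; recentring there shows the magnified measure around
  \<open>z\<close>. A translate of a magnified picture is therefore again a magnified picture of the
  same measure.\<close>

lemma translate_dilate:
  assumes "\<mu> \<in> radon"
  shows "translate (exp t *\<^sub>R (z - x)) (dilate t (translate x \<mu>)) = dilate t (translate z \<mu>)"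
proof (intro measure_eqI)
  fix A assume "A \<in> sets (translate (exp t *\<^sub>R (z - x)) (dilate t (translate x \<mu>)))"
  then have [measurable]: "A \<in> sets borel"
    by simp
  have "exp t *\<^sub>R (y - x) - exp t *\<^sub>R (z - x) = exp t *\<^sub>R (y - z)" for y
    by (simp add: algebra_simps)
  then show "emeasure (translate (exp t *\<^sub>R (z - x)) (dilate t (translate x \<mu>))) A =
      emeasure (dilate t (translate z \<mu>)) A"
    by (simp add: emeasure_translate emeasure_dilate dilate_radon translate_radon assms)
qed simp

lemma dilate_0: "\<mu> \<in> radon \<Longrightarrow> dilate 0 \<mu> = \<mu>"
  by (intro measure_eqI) (auto simp: emeasure_dilate sets_radon)

lemma translate_0: "\<mu> \<in> radon \<Longrightarrow> translate 0 \<mu> = \<mu>"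
  by (intro measure_eqI) (auto simp: emeasure_translate sets_radon)

lemma dilate_star_Mstar0: "\<mu> \<in> Mstar0 \<Longrightarrow> dilate_star t \<mu> \<in> Mstar0"
  unfolding dilate_star_def by (intro normalized_Mstar0 dilate_radon0 Mstar0_radon0)

lemma translate_star_Mstar0_iff:
  assumes "\<mu> \<in> radon"
  shows "translate_star x \<mu> \<in> Mstar0 \<longleftrightarrow> x \<in> supp \<mu>"
  using normalized_Mstar0 normalized_Mstar0_D[OF translate_radon[OF assms]] translate_radon0_iff[OF assms]
  unfolding translate_star_def by metis

lemma dilate_star_dilate_star:
  "\<mu> \<in> Mstar0 \<Longrightarrow> dilate_star s (dilate_star t \<mu>) = dilate_star (s + t) \<mu>"
  by (simp add: dilate_star_def[of t] normalized_absorb dilate_radon0 Mstar0_radon0)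
    (simp add: dilate_star_def dilate_dilate radon0_radon Mstar0_radon0)

lemma dilate_square_dilate_star:
  "\<mu> \<in> Mstar0 \<Longrightarrow> dilate_square s (dilate_star t \<mu>) = dilate_square (s + t) \<mu>"
  by (simp add: dilate_star_def[of t] normalized_absorb dilate_radon0 Mstar0_radon0)
    (simp add: dilate_square_def dilate_dilate radon0_radon Mstar0_radon0)

lemma square_dilate_star: "\<mu> \<in> Mstar0 \<Longrightarrow> square (dilate_star t \<mu>) = dilate_square t \<mu>"
  by (simp add: dilate_star_def normalized_absorb dilate_radon0 Mstar0_radon0 dilate_square_def)

text \<open>The scenery at \<open>x\<close> is the scenery at \<open>0\<close> of the recentred
  measure, so its long-run behaviour is decided by membership of
  \<open>translate_star x \<mu>\<close> in sets such as \<open>frequent V q\<close>.\<close>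

lemma scenery_eq:
  assumes "\<mu> \<in> radon" "x \<in> supp \<mu>"
  shows "scenery \<mu> x t = dilate_square t (translate_star x \<mu>)"
  using assms by (simp add: scenery_def translate_star_def normalized_absorb translate_radon0_iff)

lemma translate_star_0: "\<mu> \<in> Mstar \<Longrightarrow> translate_star 0 \<mu> = \<mu>"
  by (simp add: translate_star_def translate_0 normalized_id Mstar_radon)

lemma emeasure_square:
  assumes "\<mu> \<in> radon" "A \<in> sets borel" "A \<subseteq> B1"
  shows "emeasure (square \<mu>) A = emeasure \<mu> A / emeasure \<mu> B1"
  unfolding square_def using assms
  by (subst emeasure_restrict_space) (auto simp: emeasure_normalized sets_radon)

lemma sets_square: "\<mu> \<in> radon \<Longrightarrow> sets (square \<mu>) = sets (restrict_space borel B1)"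
  unfolding square_def by (intro sets_restrict_space_cong) (simp add: sets_radon)

lemma prob_space_square:
  assumes "\<mu> \<in> radon" "0 < emeasure \<mu> B1"
  shows "prob_space (square \<mu>)"
proof
  have "space (square \<mu>) = B1"
    using sets_eq_imp_space_eq[OF sets_square[OF assms(1)]] by (simp add: space_restrict_space)
  moreover have "emeasure \<mu> B1 < \<infinity>"
    using assms(1) by (simp add: radon_def B1_def)
  ultimately show "emeasure (square \<mu>) (space (square \<mu>)) = 1"
    using assms by (simp add: emeasure_square ennreal_divide_self less_top[symmetric])
qed

text \<open>The complement of the support is covered by the countably many basic open sets of mass
  \<open>0\<close>.\<close>

lemma AE_supp:
  fixes \<mu> :: "(real^'n) measure"
  assumes "\<mu> \<in> radon"
  shows "AE x in \<mu>. x \<in> supp \<mu>"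
proof -
  obtain \<B> :: "(real^'n) set set" where \<B>: "countable \<B>" "topological_basis \<B>"
    using ex_countable_basis by blast
  let ?N = "\<Union>{b \<in> \<B>. emeasure \<mu> b = 0}"
  have "?N \<in> null_sets \<mu>"
  proof (rule null_sets_UN'[of "{b \<in> \<B>. emeasure \<mu> b = 0}" "\<lambda>b. b", simplified])
    show "countable {b \<in> \<B>. emeasure \<mu> b = 0}"
      using \<B>(1) by (rule countable_subset[rotated]) auto
    show "b \<in> null_sets \<mu>" if "b \<in> \<B> \<and> emeasure \<mu> b = 0" for b
      using that topological_basis_open[OF \<B>(2), of b] by (auto simp: null_sets_def sets_radon[OF assms])
  qed
  moreover have "x \<in> ?N" if x: "x \<notin> supp \<mu>" for x
  proof -
    obtain U where U: "open U" "x \<in> U" "emeasure \<mu> U = 0"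
      using x by (auto simp: supp_def zero_less_iff_neq_zero)
    obtain b where b: "b \<in> \<B>" "x \<in> b" "b \<subseteq> U"
      using topological_basisE[OF \<B>(2) U(1,2)] by blast
    have "emeasure \<mu> b \<le> emeasure \<mu> U"
      using b U(1) by (intro emeasure_mono) (auto simp: sets_radon[OF assms])
    then show ?thesis
      using b U(3) by auto
  qed
  ultimately show ?thesis
    by (intro AE_I'[of ?N]) auto
qed

section \<open>Measurability of recentring and rescaling\<close>

lemma Mstar0_sets [measurable]: "Mstar0 \<in> sets Mstar_borel"
proof -
  have eq: "Mstar0 = {\<mu> \<in> space Mstar_borel. \<forall>n::nat. 0 < emeasure \<mu> (ball 0 (1 / Suc n))}"
  proof (intro equalityI subsetI)
    fix \<mu> :: "(real^'n) measure"
    assume \<mu>: "\<mu> \<in> {\<mu> \<in> space Mstar_borel. \<forall>n::nat. 0 < emeasure \<mu> (ball 0 (1 / Suc n))}"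
    have "0 < emeasure \<mu> U" if U: "open U" "0 \<in> U" for U
    proof -
      obtain e where e: "e > 0" "ball 0 e \<subseteq> U"
        using U openE by blast
      obtain n where "1 / Suc n < e"
        using e(1) nat_approx_posE by blast
      then have "ball 0 (1 / Suc n) \<subseteq> U"
        using e(2) subset_ball[of "1 / Suc n" e 0] by auto
      then have "emeasure \<mu> (ball 0 (1 / Suc n)) \<le> emeasure \<mu> U"
        using U(1) \<mu> by (intro emeasure_mono) (auto simp: Mstar_def sets_radon)
      moreover have "0 < emeasure \<mu> (ball 0 (1 / Suc n))"
        using \<mu> by blast
      ultimately show ?thesis
        by (rule less_le_trans[rotated])
    qed
    then show "\<mu> \<in> Mstar0"
      using \<mu> by (auto simp: Mstar0_def supp_def)
  qed (auto simp: Mstar0_def supp_def)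
  have [measurable]: "(\<lambda>\<mu>. emeasure \<mu> (ball 0 (1 / real (Suc n)))) \<in> borel_measurable Mstar_borel" for n
    by (rule emeasure_Mstar_measurable_open) auto
  show ?thesis
    unfolding eq by measurable
qed

lemma emeasure_dilate_measurable:
  assumes [measurable]: "t \<in> borel_measurable N" and h: "h \<in> N \<rightarrow>\<^sub>M Mstar_borel"
    and [measurable]: "A \<in> sets borel"
  shows "(\<lambda>x. emeasure (dilate (t x) (h x)) A) \<in> borel_measurable N"
proof (rule measurable_congI)
  show "(\<lambda>x. emeasure (h x) {y. exp (t x) *\<^sub>R y \<in> A}) \<in> borel_measurable N"
    by (rule emeasure_Mstar_measurable[OF h]) measurable
  show "emeasure (dilate (t x) (h x)) A = emeasure (h x) {y. exp (t x) *\<^sub>R y \<in> A}" if "x \<in> space N" for x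
    using measurable_space[OF h that] by (simp add: emeasure_dilate Mstar_radon)
qed

lemma emeasure_translate_measurable:
  assumes [measurable]: "a \<in> N \<rightarrow>\<^sub>M borel" and h: "h \<in> N \<rightarrow>\<^sub>M Mstar_borel"
    and [measurable]: "A \<in> sets borel"
  shows "(\<lambda>x. emeasure (translate (a x) (h x)) A) \<in> borel_measurable N"
proof (rule measurable_congI)
  show "(\<lambda>x. emeasure (h x) {y. y - a x \<in> A}) \<in> borel_measurable N"
    by (rule emeasure_Mstar_measurable[OF h]) measurable
  show "emeasure (translate (a x) (h x)) A = emeasure (h x) {y. y - a x \<in> A}" if "x \<in> space N" for x
    using measurable_space[OF h that] by (simp add: emeasure_translate Mstar_radon)
qed

lemma normalized_measurable:
  fixes h :: "'x \<Rightarrow> (real^'n) measure"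
  assumes "\<And>x. x \<in> space N \<Longrightarrow> h x \<in> radon" "\<And>x. x \<in> space N \<Longrightarrow> 0 < emeasure (h x) B1"
    and "\<And>A. A \<in> sets borel \<Longrightarrow> (\<lambda>x. emeasure (h x) A) \<in> borel_measurable N"
  shows "(\<lambda>x. normalized (h x)) \<in> N \<rightarrow>\<^sub>M Mstar_borel"
proof (rule measurable_Mstar_borelI)
  fix W :: "(real^'n) set" assume "open W"
  then show "(\<lambda>x. emeasure (normalized (h x)) W) \<in> borel_measurable N"
    unfolding emeasure_normalized by (intro borel_measurable_divide_ennreal assms(3)) auto
qed (intro normalized_Mstar assms(1,2))

lemma dilate_star_measurable:
  fixes h :: "'x \<Rightarrow> (real^'n) measure"
  assumes t: "t \<in> borel_measurable N" and h: "h \<in> N \<rightarrow>\<^sub>M Mstar_borel"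
    and h0: "\<And>x. x \<in> space N \<Longrightarrow> h x \<in> Mstar0"
  shows "(\<lambda>x. dilate_star (t x) (h x)) \<in> N \<rightarrow>\<^sub>M Mstar_borel"
  unfolding dilate_star_def using h0
  by (intro normalized_measurable emeasure_dilate_measurable[OF t h])
    (auto intro: radon0_radon radon0_B1 dilate_radon0 Mstar0_radon0)

lemma translate_star_measurable:
  fixes h :: "'x \<Rightarrow> (real^'n) measure"
  assumes a: "a \<in> N \<rightarrow>\<^sub>M borel" and h: "h \<in> N \<rightarrow>\<^sub>M Mstar_borel"
    and pos: "\<And>x. x \<in> space N \<Longrightarrow> 0 < emeasure (translate (a x) (h x)) B1"
  shows "(\<lambda>x. translate_star (a x) (h x)) \<in> N \<rightarrow>\<^sub>M Mstar_borel"
  unfolding translate_star_def using measurable_space[OF h] pos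
  by (intro normalized_measurable emeasure_translate_measurable[OF a h])
    (auto intro: translate_radon Mstar_radon)

text \<open>Where \<open>B1\<close> has positive mass after the translation,
  \<open>translate_star\<close> is a measurable map into \<open>Mstar\<close>; elsewhere its value
  lies outside \<open>Mstar\<close>, hence outside \<open>E\<close>, and contributes
  nothing.\<close>

lemma translate_star_sets:
  fixes h :: "'x \<Rightarrow> (real^'n) measure"
  assumes a: "a \<in> N \<rightarrow>\<^sub>M borel" and h: "h \<in> N \<rightarrow>\<^sub>M Mstar_borel"
    and E: "E \<in> sets Mstar_borel"
  shows "{x \<in> space N. translate_star (a x) (h x) \<in> E} \<in> sets N"
proof -
  define W where "W = {x \<in> space N. 0 < emeasure (translate (a x) (h x)) B1}"
  have [measurable]: "(\<lambda>x. emeasure (translate (a x) (h x)) B1) \<in> borel_measurable N"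
    by (rule emeasure_translate_measurable[OF a h]) simp
  have W: "W \<in> sets N"
    unfolding W_def by measurable
  have "(\<lambda>x. translate_star (a x) (h x)) \<in> restrict_space N W \<rightarrow>\<^sub>M Mstar_borel"
    by (rule translate_star_measurable)
      (auto simp: W_def space_restrict_space intro: measurable_restrict_space1 a h)
  from measurable_sets[OF this E]
  have "{x \<in> W. translate_star (a x) (h x) \<in> E} \<in> sets (restrict_space N W)"
    unfolding space_restrict_space2[OF W] by (simp add: vimage_def Int_def conj_commute)
  moreover have "{x \<in> W. translate_star (a x) (h x) \<in> E} = {x \<in> space N. translate_star (a x) (h x) \<in> E}"
    using sets.sets_into_space[OF E]
    by (auto simp: W_def translate_star_def intro: normalized_Mstar_D[OF subsetD, of E])
  ultimately show ?thesis
    using W by (simp add: sets_restrict_space_iff)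
qed

lemma square_measurable_kernel:
  fixes h :: "'x \<Rightarrow> (real^'n) measure"
  assumes rad: "\<And>x. x \<in> space N \<Longrightarrow> h x \<in> radon"
    and pos: "\<And>x. x \<in> space N \<Longrightarrow> 0 < emeasure (h x) B1"
    and ev: "\<And>A. A \<in> sets borel \<Longrightarrow> (\<lambda>x. emeasure (h x) A) \<in> borel_measurable N"
  shows "(\<lambda>x. square (h x)) \<in> N \<rightarrow>\<^sub>M borel_of Msquare"
  unfolding Msquare_def
proof (rule measurable_prob_topologyI, rule measurable_prob_algebraI)
  show "prob_space (square (h x))" if "x \<in> space N" for x
    using prob_space_square[OF rad[OF that] pos[OF that]] .
  show "(\<lambda>x. square (h x)) \<in> N \<rightarrow>\<^sub>M subprob_algebra (restrict_space borel B1)"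
  proof (rule measurable_subprob_algebra)
    show "subprob_space (square (h x))" if "x \<in> space N" for x
      using prob_space_square[OF rad[OF that] pos[OF that]] by (rule prob_space_imp_subprob_space)
    show "sets (square (h x)) = sets (restrict_space borel B1)" if "x \<in> space N" for x
      by (rule sets_square[OF rad[OF that]])
    fix A :: "(real^'n) set" assume "A \<in> sets (restrict_space borel B1)"
    then have A: "A \<in> sets borel" "A \<subseteq> B1"
      by (auto simp: sets_restrict_space)
    show "(\<lambda>x. emeasure (square (h x)) A) \<in> borel_measurable N"
    proof (rule measurable_congI)
      show "(\<lambda>x. emeasure (h x) A / emeasure (h x) B1) \<in> borel_measurable N"
        by (intro borel_measurable_divide_ennreal ev A B1_borel)
      show "emeasure (square (h x)) A = emeasure (h x) A / emeasure (h x) B1" if "x \<in> space N" for x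
        by (rule emeasure_square[OF rad[OF that] A])
    qed
  qed
qed

lemma dilate_square_measurable:
  fixes h :: "'x \<Rightarrow> (real^'n) measure"
  assumes t: "t \<in> borel_measurable N" and h: "h \<in> N \<rightarrow>\<^sub>M Mstar_borel"
    and h0: "\<And>x. x \<in> space N \<Longrightarrow> h x \<in> Mstar0"
  shows "(\<lambda>x. dilate_square (t x) (h x)) \<in> N \<rightarrow>\<^sub>M borel_of Msquare"
  unfolding dilate_square_def using h0
  by (intro square_measurable_kernel emeasure_dilate_measurable[OF t h])
    (auto intro: radon0_radon radon0_B1 dilate_radon0 Mstar0_radon0)

lemma square_measurable: "square \<in> Mstar_borel \<rightarrow>\<^sub>M borel_of Msquare"
proof -
  have "(\<lambda>\<mu>. square \<mu>) \<in> Mstar_borel \<rightarrow>\<^sub>M borel_of Msquare"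
  proof (rule square_measurable_kernel)
    fix A :: "(real^'n) set" assume A [measurable]: "A \<in> sets borel"
    show "(\<lambda>\<mu>. emeasure \<mu> A) \<in> borel_measurable Mstar_borel"
      by (rule emeasure_Mstar_measurable) auto
  qed (auto simp: Mstar_def)
  then show ?thesis
    by simp
qed

text \<open>\<open>dilate_star\<close> is an action on \<open>Mstar0\<close> only, so the dynamics
  has to live on the restriction of \<open>P\<close> to this set of full measure.\<close>

lemma S_invariant_restrict_space:
  fixes P :: "(real^'n) measure measure"
  assumes P: "sets P = sets Mstar_borel" "S_invariant P"
  shows "Mstar0 \<in> sets P" "space P = Mstar" "space (restrict_space P Mstar0) = Mstar0"
    and "AE \<mu> in P. \<mu> \<in> Mstar0"
    and "(\<lambda>\<mu>. \<mu>) \<in> restrict_space P Mstar0 \<rightarrow>\<^sub>M Mstar_borel"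
    and "dilate_star t \<in> restrict_space P Mstar0 \<rightarrow>\<^sub>M P"
    and "distr (restrict_space P Mstar0) P (dilate_star t) = P"
proof -
  show M0: "Mstar0 \<in> sets P"
    using P(1) by simp
  show "space P = Mstar"
    using sets_eq_imp_space_eq[OF P(1)] by simp
  show sp: "space (restrict_space P Mstar0) = Mstar0"
    using M0 by (simp add: space_restrict_space2)
  show id: "(\<lambda>\<mu>. \<mu>) \<in> restrict_space P Mstar0 \<rightarrow>\<^sub>M Mstar_borel"
    by (intro measurable_restrict_space1) (simp add: measurable_ident_sets[OF P(1)])
  show "dilate_star t \<in> restrict_space P Mstar0 \<rightarrow>\<^sub>M P"
    using dilate_star_measurable[OF borel_measurable_const id, of t] sp
    by (simp add: measurable_cong_sets[OF refl P(1)])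
qed (use P(2) in \<open>auto simp: S_invariant_def\<close>)

text \<open>The same exact invariance, with no exceptional null set, that \<open>S_ergodic\<close>
  asks of its sets.\<close>

definition S_invariant_set :: "(real^'n) measure set \<Rightarrow> bool" where
  "S_invariant_set E \<longleftrightarrow> E \<subseteq> Mstar0 \<and> (\<forall>t. {\<mu> \<in> Mstar0. dilate_star t \<mu> \<in> E} = E)"

lemma S_invariant_set_iff: "S_invariant_set E \<Longrightarrow> \<mu> \<in> Mstar0 \<Longrightarrow> dilate_star t \<mu> \<in> E \<longleftrightarrow> \<mu> \<in> E"
  by (auto simp: S_invariant_set_def)

text \<open>The function \<open>g\<close> of the overview, for the set \<open>E\<close>.\<close>

definition disagree :: "(real^'n) measure set \<Rightarrow> (real^'n) measure \<Rightarrow> ennreal" where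
  "disagree E \<mu> = emeasure \<mu> {y \<in> B1. (translate_star y \<mu> \<in> E) \<noteq> (\<mu> \<in> E)}"

lemma disagree_measurable:
  assumes E [measurable]: "E \<in> sets Mstar_borel"
  shows "disagree E \<in> borel_measurable Mstar_borel"
  unfolding disagree_def
proof (rule emeasure_Mstar_measurable)
  have [measurable]: "Measurable.pred (Mstar_borel \<Otimes>\<^sub>M borel) (\<lambda>p. translate_star (snd p) (fst p) \<in> E)"
    unfolding pred_def by (rule translate_star_sets[OF _ _ E]) measurable
  show "{p \<in> space (Mstar_borel \<Otimes>\<^sub>M borel). snd p \<in> {y \<in> B1. (translate_star y (fst p) \<in> E) \<noteq> (fst p \<in> E)}}
      \<in> sets (Mstar_borel \<Otimes>\<^sub>M borel)"
    by measurable
qed simp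

lemma translate_star_section:
  assumes "E \<in> sets Mstar_borel" "\<mu> \<in> Mstar"
  shows "{z. translate_star z \<mu> \<in> E} \<in> sets borel"
  using translate_star_sets[of "\<lambda>z. z" borel "\<lambda>_. \<mu>" E] assms by simp

text \<open>Substitute \<open>y = exp t * (z - x)\<close>: by \<open>translate_dilate\<close>,
  recentring at \<open>y\<close> gives the magnified measure around \<open>z\<close>, and invariance
  of \<open>E\<close> removes the time \<open>t\<close>. What remains is the fraction of the window
  at \<open>x\<close> that lies on the other side of
  \<open>{z. translate_star z \<mu> \<in> E}\<close>.\<close>

lemma disagree_dilate_translate:
  fixes \<mu> :: "(real^'n) measure"
  assumes E: "S_invariant_set E" "E \<in> sets Mstar_borel" and \<mu>: "\<mu> \<in> Mstar" "x \<in> supp \<mu>"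
  shows "disagree E (dilate_star t (translate_star x \<mu>)) =
    emeasure \<mu> {z. in_window t x z \<and> (translate_star z \<mu> \<in> E) \<noteq> (translate_star x \<mu> \<in> E)} /
    emeasure \<mu> {z. in_window t x z}"
proof -
  define \<rho> where "\<rho> = dilate_star t (translate_star x \<mu>)"
  let ?\<kappa> = "dilate t (translate x \<mu>)"
  have rad: "\<mu> \<in> radon"
    using \<mu>(1) by (rule Mstar_radon)
  have tr0: "translate x \<mu> \<in> radon0"
    using \<mu>(2) rad by (simp add: translate_radon0_iff)
  have \<kappa>0: "?\<kappa> \<in> radon0"
    by (rule dilate_radon0[OF tr0])
  have \<rho>: "\<rho> = normalized ?\<kappa>"
    unfolding \<rho>_def translate_star_def normalized_absorb[OF tr0] by (simp add: dilate_star_def)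
  have \<rho>M: "\<rho> \<in> Mstar"
    using normalized_Mstar0[OF \<kappa>0] by (simp add: \<rho> Mstar0_def)
  have em: "emeasure \<rho> A = emeasure \<mu> {z. exp t *\<^sub>R (z - x) \<in> A} / emeasure \<mu> {z. in_window t x z}"
    if [measurable]: "A \<in> sets borel" for A
    by (simp add: \<rho> emeasure_normalized emeasure_dilate translate_radon rad emeasure_translate)
  have \<rho>E: "\<rho> \<in> E \<longleftrightarrow> translate_star x \<mu> \<in> E"
    unfolding \<rho>_def using translate_star_Mstar0_iff[OF rad] \<mu>(2) by (intro S_invariant_set_iff[OF E(1)]) simp
  have trE: "translate_star (exp t *\<^sub>R (z - x)) \<rho> \<in> E \<longleftrightarrow> translate_star z \<mu> \<in> E" for z
  proof -
    have eq: "translate_star (exp t *\<^sub>R (z - x)) \<rho> = normalized (dilate t (translate z \<mu>))"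
      unfolding \<rho> normalized_absorb[OF \<kappa>0] by (simp add: translate_star_def translate_dilate[OF rad])
    show ?thesis
    proof (cases "z \<in> supp \<mu>")
      case True
      then have z0: "translate z \<mu> \<in> radon0"
        using rad by (simp add: translate_radon0_iff)
      have "normalized (dilate t (translate z \<mu>)) = dilate_star t (translate_star z \<mu>)"
        unfolding translate_star_def normalized_absorb[OF z0] by (simp add: dilate_star_def)
      then show ?thesis
        unfolding eq using translate_star_Mstar0_iff[OF rad] True
        by (simp add: S_invariant_set_iff[OF E(1)])
    next
      case False
      \<comment> \<open>Off the support neither of the two measures charges every neighbourhood of
        \<open>0\<close>, so neither can lie in \<open>E \<subseteq> Mstar0\<close>.\<close>
      have "normalized (dilate t (translate z \<mu>)) \<notin> Mstar0"
      proof
        assume "normalized (dilate t (translate z \<mu>)) \<in> Mstar0"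
        then have "dilate t (translate z \<mu>) \<in> radon0"
          by (rule normalized_Mstar0_D[OF dilate_radon[OF translate_radon[OF rad]]])
        then have "dilate (- t) (dilate t (translate z \<mu>)) \<in> radon0"
          by (rule dilate_radon0)
        then have "translate z \<mu> \<in> radon0"
          by (simp add: dilate_dilate translate_radon rad dilate_0)
        then show False
          using False rad by (simp add: translate_radon0_iff)
      qed
      moreover have "translate_star z \<mu> \<notin> Mstar0"
        using False rad by (simp add: translate_star_Mstar0_iff)
      ultimately show ?thesis
        using E(1) by (auto simp: eq S_invariant_set_def)
    qed
  qed
  have "{y \<in> B1. (translate_star y \<rho> \<in> E) \<noteq> (\<rho> \<in> E)} \<in> sets borel"
  proof -
    have "{y \<in> B1. (translate_star y \<rho> \<in> E) \<noteq> (\<rho> \<in> E)} =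
        (if \<rho> \<in> E then B1 - {y. translate_star y \<rho> \<in> E} else B1 \<inter> {y. translate_star y \<rho> \<in> E})"
      by auto
    then show ?thesis
      using translate_star_section[OF E(2) \<rho>M] B1_borel by (simp add: sets.Diff sets.Int)
  qed
  from em[OF this] show ?thesis
    unfolding \<rho>_def[symmetric] disagree_def by (simp add: trE \<rho>E)
qed


section \<open>A density theorem in mean\<close>

lemma ennreal_divide_le_1: "a \<le> b \<Longrightarrow> b < \<top> \<Longrightarrow> a / b \<le> (1 :: ennreal)"
  using divide_right_mono_ennreal[of a b b] by (cases "b = 0") auto

lemma ennreal_inverse_antimono: "a \<le> b \<Longrightarrow> inverse b \<le> inverse (a :: ennreal)"
  by (simp add: less_eq_ennreal.rep_eq inverse_ennreal.rep_eq ereal_inverse_antimono)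

text \<open>Radius \<open>1 / 2\<close>: two points of one such ball differ by a vector of
  \<open>ball 0 1\<close>, which lies in \<open>B1\<close>.\<close>

lemma B1_cover:
  "\<exists>C :: (real^'n) set. finite C \<and> B1 \<subseteq> (\<Union>c\<in>C. ball c (1 / 2))"
proof -
  have "compact (B1 :: (real^'n) set)"
    by (simp add: B1_def)
  then show ?thesis
    using compact_eq_totally_bounded[of "B1 :: (real^'n) set"] by (auto intro!: exI[of _ "1 / 2"])
qed

lemma local_emeasure_measurable:
  fixes \<nu> :: "(real^'n) measure"
  assumes \<nu>: "\<nu> \<in> radon"
    and [measurable]: "Measurable.pred (borel \<Otimes>\<^sub>M borel) (\<lambda>p. Q (fst p) (snd p))"
  shows "(\<lambda>x. emeasure \<nu> {z. in_window t x z \<and> Q x z}) \<in> borel_measurable borel"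
proof (rule emeasure_radon_measurable[OF \<nu>])
  show "{p \<in> space (borel \<Otimes>\<^sub>M borel). snd p \<in> {z. in_window t (fst p) z \<and> Q (fst p) z}}
      \<in> sets (borel \<Otimes>\<^sub>M (borel :: (real^'n) measure))"
    unfolding mem_Collect_eq by measurable
qed simp

text \<open>After exchanging the integrals it remains to integrate \<open>1 / \<nu>(window at x)\<close> over the \<open>x\<close> whose
  window contains \<open>z\<close>. These \<open>x\<close> are covered by boundedly many sets \<open>Q c\<close>, each contained in the
  window of each of its points, so each contributes at most \<open>1\<close>.\<close>

lemma local_fraction_bound:
  "\<exists>k :: nat. \<forall>(\<nu> :: (real^'n) measure) W t. finite_measure \<nu> \<longrightarrow> sets \<nu> = sets borel \<longrightarrow> W \<in> sets borel \<longrightarrow>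
    (\<integral>\<^sup>+x. emeasure \<nu> {z. in_window t x z \<and> z \<in> W} /
       emeasure \<nu> {z. in_window t x z} \<partial>\<nu>) \<le> of_nat k * emeasure \<nu> W"
proof -
  obtain C :: "(real^'n) set" where C: "finite C" "B1 \<subseteq> (\<Union>c\<in>C. ball c (1 / 2))"
    using B1_cover by blast
  show ?thesis
  proof (intro exI[of _ "card C"] allI impI)
    fix \<nu> :: "(real^'n) measure" and W :: "(real^'n) set" and t :: real
    assume fin: "finite_measure \<nu>" and sets [measurable_cong]: "sets \<nu> = sets borel"
      and W [measurable]: "W \<in> sets borel"
    interpret finite_measure \<nu> by fact
    interpret P: pair_sigma_finite \<nu> \<nu> ..
    have sp [simp]: "space \<nu> = UNIV"
      using sets_eq_imp_space_eq[OF sets] by simp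
    define A where "A x = {z. in_window t x z}" for x :: "real^'n"
    define r where "r x = inverse (emeasure \<nu> (A x))" for x
    have [measurable]: "Measurable.pred (\<nu> \<Otimes>\<^sub>M \<nu>) (\<lambda>p. exp t *\<^sub>R (snd p - fst p) \<in> B1)"
      by measurable
    have [measurable]: "r \<in> borel_measurable \<nu>"
      unfolding r_def A_def by measurable
    have inner: "(\<integral>\<^sup>+x. indicator {x. z \<in> A x} x * r x \<partial>\<nu>) \<le> of_nat (card C)" for z
    proof -
      define Q where "Q c = {x. exp t *\<^sub>R (z - x) \<in> ball c (1 / 2)}" for c
      have Q [measurable]: "Q c \<in> sets borel" for c
        unfolding Q_def mem_ball by measurable
      have Q_sub: "Q c \<subseteq> A x" if x: "x \<in> Q c" for c x
      proof
        fix y assume y: "y \<in> Q c"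
        have "dist (exp t *\<^sub>R (z - x)) (exp t *\<^sub>R (z - y)) < 1"
          by (rule dist_triangle_half_r[of c]) (use x y in \<open>simp_all add: Q_def\<close>)
        moreover have "exp t *\<^sub>R (z - x) - exp t *\<^sub>R (z - y) = exp t *\<^sub>R (y - x)"
          by (simp add: algebra_simps)
        ultimately have "exp t *\<^sub>R (y - x) \<in> ball 0 1"
          by (simp add: dist_norm)
        then show "y \<in> A x"
          using ball_subset_B1 by (auto simp: A_def)
      qed
      have A_meas [measurable]: "A x \<in> sets borel" for x
        unfolding A_def by measurable
      have "(\<integral>\<^sup>+x. indicator {x. z \<in> A x} x * r x \<partial>\<nu>) \<le>
          (\<integral>\<^sup>+x. (\<Sum>c\<in>C. indicator (Q c) x * inverse (emeasure \<nu> (Q c))) \<partial>\<nu>)"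
      proof (rule nn_integral_mono)
        fix x
        show "indicator {x. z \<in> A x} x * r x \<le> (\<Sum>c\<in>C. indicator (Q c) x * inverse (emeasure \<nu> (Q c)))"
        proof (cases "z \<in> A x")
          case True
          then obtain c where c: "c \<in> C" "x \<in> Q c"
            using C(2) by (auto simp: A_def Q_def)
          have "r x \<le> inverse (emeasure \<nu> (Q c))"
            unfolding r_def using Q_sub[OF c(2)]
            by (intro ennreal_inverse_antimono emeasure_mono) (auto simp: sets)
          also have "\<dots> = indicator (Q c) x * inverse (emeasure \<nu> (Q c))"
            using c by simp
          also have "\<dots> \<le> (\<Sum>c\<in>C. indicator (Q c) x * inverse (emeasure \<nu> (Q c)))"
            by (rule member_le_sum[OF c(1) _ C(1)]) simp
          finally show ?thesis
            using True by simp
        qed simp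
      qed
      also have "\<dots> = (\<Sum>c\<in>C. emeasure \<nu> (Q c) * inverse (emeasure \<nu> (Q c)))"
        by (simp add: nn_integral_sum nn_integral_multc)
      \<comment> \<open>A null \<open>Q c\<close> contributes \<open>0 * \<infinity> = 0\<close>, so
        every summand is at most \<open>1\<close>.\<close>
      also have "\<dots> \<le> (\<Sum>c\<in>C. 1)"
        unfolding divide_ennreal_def[symmetric]
        by (intro sum_mono ennreal_divide_le_1) (auto simp: less_top[symmetric])
      finally show ?thesis
        by simp
    qed
    have "(\<integral>\<^sup>+x. emeasure \<nu> {z. in_window t x z \<and> z \<in> W} /
        emeasure \<nu> {z. in_window t x z} \<partial>\<nu>) =
        (\<integral>\<^sup>+x. (\<integral>\<^sup>+z. indicator {z. in_window t x z} z * indicator W z * r x \<partial>\<nu>) \<partial>\<nu>)"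
    proof (intro nn_integral_cong)
      fix x
      have "(\<integral>\<^sup>+z. indicator {z. in_window t x z} z * indicator W z * r x \<partial>\<nu>) =
          (\<integral>\<^sup>+z. indicator {z. in_window t x z \<and> z \<in> W} z \<partial>\<nu>) * r x"
        by (subst nn_integral_multc[symmetric]) (auto intro!: nn_integral_cong split: split_indicator)
      then show "emeasure \<nu> {z. in_window t x z \<and> z \<in> W} /
          emeasure \<nu> {z. in_window t x z} =
          (\<integral>\<^sup>+z. indicator {z. in_window t x z} z * indicator W z * r x \<partial>\<nu>)"
        by (simp add: divide_ennreal_def r_def A_def)
    qed
    also have "\<dots> = (\<integral>\<^sup>+z. (\<integral>\<^sup>+x. indicator {z. in_window t x z} z * indicator W z * r x \<partial>\<nu>) \<partial>\<nu>)"
      by (rule P.Fubini'[symmetric]) measurable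
    also have "\<dots> = (\<integral>\<^sup>+z. indicator W z * (\<integral>\<^sup>+x. indicator {x. z \<in> A x} x * r x \<partial>\<nu>) \<partial>\<nu>)"
    proof (intro nn_integral_cong)
      fix z
      have [measurable]: "{x. z \<in> A x} \<in> sets borel"
        unfolding A_def by measurable
      show "(\<integral>\<^sup>+x. indicator {z. in_window t x z} z * indicator W z * r x \<partial>\<nu>) =
          indicator W z * (\<integral>\<^sup>+x. indicator {x. z \<in> A x} x * r x \<partial>\<nu>)"
        by (subst nn_integral_cmult[symmetric])
          (auto intro!: nn_integral_cong simp: A_def split: split_indicator)
    qed
    also have "\<dots> \<le> (\<integral>\<^sup>+z. indicator W z * of_nat (card C) \<partial>\<nu>)"
      by (intro nn_integral_mono mult_left_mono inner) auto
    also have "\<dots> = of_nat (card C) * emeasure \<nu> W"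
      by (simp add: nn_integral_multc mult.commute)
    finally show "(\<integral>\<^sup>+x. emeasure \<nu> {z. in_window t x z \<and> z \<in> W} /
       emeasure \<nu> {z. in_window t x z} \<partial>\<nu>) \<le> of_nat (card C) * emeasure \<nu> W" .
  qed
qed

lemma compact_inner_approx:
  fixes \<nu> :: "(real^'n) measure"
  assumes "finite_measure \<nu>" "sets \<nu> = sets borel" "H \<in> sets borel" "0 < \<epsilon>"
  obtains K where "compact K" "K \<subseteq> H" "measure \<nu> (H - K) < \<epsilon>"
proof -
  interpret finite_measure \<nu> by fact
  have H: "H \<in> sets \<nu>"
    using assms by simp
  have "\<exists>K. compact K \<and> K \<subseteq> H \<and> measure \<nu> H - \<epsilon> < measure \<nu> K"
  \<comment> \<open>For such a small \<open>H\<close> the empty set will do; otherwise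
    \<open>measure \<nu> H - \<epsilon>\<close> is nonnegative and survives the passage to
    \<open>ennreal\<close>.\<close>
  proof (cases "measure \<nu> H < \<epsilon>")
    case True
    then show ?thesis
      by (intro exI[of _ "{}"]) auto
  next
    case False
    have "ennreal (measure \<nu> H - \<epsilon>) < emeasure \<nu> H"
      using False assms(4) by (simp add: emeasure_eq_measure ennreal_lessI)
    also have "emeasure \<nu> H = (SUP K \<in> {K. K \<subseteq> H \<and> compact K}. emeasure \<nu> K)"
      by (rule inner_regular[OF assms(2) _ assms(3)]) simp
    finally obtain K where "K \<subseteq> H" "compact K" "ennreal (measure \<nu> H - \<epsilon>) < emeasure \<nu> K"
      by (auto simp: less_SUP_iff)
    then show ?thesis
      using False by (intro exI[of _ K]) (simp add: emeasure_eq_measure ennreal_less_iff)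
  qed
  then obtain K where K: "compact K" "K \<subseteq> H" "measure \<nu> H - \<epsilon> < measure \<nu> K"
    by blast
  moreover have "measure \<nu> (H - K) = measure \<nu> H - measure \<nu> K"
    using K H by (intro finite_measure_Diff) (auto simp: assms(2) borel_compact)
  ultimately show thesis
    by (intro that[of K]) auto
qed

text \<open>Disjoint compact sets \<open>K1 \<subseteq> H\<close> and
  \<open>K2 \<subseteq> - H\<close> have positive distance, so a small window cannot meet both. A
  wrong point \<open>z\<close> in the window of \<open>x\<close> then forces \<open>x\<close> or
  \<open>z\<close> into the remainder \<open>W\<close>: the first case costs at most the mass of
  \<open>W\<close>, the second at most \<open>k\<close> times that by
  \<open>local_fraction_bound\<close>.\<close>

lemma density_in_mean:
  fixes \<nu> :: "(real^'n) measure"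
  assumes fin: "finite_measure \<nu>" and sets: "sets \<nu> = sets borel" and H: "H \<in> sets borel"
  shows "(\<lambda>n. \<integral>\<^sup>+x. emeasure \<nu> {z. in_window (real n) x z \<and> (z \<in> H) \<noteq> (x \<in> H)} /
    emeasure \<nu> {z. in_window (real n) x z} \<partial>\<nu>) \<longlonglongrightarrow> 0"
proof (rule order_tendstoI)
  interpret finite_measure \<nu> by fact
  fix a :: ennreal assume "0 < a"
  then obtain b where b: "0 < b" "b < a"
    using dense by blast
  then obtain s where s: "b = ennreal s" "0 < s"
    by (cases b) auto
  obtain k :: nat where k': "\<forall>(\<nu> :: (real^'n) measure) W t. finite_measure \<nu> \<longrightarrow> sets \<nu> = sets borel \<longrightarrow> W \<in> sets borel \<longrightarrow>
    (\<integral>\<^sup>+x. emeasure \<nu> {z. in_window t x z \<and> z \<in> W} /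
       emeasure \<nu> {z. in_window t x z} \<partial>\<nu>) \<le> of_nat k * emeasure \<nu> W"
    using local_fraction_bound[where 'n = 'n] by blast
  have k: "\<And>W t. W \<in> sets borel \<Longrightarrow>
    (\<integral>\<^sup>+x. emeasure \<nu> {z. in_window t x z \<and> z \<in> W} /
       emeasure \<nu> {z. in_window t x z} \<partial>\<nu>) \<le> of_nat k * emeasure \<nu> (W :: (real^'n) set)"
    by (rule k'[rule_format, OF fin sets])
  \<comment> \<open>Two remainders of mass below \<open>\<epsilon>\<close>, weighted by the total
    factor \<open>1 + k\<close>, stay within \<open>s\<close>.\<close>
  define \<epsilon> where "\<epsilon> = s / (2 * (1 + real k))"
  have \<epsilon>: "\<epsilon> > 0"
    using s by (simp add: \<epsilon>_def)
  obtain K1 where K1: "compact K1" "K1 \<subseteq> H" "measure \<nu> (H - K1) < \<epsilon>"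
    using compact_inner_approx[OF fin sets H \<epsilon>] .
  have H': "- H \<in> sets borel"
    using H by (simp add: borel_comp)
  obtain K2 where K2: "compact K2" "K2 \<subseteq> - H" "measure \<nu> (- H - K2) < \<epsilon>"
    using compact_inner_approx[OF fin sets H' \<epsilon>] .
  define W where "W = (H - K1) \<union> (- H - K2)"
  have [measurable]: "K1 \<in> sets borel" "K2 \<in> sets borel" "- H \<in> sets borel"
    using K1(1) K2(1) H by (auto simp: borel_compact borel_comp)
  have W [measurable]: "W \<in> sets borel"
    unfolding W_def using H by measurable
  have "measure \<nu> W \<le> measure \<nu> (H - K1) + measure \<nu> (- H - K2)"
    unfolding W_def using H by (intro measure_Un_le) (auto simp: sets)
  then have "measure \<nu> W \<le> 2 * \<epsilon>"
    using K1(3) K2(3) by simp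
  then have \<nu>W: "emeasure \<nu> W \<le> ennreal (2 * \<epsilon>)"
    by (simp add: emeasure_eq_measure ennreal_leI)
  have "K1 \<inter> K2 = {}"
    using K1(2) K2(2) by auto
  then obtain d where d: "d > 0" "\<And>x y. x \<in> K1 \<Longrightarrow> y \<in> K2 \<Longrightarrow> d \<le> dist x y"
    using separate_compact_closed[OF K1(1) compact_imp_closed[OF K2(1)]] by blast
  have "bounded (B1 :: (real^'n) set)"
    by (simp add: B1_def)
  then obtain r where r: "\<And>x :: real^'n. x \<in> B1 \<Longrightarrow> norm x \<le> r"
    by (auto simp: bounded_iff)
  obtain N :: nat where N: "r / d < real N"
    using reals_Archimedean2 by blast
  \<comment> \<open>\<open>exp (- n) * r\<close> bounds the distance from \<open>x\<close> to the
    points of its window at time \<open>n\<close>.\<close>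
  have "exp (- real n) * r < d" if "n \<ge> N" for n
  proof -
    have "r < d * real N"
      using N d(1) by (simp add: field_simps)
    also have "real N \<le> exp (real n)"
      using that exp_ge_add_one_self[of "real n"] by linarith
    then have "d * real N \<le> d * exp (real n)"
      using d(1) by simp
    finally have "exp (- real n) * r < exp (- real n) * (d * exp (real n))"
      by simp
    then show ?thesis
      by (simp add: exp_minus field_simps)
  qed
  then have "\<forall>\<^sub>F n in sequentially. exp (- real n) * r < d"
    by (auto simp: eventually_sequentially)
  then show "\<forall>\<^sub>F n in sequentially. (\<integral>\<^sup>+x. emeasure \<nu> {z. in_window (real n) x z \<and> (z \<in> H) \<noteq> (x \<in> H)} /
    emeasure \<nu> {z. in_window (real n) x z} \<partial>\<nu>) < a"
  proof eventually_elim
    case (elim n)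
    let ?A = "\<lambda>x :: real^'n. {z. in_window (real n) x z}"
    have A_meas: "?A x \<in> sets borel" for x
      by measurable
    have near: "dist x z < d" if "z \<in> ?A x" for x z
    proof -
      have "exp (- real n) * norm (exp (real n) *\<^sub>R (z - x)) \<le> exp (- real n) * r"
        using r[of "exp (real n) *\<^sub>R (z - x)"] that by (intro mult_left_mono) (simp_all del: norm_scaleR)
      also have "exp (- real n) * norm (exp (real n) *\<^sub>R (z - x)) = dist x z"
        by (simp add: dist_norm norm_minus_commute exp_minus)
      finally show ?thesis
        using elim by simp
    qed
    have le: "emeasure \<nu> {z. in_window (real n) x z \<and> (z \<in> H) \<noteq> (x \<in> H)} / emeasure \<nu> (?A x)
      \<le> indicator W x + emeasure \<nu> {z. in_window (real n) x z \<and> z \<in> W} / emeasure \<nu> (?A x)" for x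
    proof (cases "x \<in> W")
      case True
      have "emeasure \<nu> {z. in_window (real n) x z \<and> (z \<in> H) \<noteq> (x \<in> H)} / emeasure \<nu> (?A x) \<le> 1"
        using A_meas by (intro ennreal_divide_le_1 emeasure_mono) (auto simp: sets less_top[symmetric])
      then show ?thesis
        using True by (simp add: add_increasing2)
    next
      case False
      have "{z. in_window (real n) x z \<and> (z \<in> H) \<noteq> (x \<in> H)} \<subseteq> {z. in_window (real n) x z \<and> z \<in> W}"
      proof
        fix z assume z: "z \<in> {z. in_window (real n) x z \<and> (z \<in> H) \<noteq> (x \<in> H)}"
        have dxz: "dist x z < d"
          using near[of z x] z by simp
        have "\<not> (x \<in> K1 \<and> z \<in> K2)" "\<not> (x \<in> K2 \<and> z \<in> K1)"
          using d(2)[of x z] d(2)[of z x] dxz by (auto simp: dist_commute)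
        then show "z \<in> {z. in_window (real n) x z \<and> z \<in> W}"
          using z False K1(2) K2(2) by (auto simp: W_def)
      qed
      moreover have "{z. in_window (real n) x z \<and> z \<in> W} \<in> sets borel"
        by measurable
      ultimately show ?thesis
        using False by (auto intro!: divide_right_mono_ennreal emeasure_mono simp: sets)
    qed
    have "(\<integral>\<^sup>+x. emeasure \<nu> {z. in_window (real n) x z \<and> (z \<in> H) \<noteq> (x \<in> H)} / emeasure \<nu> (?A x) \<partial>\<nu>)
      \<le> (\<integral>\<^sup>+x. indicator W x + emeasure \<nu> {z. in_window (real n) x z \<and> z \<in> W} / emeasure \<nu> (?A x) \<partial>\<nu>)"
      by (intro nn_integral_mono le)
    also have "\<dots> = emeasure \<nu> W +
        (\<integral>\<^sup>+x. emeasure \<nu> {z. in_window (real n) x z \<and> z \<in> W} / emeasure \<nu> (?A x) \<partial>\<nu>)"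
    proof (subst nn_integral_add)
      have "\<nu> \<in> radon"
        using sets by (simp add: radon_def less_top[symmetric])
      note A_ev = local_emeasure_measurable[OF this]
      have "(\<lambda>x. emeasure \<nu> {z. in_window (real n) x z \<and> z \<in> W} / emeasure \<nu> (?A x)) \<in> borel_measurable borel"
        using A_ev[of "\<lambda>_ _. True" "real n"] A_ev[of "\<lambda>_ z. z \<in> W" "real n"]
        by (intro borel_measurable_divide_ennreal) simp_all
      then show "(\<lambda>x. emeasure \<nu> {z. in_window (real n) x z \<and> z \<in> W} / emeasure \<nu> (?A x)) \<in> borel_measurable \<nu>"
        by (simp add: measurable_cong_sets[OF sets refl])
    qed (use W in \<open>auto intro!: borel_measurable_indicator simp: sets\<close>)
    also have "\<dots> \<le> emeasure \<nu> W + of_nat k * emeasure \<nu> W"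
      by (intro add_left_mono k W)
    also have "\<dots> = (1 + of_nat k) * emeasure \<nu> W"
      by (simp add: distrib_right)
    also have "\<dots> \<le> (1 + of_nat k) * ennreal (2 * \<epsilon>)"
      by (intro mult_left_mono \<nu>W) simp
    also have "\<dots> = ennreal ((1 + real k) * (2 * \<epsilon>))"
      using \<epsilon> by (simp add: ennreal_mult ennreal_of_nat_eq_real_of_nat flip: ennreal_plus ennreal_1)
    also have "(1 + real k) * (2 * \<epsilon>) = s"
      by (simp add: \<epsilon>_def field_simps)
    finally show ?case
      using b(2) s(1) by simp
  qed
qed simp


section \<open>A one-sided ergodic theorem\<close>

text \<open>Garsia's proof of Hopf's maximal inequality, for an additive cocycle \<open>s\<close>
  given directly instead of as sums along orbits. The maximum \<open>M k\<close> of
  \<open>s 0, ..., s k\<close> satisfies \<open>M k x \<le> s 1 x + M k (T x)\<close> where it is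
  positive; on integrating, the two \<open>M k\<close> terms cancel by invariance, and for growing
  \<open>k\<close> the sets \<open>P k\<close> exhaust the space up to a null set by
  \<open>pos\<close>.\<close>

lemma maximal_ergodic_inequality:
  fixes s :: "nat \<Rightarrow> 'a \<Rightarrow> real"
  assumes N: "prob_space N" and T [measurable]: "T \<in> N \<rightarrow>\<^sub>M N" and TN: "distr N N T = N"
    and s0: "\<And>x. s 0 x = 0"
    and s_Suc: "\<And>n x. x \<in> space N \<Longrightarrow> s (Suc n) x = s 1 x + s n (T x)"
    and [measurable]: "\<And>n. s n \<in> borel_measurable N"
    and bound: "\<And>n x. x \<in> space N \<Longrightarrow> \<bar>s n x\<bar> \<le> c * real n"
    and pos: "AE x in N. \<exists>n. 0 < s n x"
  shows "0 \<le> integral\<^sup>L N (s 1)"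
proof -
  interpret prob_space N by fact
  obtain x0 where x0: "x0 \<in> space N"
    using not_empty by auto
  have c: "0 \<le> c"
    using bound[OF x0, of 1] by simp
  define M where "M k x = Max ((\<lambda>n. s n x) ` {..k})" for k x
  have [measurable]: "M k \<in> borel_measurable N" for k
    unfolding M_def by (intro borel_measurable_Max) auto
  have s_le: "s n x \<le> M k x" if "n \<le> k" for n k x
    unfolding M_def using that by (intro Max_ge) auto
  have M_in: "\<exists>n\<le>k. M k x = s n x" for k x
  proof -
    have "M k x \<in> (\<lambda>n. s n x) ` {..k}"
      unfolding M_def by (rule Max_in) auto
    then show ?thesis
      by auto
  qed
  have M_bound: "\<bar>M k x\<bar> \<le> c * real k" if "x \<in> space N" for k x
  proof -
    obtain n where n: "n \<le> k" "M k x = s n x"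
      using M_in by blast
    have "\<bar>s n x\<bar> \<le> c * real n"
      by (rule bound[OF that])
    also have "\<dots> \<le> c * real k"
      using c n by (intro mult_left_mono) auto
    finally show ?thesis
      using n by simp
  qed
  have int_M: "integrable N (M k)" for k
    using M_bound by (intro integrable_const_bound[of _ "c * real k"]) auto
  have int_MT: "integrable N (\<lambda>x. M k (T x))" for k
    using M_bound measurable_space[OF T] by (intro integrable_const_bound[of _ "c * real k"]) auto
  have int_eq: "(\<integral>x. M k (T x) \<partial>N) = integral\<^sup>L N (M k)" for k
    using integral_distr[OF T, of "M k"] by (simp add: TN)
  define P where "P k = {x \<in> space N. 0 < M k x}" for k
  have [measurable]: "P k \<in> sets N" for k
    unfolding P_def by measurable
  \<comment> \<open>Off \<open>P k\<close> the maximum is at most \<open>0\<close> at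
    \<open>x\<close> and at least \<open>0\<close> at \<open>T x\<close>, because
    \<open>s 0 = 0\<close> takes part in it.\<close>
  have le: "M k x - M k (T x) \<le> indicator (P k) x * s 1 x" if x: "x \<in> space N" for k x
  proof (cases "x \<in> P k")
    case True
    obtain n where n: "n \<le> k" "M k x = s n x"
      using M_in by blast
    then obtain m where m: "n = Suc m"
      using True s0 by (cases n) (auto simp: P_def)
    have "M k x = s 1 x + s m (T x)"
      using s_Suc[OF x, of m] n m by simp
    also have "\<dots> \<le> s 1 x + M k (T x)"
      using n m by (intro add_left_mono s_le) simp
    finally show ?thesis
      using True by simp
  next
    case False
    then show ?thesis
      using x s_le[of 0 k "T x"] s0 by (simp add: P_def)
  qed
  have int_P: "integrable N (\<lambda>x. indicator (P k) x * s 1 x)" for k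
    using bound[of _ 1] c by (intro integrable_const_bound[of _ c]) (auto split: split_indicator)
  have nonneg: "0 \<le> (\<integral>x. indicator (P k) x * s 1 x \<partial>N)" for k
  proof -
    have "0 = (\<integral>x. M k x - M k (T x) \<partial>N)"
      using int_M int_MT int_eq by simp
    also have "\<dots> \<le> (\<integral>x. indicator (P k) x * s 1 x \<partial>N)"
      by (intro integral_mono le Bochner_Integration.integrable_diff int_M int_MT int_P)
    finally show ?thesis .
  qed
  have "(\<lambda>k. \<integral>x. indicator (P k) x * s 1 x \<partial>N) \<longlonglongrightarrow> integral\<^sup>L N (s 1)"
  proof (rule integral_dominated_convergence[where w = "\<lambda>_. c"])
    show "AE x in N. (\<lambda>k. indicator (P k) x * s 1 x) \<longlonglongrightarrow> s 1 x"
      using pos AE_space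
    proof eventually_elim
      case (elim x)
      then obtain n where n: "0 < s n x"
        by blast
      have "indicator (P k) x * s 1 x = s 1 x" if "n \<le> k" for k
        using s_le[OF that, of x] n elim by (simp add: P_def)
      then show ?case
        by (intro tendsto_eventually) (auto simp: eventually_sequentially)
    qed
    show "AE x in N. norm (indicator (P k) x * s 1 x) \<le> c" for k
      using bound[of _ 1] c by (intro AE_I2) (auto split: split_indicator)
  qed auto
  then show ?thesis
    by (rule LIMSEQ_le_const) (use nonneg in auto)
qed

section \<open>Sojourn times of sceneries\<close>

lemma dilate_star_0: "\<mu> \<in> Mstar0 \<Longrightarrow> dilate_star 0 \<mu> = (\<mu> :: (real^'n) measure)"
  by (simp add: dilate_star_def dilate_0 radon0_radon Mstar0_radon0 normalized_id Mstar0_def Mstar_radon)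

text \<open>Half-open intervals fit together without overlap, so sojourn times form a cocycle over
  the time-one map.\<close>

definition sojourn :: "(real^'n) measure set \<Rightarrow> (real^'n) measure \<Rightarrow> real \<Rightarrow> real \<Rightarrow> real" where
  "sojourn V \<mu> a b = measure lborel {t \<in> {a..<b}. dilate_square t \<mu> \<in> V}"

text \<open>The slack between \<open>r\<close> and \<open>q\<close> makes this set exactly \<open>S\<^sup>*\<close>-invariant, as \<^const>\<open>S_ergodic\<close> requires.\<close>

definition frequent :: "(real^'n) measure set \<Rightarrow> real \<Rightarrow> (real^'n) measure set" where
  "frequent V q = {\<mu> \<in> Mstar0. \<forall>r::rat. of_rat r < q \<longrightarrow>
     (\<exists>N. \<forall>n\<ge>N. of_rat r * real n \<le> sojourn V \<mu> 0 (real n))}"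

context
  fixes V :: "(real^'n) measure set"
  assumes V: "V \<in> sets (borel_of Msquare)"
begin

lemma sojourn_sets:
  assumes "\<mu> \<in> Mstar0"
  shows "{t. dilate_square t \<mu> \<in> V} \<in> sets borel"
proof -
  have "(\<lambda>t. dilate_square t \<mu>) \<in> borel \<rightarrow>\<^sub>M borel_of Msquare"
    using assms by (intro dilate_square_measurable) (auto simp: Mstar0_def)
  from measurable_sets[OF this V] show ?thesis
    by (simp add: vimage_def)
qed

lemma sojourn_fmeasurable:
  assumes "\<mu> \<in> Mstar0"
  shows "{t \<in> {a..<b}. dilate_square t \<mu> \<in> V} \<in> fmeasurable lborel"
proof (rule fmeasurableI2)
  show "{a..<b} \<in> fmeasurable lborel"
    by (cases "a \<le> b") (auto intro: fmeasurableI)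
  show "{t \<in> {a..<b}. dilate_square t \<mu> \<in> V} \<in> sets lborel"
    using sojourn_sets[OF assms] by (simp add: Collect_conj_eq sets.Int)
qed auto

lemma sojourn_bounds:
  assumes "\<mu> \<in> Mstar0" "a \<le> b"
  shows "0 \<le> sojourn V \<mu> a b" "sojourn V \<mu> a b \<le> b - a"
proof -
  show "0 \<le> sojourn V \<mu> a b"
    by (simp add: sojourn_def)
  have "sojourn V \<mu> a b \<le> measure lborel {a..<b}"
    unfolding sojourn_def
    by (rule measure_mono_fmeasurable)
      (use sojourn_fmeasurable[OF assms(1), of a b] assms(2) in \<open>auto simp: fmeasurable_def\<close>)
  then show "sojourn V \<mu> a b \<le> b - a"
    using assms(2) by simp
qed

lemma sojourn_add:
  assumes "\<mu> \<in> Mstar0" "a \<le> b" "b \<le> c"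
  shows "sojourn V \<mu> a c = sojourn V \<mu> a b + sojourn V \<mu> b c"
proof -
  have "{t \<in> {a..<c}. dilate_square t \<mu> \<in> V} =
      {t \<in> {a..<b}. dilate_square t \<mu> \<in> V} \<union> {t \<in> {b..<c}. dilate_square t \<mu> \<in> V}"
    using assms by auto
  moreover have "measure lborel ({t \<in> {a..<b}. dilate_square t \<mu> \<in> V} \<union> {t \<in> {b..<c}. dilate_square t \<mu> \<in> V}) =
      sojourn V \<mu> a b + sojourn V \<mu> b c"
    unfolding sojourn_def
  proof (rule measure_Union)
    note fm = sojourn_fmeasurable[OF assms(1)]
    show "emeasure lborel {t \<in> {a..<b}. dilate_square t \<mu> \<in> V} \<noteq> \<infinity>"
      "emeasure lborel {t \<in> {b..<c}. dilate_square t \<mu> \<in> V} \<noteq> \<infinity>"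
      "{t \<in> {a..<b}. dilate_square t \<mu> \<in> V} \<in> sets lborel"
      "{t \<in> {b..<c}. dilate_square t \<mu> \<in> V} \<in> sets lborel"
      using fmeasurableD2[OF fm] fmeasurableD[OF fm] by simp_all
  qed auto
  ultimately show ?thesis
    by (simp add: sojourn_def)
qed

lemma sojourn_dilate_star:
  assumes "\<mu> \<in> Mstar0"
  shows "sojourn V (dilate_star s \<mu>) a b = sojourn V \<mu> (a + s) (b + s)"
proof -
  let ?B = "{t \<in> {a + s..<b + s}. dilate_square t \<mu> \<in> V}"
  have B: "?B \<in> sets borel"
    using sojourn_sets[OF assms] by (simp add: Collect_conj_eq sets.Int)
  have "measure lborel ?B = measure (distr lborel borel ((+) s)) ?B"
    by (simp add: lborel_distr_plus)
  also have "\<dots> = measure lborel ((+) s -` ?B)"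
    using B by (subst measure_distr) auto
  also have "(+) s -` ?B = {t \<in> {a..<b}. dilate_square t (dilate_star s \<mu>) \<in> V}"
    by (auto simp: dilate_square_dilate_star[OF assms] add.commute)
  finally show ?thesis
    by (simp add: sojourn_def)
qed

text \<open>The part of \<open>{0..<n}\<close> outside its shift by \<open>s\<close> lies in one
  interval of length \<open>\<bar>s\<bar>\<close>.\<close>

lemma sojourn_shift_ge:
  assumes "\<mu> \<in> Mstar0" "0 \<le> n"
  shows "sojourn V \<mu> 0 n - \<bar>s\<bar> \<le> sojourn V \<mu> s (n + s)"
proof -
  obtain a b where ab: "a \<le> b" "b - a = \<bar>s\<bar>" "{0..<n} \<subseteq> {s..<n + s} \<union> {a..<b}"
  proof (cases "0 \<le> s")
    case True
    then show thesis
      by (intro that[of 0 s]) auto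
  next
    case False
    then show thesis
      by (intro that[of "n + s" n]) auto
  qed
  have "sojourn V \<mu> 0 n \<le> measure lborel ({t \<in> {s..<n + s}. dilate_square t \<mu> \<in> V} \<union> {a..<b})"
    unfolding sojourn_def
  proof (rule measure_mono_fmeasurable)
    show "{t \<in> {0..<n}. dilate_square t \<mu> \<in> V} \<in> sets lborel"
      using sojourn_fmeasurable[OF assms(1)] by (auto simp: fmeasurable_def)
    show "{t \<in> {s..<n + s}. dilate_square t \<mu> \<in> V} \<union> {a..<b} \<in> fmeasurable lborel"
      using ab(1) by (intro fmeasurable.Un[OF sojourn_fmeasurable[OF assms(1)]] fmeasurableI) auto
  qed (use ab in auto)
  also have "\<dots> \<le> sojourn V \<mu> s (n + s) + measure lborel {a..<b}"
    unfolding sojourn_def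
    by (intro measure_Un_le fmeasurableD[OF sojourn_fmeasurable[OF assms(1)]]) auto
  also have "measure lborel {a..<b} = \<bar>s\<bar>"
    using ab by simp
  finally show ?thesis
    by simp
qed

lemma sojourn_measurable:
  assumes "sets R = sets Mstar_borel"
  shows "(\<lambda>\<mu>. emeasure lborel {t \<in> {a..<b}. dilate_square t \<mu> \<in> V}) \<in> borel_measurable (restrict_space R Mstar0)"
    and "(\<lambda>\<mu>. sojourn V \<mu> a b) \<in> borel_measurable (restrict_space R Mstar0)"
    and "{p \<in> space (restrict_space R Mstar0 \<Otimes>\<^sub>M lborel). snd p \<in> {a..<b} \<and> dilate_square (snd p) (fst p) \<in> V}
      \<in> sets (restrict_space R Mstar0 \<Otimes>\<^sub>M lborel)"
proof -
  let ?N = "restrict_space R Mstar0"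
  have sp: "space ?N = Mstar0"
    using sets_eq_imp_space_eq[OF assms] by (auto simp: space_restrict_space Mstar0_def)
  have id: "(\<lambda>\<mu>. \<mu>) \<in> ?N \<rightarrow>\<^sub>M Mstar_borel"
    by (intro measurable_restrict_space1) (simp add: measurable_ident_sets[OF assms])
  have fst: "(\<lambda>p. fst p) \<in> ?N \<Otimes>\<^sub>M lborel \<rightarrow>\<^sub>M Mstar_borel"
    by (rule measurable_compose[OF measurable_fst id])
  have "(\<lambda>p. dilate_square (snd p) (fst p)) \<in> ?N \<Otimes>\<^sub>M lborel \<rightarrow>\<^sub>M borel_of Msquare"
    by (rule dilate_square_measurable[OF _ fst]) (auto simp: space_pair_measure sp)
  then have [measurable]: "Measurable.pred (?N \<Otimes>\<^sub>M lborel) (\<lambda>p. dilate_square (snd p) (fst p) \<in> V)"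
    by (rule pred_sets2[OF V])
  show sets: "{p \<in> space (?N \<Otimes>\<^sub>M lborel). snd p \<in> {a..<b} \<and> dilate_square (snd p) (fst p) \<in> V}
      \<in> sets (?N \<Otimes>\<^sub>M lborel)"
    by measurable
  show *: "(\<lambda>\<mu>. emeasure lborel {t \<in> {a..<b}. dilate_square t \<mu> \<in> V}) \<in> borel_measurable ?N"
    by (rule lborel.measurable_emeasure) (use sets in simp_all)
  show "(\<lambda>\<mu>. sojourn V \<mu> a b) \<in> borel_measurable ?N"
    unfolding sojourn_def measure_def by (intro measurable_compose[OF *]) simp
qed

text \<open>All quantifiers in \<open>frequent\<close> run over rationals and naturals, so countable
  set operations suffice.\<close>

lemma frequent_sets: "frequent V q \<in> sets Mstar_borel"
proof -
  let ?N = "restrict_space Mstar_borel Mstar0 :: (real^'n) measure measure"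
  note [measurable] = sojourn_measurable(2)[OF refl]
  have sp: "space ?N = Mstar0"
    by (auto simp: space_restrict_space Mstar0_def)
  have "{\<mu> \<in> space ?N. \<forall>r::rat. of_rat r < q \<longrightarrow> (\<exists>N. \<forall>n\<ge>N. of_rat r * real n \<le> sojourn V \<mu> 0 (real n))} \<in> sets ?N"
    by measurable
  then have "frequent V q \<in> sets ?N"
    unfolding frequent_def sp .
  then show ?thesis
    using Mstar0_sets sp by (subst (asm) sets_restrict_space_iff) (auto simp: space_restrict_space Int_commute)
qed

text \<open>A dilation shifts the time interval, at a cost of at most \<open>\<bar>s\<bar>\<close>.
  Starting from a rate \<open>r'\<close> strictly between \<open>r\<close> and \<open>q\<close>,
  this loss is absorbed as soon as \<open>n \<ge> \<bar>s\<bar> / (r' - r)\<close>.\<close>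

lemma frequent_dilate_star:
  assumes \<mu>: "\<mu> \<in> frequent V q"
  shows "dilate_star s \<mu> \<in> frequent V q"
proof -
  have \<mu>0: "\<mu> \<in> Mstar0"
    using \<mu> by (simp add: frequent_def)
  have "\<exists>N. \<forall>n\<ge>N. of_rat r * real n \<le> sojourn V (dilate_star s \<mu>) 0 (real n)" if r: "real_of_rat r < q" for r
  proof -
    obtain r' :: rat where r': "real_of_rat r < of_rat r'" "of_rat r' < q"
      using of_rat_dense[OF r] by auto
    obtain N where N: "\<And>n. n \<ge> N \<Longrightarrow> of_rat r' * real n \<le> sojourn V \<mu> 0 (real n)"
      using \<mu> r'(2) unfolding frequent_def by blast
    obtain m :: nat where m: "\<bar>s\<bar> / (of_rat r' - of_rat r) \<le> real m"
      using real_arch_simple by blast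
    have "of_rat r * real n \<le> sojourn V (dilate_star s \<mu>) 0 (real n)" if n: "n \<ge> max N m" for n
    proof -
      have "\<bar>s\<bar> / (of_rat r' - of_rat r) \<le> real n"
        using m n by linarith
      then have "\<bar>s\<bar> \<le> (of_rat r' - of_rat r) * real n"
        using r'(1) by (simp add: field_simps)
      then have "of_rat r * real n \<le> of_rat r' * real n - \<bar>s\<bar>"
        by (simp add: algebra_simps)
      also have "\<dots> \<le> sojourn V \<mu> 0 (real n) - \<bar>s\<bar>"
        using N[of n] n by simp
      also have "\<dots> \<le> sojourn V \<mu> s (real n + s)"
        by (rule sojourn_shift_ge[OF \<mu>0]) simp
      finally show ?thesis
        by (simp add: sojourn_dilate_star[OF \<mu>0])
    qed
    then show ?thesis
      by blast
  qed
  then show ?thesis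
    using dilate_star_Mstar0[OF \<mu>0] by (auto simp: frequent_def)
qed

lemma frequent_invariant: "S_invariant_set (frequent V q)"
proof -
  have "\<mu> \<in> frequent V q" if "\<mu> \<in> Mstar0" "dilate_star t \<mu> \<in> frequent V q" for \<mu> t
    using frequent_dilate_star[OF that(2), of "- t"] that(1)
    by (simp add: dilate_star_dilate_star dilate_star_0)
  moreover have "frequent V q \<subseteq> Mstar0"
    by (auto simp: frequent_def)
  ultimately show ?thesis
    unfolding S_invariant_set_def using frequent_dilate_star by blast
qed

end

text \<open>If \<open>frequent V q\<close> fails to have full measure, ergodicity makes it null, so
  almost surely \<open>q * n - sojourn V \<mu> 0 n\<close> is positive for some \<open>n\<close>.
  The maximal inequality then says that \<open>q\<close> is at least the mean sojourn in unit time.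
  By invariance this mean is the probability that \<open>square \<mu> \<in> V\<close>, a
  contradiction.\<close>

lemma ergodic_frequent:
  fixes V :: "(real^'n) measure set"
  assumes V: "V \<in> sets (borel_of Msquare)"
    and R: "prob_space R" "sets R = sets Mstar_borel" "S_ergodic R"
    and q: "q < measure R {\<mu> \<in> space R. square \<mu> \<in> V}"
  shows "AE \<mu> in R. \<mu> \<in> frequent V q"
proof (rule ccontr)
  assume neg: "\<not> (AE \<mu> in R. \<mu> \<in> frequent V q)"
  interpret R: prob_space R by fact
  have F: "frequent V q \<in> sets R"
    using frequent_sets[OF V] R(2) by simp
  have "emeasure R (frequent V q) = 0 \<or> emeasure R (frequent V q) = 1"
    using R(3) F frequent_invariant[OF V, of q] by (simp add: S_ergodic_def S_invariant_set_def)
  moreover have "emeasure R (frequent V q) \<noteq> 1"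
  proof
    assume "emeasure R (frequent V q) = 1"
    then have "R.prob (frequent V q) = 1"
      by (simp add: R.emeasure_eq_measure)
    then show False
      using neg R.AE_in_set_eq_1[OF F] by simp
  qed
  ultimately have AE_not: "AE \<mu> in R. \<mu> \<notin> frequent V q"
    using F by (auto intro!: AE_not_in)
  let ?N = "restrict_space R Mstar0"
  have "S_invariant R"
    using R(3) by (simp add: S_ergodic_def)
  note inv_facts = S_invariant_restrict_space[OF R(2) this]
  note M0 = inv_facts(1) and spR = inv_facts(2) and spN = inv_facts(3) and AE0 = inv_facts(4)
    and dil = inv_facts(6) and inv = inv_facts(7)
  have N: "prob_space ?N"
    using AE0 M0 by (intro prob_spaceI) (simp add: spN emeasure_restrict_space R.emeasure_eq_1_AE)
  interpret N: prob_space ?N by (rule N)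
  have T: "dilate_star 1 \<in> ?N \<rightarrow>\<^sub>M ?N"
    using dil[of 1] dilate_star_Mstar0 by (intro measurable_restrict_space2) (auto simp: spN)
  have TN: "distr ?N ?N (dilate_star 1) = ?N"
  proof (rule measure_eqI)
    fix A assume "A \<in> sets (distr ?N ?N (dilate_star 1))"
    then have A: "A \<in> sets ?N"
      by simp
    then have A': "A \<in> sets R" "A \<subseteq> Mstar0"
      using M0 by (auto simp: sets_restrict_space_iff)
    have "emeasure (distr ?N ?N (dilate_star 1)) A = emeasure ?N (dilate_star 1 -` A \<inter> space ?N)"
      by (rule emeasure_distr[OF T A])
    also have "\<dots> = emeasure (distr ?N R (dilate_star 1)) A"
      by (rule emeasure_distr[OF dil A'(1), symmetric])
    also have "\<dots> = emeasure ?N A"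
      using A' M0 by (simp add: inv emeasure_restrict_space)
    finally show "emeasure (distr ?N ?N (dilate_star 1)) A = emeasure ?N A" .
  qed simp
  have AE_N: "AE \<mu> in ?N. \<mu> \<notin> frequent V q"
    using AE_not M0 by (subst AE_restrict_space_iff) (auto elim: eventually_mono)
  define s where "s n \<mu> = q * real n - sojourn V \<mu> 0 (real n)" for n :: nat and \<mu>
  have "0 \<le> integral\<^sup>L ?N (s 1)"
  proof (rule maximal_ergodic_inequality[OF N T TN])
    show "s 0 x = 0" for x
      by (simp add: s_def sojourn_def)
    show "s (Suc n) \<mu> = s 1 \<mu> + s n (dilate_star 1 \<mu>)" if "\<mu> \<in> space ?N" for n \<mu>
      using that sojourn_add[OF V, of \<mu> 0 1 "real n + 1"] sojourn_dilate_star[OF V, of \<mu> 1 0 "real n"]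
      by (simp add: s_def spN algebra_simps)
    show "s n \<in> borel_measurable ?N" for n
      using sojourn_measurable(2)[OF V R(2), of 0 "real n"] unfolding s_def by measurable
    show "\<bar>s n \<mu>\<bar> \<le> (\<bar>q\<bar> + 1) * real n" if "\<mu> \<in> space ?N" for n \<mu>
    proof -
      have "\<bar>s n \<mu>\<bar> \<le> \<bar>q * real n\<bar> + \<bar>sojourn V \<mu> 0 (real n)\<bar>"
        unfolding s_def by (rule abs_triangle_ineq4)
      also have "\<dots> \<le> \<bar>q\<bar> * real n + real n"
        using sojourn_bounds[OF V, of \<mu> 0 "real n"] that by (simp add: spN abs_mult)
      finally show ?thesis
        by (simp add: algebra_simps)
    qed
    show "AE \<mu> in ?N. \<exists>n. 0 < s n \<mu>"
      using AE_N AE_space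
    proof eventually_elim
      case (elim \<mu>)
      then obtain r where r: "real_of_rat r < q"
        and "\<And>N. \<exists>n\<ge>N. \<not> of_rat r * real n \<le> sojourn V \<mu> 0 (real n)"
        unfolding frequent_def spN by auto
      \<comment> \<open>\<open>n = 0\<close> must be avoided: \<open>r < q\<close> stays strict only
        after multiplication by a positive \<open>n\<close>.\<close>
      then obtain n where n: "n \<ge> Suc 0" "sojourn V \<mu> 0 (real n) < of_rat r * real n"
        by (meson not_le)
      have "of_rat r * real n < q * real n"
        using r n(1) by simp
      then have "0 < s n \<mu>"
        unfolding s_def using n(2) by linarith
      then show ?case ..
    qed
  qed
  moreover have int_soj: "integrable ?N (\<lambda>\<mu>. sojourn V \<mu> 0 1)"
    using sojourn_bounds[OF V, of _ 0 1] sojourn_measurable(2)[OF V R(2), of 0 1]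
    by (intro N.integrable_const_bound[of _ 1]) (auto simp: spN)
  moreover have "integral\<^sup>L ?N (s 1) = q - (\<integral>\<mu>. sojourn V \<mu> 0 1 \<partial>?N)"
    using int_soj by (simp add: s_def[abs_def] N.prob_space)
  \<comment> \<open>After exchanging the integrals, every time slice
    \<open>{\<mu>. dilate_square t \<mu> \<in> V}\<close> has the same measure \<open>?p\<close> by
    invariance, and the times fill an interval of length \<open>1\<close>.\<close>
  moreover have "(\<integral>\<mu>. sojourn V \<mu> 0 1 \<partial>?N) = measure R {\<mu> \<in> space R. square \<mu> \<in> V}"
  proof -
    let ?p = "emeasure R {\<mu> \<in> space R. square \<mu> \<in> V}"
    have "square \<in> R \<rightarrow>\<^sub>M borel_of Msquare"
      using square_measurable by (simp add: measurable_cong_sets[OF R(2) refl])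
    from measurable_sets[OF this V]
    have B: "{\<mu> \<in> space R. square \<mu> \<in> V} \<in> sets R"
      by (simp add: vimage_def Int_def conj_commute)
    interpret P: pair_sigma_finite ?N lborel ..
    let ?I = "\<lambda>\<mu> t. indicator {p \<in> space (?N \<Otimes>\<^sub>M lborel). snd p \<in> {0..<1} \<and> dilate_square (snd p) (fst p) \<in> V} (\<mu>, t) :: ennreal"
    have I: "?I \<mu> t = indicator {0..<1} t * indicator {\<mu> \<in> Mstar0. dilate_square t \<mu> \<in> V} \<mu>"
      if "\<mu> \<in> Mstar0" for \<mu> t
      using that by (auto simp: space_pair_measure spN split: split_indicator)
    have slice: "{\<mu> \<in> Mstar0. dilate_square t \<mu> \<in> V} \<in> sets ?N" "emeasure ?N {\<mu> \<in> Mstar0. dilate_square t \<mu> \<in> V} = ?p" for t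
    proof -
      have eq: "dilate_star t -` {\<mu> \<in> space R. square \<mu> \<in> V} \<inter> space ?N = {\<mu> \<in> Mstar0. dilate_square t \<mu> \<in> V}"
        using dilate_star_Mstar0 by (auto simp: spN spR square_dilate_star Mstar0_def[symmetric])
          (auto simp: Mstar0_def)
      show "{\<mu> \<in> Mstar0. dilate_square t \<mu> \<in> V} \<in> sets ?N"
        using measurable_sets[OF dil B, of t] unfolding eq .
      show "emeasure ?N {\<mu> \<in> Mstar0. dilate_square t \<mu> \<in> V} = ?p"
        using emeasure_distr[OF dil B, of t] unfolding eq inv by simp
    qed
    have "ennreal (\<integral>\<mu>. sojourn V \<mu> 0 1 \<partial>?N) = (\<integral>\<^sup>+\<mu>. ennreal (sojourn V \<mu> 0 1) \<partial>?N)"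
      by (rule nn_integral_eq_integral[OF int_soj, symmetric]) (simp add: sojourn_def)
    also have "\<dots> = (\<integral>\<^sup>+\<mu>. (\<integral>\<^sup>+t. ?I \<mu> t \<partial>lborel) \<partial>?N)"
    proof (rule nn_integral_cong)
      fix \<mu> assume "\<mu> \<in> space ?N"
      then have \<mu>: "\<mu> \<in> Mstar0"
        by (simp add: spN)
      have "ennreal (sojourn V \<mu> 0 1) = emeasure lborel {t \<in> {0..<1}. dilate_square t \<mu> \<in> V}"
        unfolding sojourn_def
        using fmeasurableD2[OF sojourn_fmeasurable[OF V \<mu>, of 0 1]] by (simp add: emeasure_eq_ennreal_measure)
      also have "\<dots> = (\<integral>\<^sup>+t. indicator {t \<in> {0..<1}. dilate_square t \<mu> \<in> V} t \<partial>lborel)"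
        using fmeasurableD[OF sojourn_fmeasurable[OF V \<mu>, of 0 1]] by simp
      also have "\<dots> = (\<integral>\<^sup>+t. ?I \<mu> t \<partial>lborel)"
        by (intro nn_integral_cong) (simp only: I[OF \<mu>], simp add: \<mu> indicator_def)
      finally show "ennreal (sojourn V \<mu> 0 1) = (\<integral>\<^sup>+t. ?I \<mu> t \<partial>lborel)" .
    qed
    also have "\<dots> = (\<integral>\<^sup>+t. (\<integral>\<^sup>+\<mu>. ?I \<mu> t \<partial>?N) \<partial>lborel)"
      by (rule P.Fubini'[symmetric])
        (use sojourn_measurable(3)[OF V R(2), of 0 1] in \<open>simp add: borel_measurable_indicator\<close>)
    also have "\<dots> = (\<integral>\<^sup>+t. indicator {0..<1::real} t * ?p \<partial>lborel)"
    proof (rule nn_integral_cong)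
      fix t
      have "(\<integral>\<^sup>+\<mu>. ?I \<mu> t \<partial>?N) = (\<integral>\<^sup>+\<mu>. indicator {0..<1} t * indicator {\<mu> \<in> Mstar0. dilate_square t \<mu> \<in> V} \<mu> \<partial>?N)"
        by (intro nn_integral_cong I) (simp add: spN)
      also have "\<dots> = indicator {0..<1} t * ?p"
        using slice[of t] by (simp add: nn_integral_cmult)
      finally show "(\<integral>\<^sup>+\<mu>. ?I \<mu> t \<partial>?N) = indicator {0..<1} t * ?p" .
    qed
    also have "\<dots> = ?p"
      by (simp add: nn_integral_multc)
    finally have "ennreal (\<integral>\<mu>. sojourn V \<mu> 0 1 \<partial>?N) = ennreal (measure R {\<mu> \<in> space R. square \<mu> \<in> V})"
      by (simp add: R.emeasure_eq_measure)
    moreover have "0 \<le> (\<integral>\<mu>. sojourn V \<mu> 0 1 \<partial>?N)"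
      by (simp add: sojourn_def)
    ultimately show ?thesis
      by (subst (asm) ennreal_inj) auto
  qed
  ultimately show False
    using q by simp
qed


section \<open>Translation invariance of invariant sets\<close>

text \<open>\<open>measure_of\<close> returns the given set function once it is known to be
  countably additive; this follows by exchanging sum and integral.\<close>

lemma emeasure_mixture:
  assumes sets: "\<And>x. x \<in> space M \<Longrightarrow> sets (K x) = sets N"
    and meas: "\<And>A. A \<in> sets N \<Longrightarrow> (\<lambda>x. emeasure (K x) A) \<in> borel_measurable M"
    and A: "A \<in> sets N"
  shows "emeasure (mixture N M K) A = (\<integral>\<^sup>+x. emeasure (K x) A \<partial>M)"
  unfolding mixture_def
proof (rule emeasure_measure_of_sigma[OF _ _ _ A])
  show "sigma_algebra (space N) (sets N)" ..
  show "positive (sets N) (\<lambda>A. \<integral>\<^sup>+x. emeasure (K x) A \<partial>M)"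
    by (simp add: positive_def)
  show "countably_additive (sets N) (\<lambda>A. \<integral>\<^sup>+x. emeasure (K x) A \<partial>M)"
  proof (rule countably_additiveI)
    fix B :: "nat \<Rightarrow> 'b set"
    assume B: "range B \<subseteq> sets N" "disjoint_family B" "(\<Union>i. B i) \<in> sets N"
    have "(\<Sum>i. \<integral>\<^sup>+x. emeasure (K x) (B i) \<partial>M) = (\<integral>\<^sup>+x. (\<Sum>i. emeasure (K x) (B i)) \<partial>M)"
      using B meas by (intro nn_integral_suminf[symmetric]) auto
    also have "\<dots> = (\<integral>\<^sup>+x. emeasure (K x) (\<Union>i. B i) \<partial>M)"
      using B sets by (intro nn_integral_cong suminf_emeasure) auto
    finally show "(\<Sum>i. \<integral>\<^sup>+x. emeasure (K x) (B i) \<partial>M) = (\<integral>\<^sup>+x. emeasure (K x) (\<Union>i. B i) \<partial>M)" .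
  qed
qed

lemma sets_mixture [simp]: "sets (mixture N M K) = sets N"
  by (simp add: mixture_def)

lemma space_mixture [simp]: "space (mixture N M K) = space N"
  by (simp add: mixture_def)

lemma emeasure_palm_average:
  assumes U: "U \<in> sets borel" and \<mu>: "\<mu> \<in> Mstar" and D: "D \<in> sets Mstar_borel"
  shows "emeasure (palm_average U \<mu>) D = emeasure \<mu> {x \<in> U. translate_star x \<mu> \<in> D}"
proof -
  have sets: "sets \<mu> = sets borel"
    using \<mu> by (simp add: Mstar_def radon_def)
  have U': "U \<in> sets \<mu>"
    using U sets by simp
  have sp: "space (restrict_space \<mu> U) = U"
    by (rule space_restrict_space2[OF U'])
  have sec: "{x \<in> U. translate_star x \<mu> \<in> A} \<in> sets (restrict_space \<mu> U)" if "A \<in> sets Mstar_borel" for A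
  proof -
    have "U \<inter> {x. translate_star x \<mu> \<in> A} \<in> sets \<mu>"
      using translate_star_section[OF that \<mu>] U' sets by auto
    then show ?thesis
      using U' by (auto simp: sets_restrict_space_iff Int_def)
  qed
  have "emeasure (palm_average U \<mu>) D =
      (\<integral>\<^sup>+x. emeasure (return Mstar_borel (translate_star x \<mu>)) D \<partial>restrict_space \<mu> U)"
    unfolding palm_average_def
  proof (rule emeasure_mixture[OF _ _ D])
    fix A assume A: "A \<in> sets (Mstar_borel :: (real^'a) measure measure)"
    show "(\<lambda>x. emeasure (return Mstar_borel (translate_star x \<mu>)) A) \<in> borel_measurable (restrict_space \<mu> U)"
      by (rule measurable_congI[OF borel_measurable_indicator[OF sec[OF A]]]) (simp add: sp A indicator_def)
  qed simp
  also have "\<dots> = (\<integral>\<^sup>+x. indicator {x \<in> U. translate_star x \<mu> \<in> D} x \<partial>restrict_space \<mu> U)"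
    by (intro nn_integral_cong) (simp add: sp D indicator_def)
  also have "\<dots> = emeasure (restrict_space \<mu> U) {x \<in> U. translate_star x \<mu> \<in> D}"
    using sec[OF D] by simp
  also have "\<dots> = emeasure \<mu> {x \<in> U. translate_star x \<mu> \<in> D}"
    using U' by (intro emeasure_restrict_space) auto
  finally show ?thesis .
qed

lemma palm_average_measurable:
  assumes U: "U \<in> sets borel" and P: "sets P = sets Mstar_borel" and D: "D \<in> sets Mstar_borel"
  shows "(\<lambda>\<mu>. emeasure \<mu> {x \<in> U. translate_star x \<mu> \<in> D}) \<in> borel_measurable P"
proof (rule emeasure_Mstar_measurable)
  have [measurable]: "Measurable.pred (P \<Otimes>\<^sub>M borel) (\<lambda>p. translate_star (snd p) (fst p) \<in> D)"
    unfolding pred_def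
    by (rule translate_star_sets[OF _ _ D]) (auto simp: measurable_cong_sets[OF refl P[symmetric]])
  note [measurable] = U
  show "{p \<in> space (P \<Otimes>\<^sub>M borel). snd p \<in> {x \<in> U. translate_star x (fst p) \<in> D}} \<in> sets (P \<Otimes>\<^sub>M borel)"
    unfolding mem_Collect_eq by measurable
qed (simp add: measurable_ident_sets[OF P])

lemma emeasure_palm_mixture:
  fixes P :: "(real^'n) measure measure"
  assumes U: "U \<in> sets borel" and P: "sets P = sets Mstar_borel" and D: "D \<in> sets Mstar_borel"
  shows "emeasure (mixture Mstar_borel P (palm_average U)) D =
    (\<integral>\<^sup>+\<mu>. emeasure \<mu> {x \<in> U. translate_star x \<mu> \<in> D} \<partial>P)"
proof -
  have sp: "space P = Mstar"
    using sets_eq_imp_space_eq[OF P] by simp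
  have "emeasure (mixture Mstar_borel P (palm_average U)) D = (\<integral>\<^sup>+\<mu>. emeasure (palm_average U \<mu>) D \<partial>P)"
  proof (rule emeasure_mixture[OF _ _ D])
    show "sets (palm_average U \<mu>) = sets Mstar_borel" for \<mu> :: "(real^'n) measure"
      by (simp add: palm_average_def)
    show "(\<lambda>\<mu>. emeasure (palm_average U \<mu>) A) \<in> borel_measurable P" if "A \<in> sets Mstar_borel" for A
      by (rule measurable_congI[OF palm_average_measurable[OF U P that]])
        (simp add: sp emeasure_palm_average[OF U _ that])
  qed
  also have "\<dots> = (\<integral>\<^sup>+\<mu>. emeasure \<mu> {x \<in> U. translate_star x \<mu> \<in> D} \<partial>P)"
    by (intro nn_integral_cong) (simp add: sp emeasure_palm_average[OF U _ D])
  finally show ?thesis .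
qed

text \<open>At times \<open>n \<ge> 0\<close> a window is no larger than \<open>B1\<close>, so
  windows around points of \<open>B1\<close> stay in the doubled cube.\<close>

lemma dilated_B1_subset:
  assumes "x \<in> B1" "in_window (real n) x z"
  shows "z \<in> cbox (- 2) (2 :: real^'n)"
proof -
  have "\<bar>z $ i\<bar> \<le> 2" for i
  proof -
    have 1: "\<bar>x $ i\<bar> \<le> 1" "\<bar>exp (real n) * (z - x) $ i\<bar> \<le> 1"
      using assms by (auto simp: B1_def mem_box_cart abs_le_iff minus_le_iff)
    have "\<bar>(z - x) $ i\<bar> \<le> exp (real n) * \<bar>(z - x) $ i\<bar>"
      using mult_right_mono[of 1 "exp (real n)" "\<bar>(z - x) $ i\<bar>"] by simp
    then have "\<bar>(z - x) $ i\<bar> \<le> 1"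
      using 1(2) by (simp add: abs_mult)
    then show ?thesis
      using 1(1) by simp
  qed
  then show ?thesis
    by (auto simp: mem_box_cart abs_le_iff minus_le_iff)
qed

text \<open>These are the inner integrals of the quasi-Palm average. By
  \<open>disagree_dilate_translate\<close> the condition on \<open>x\<close> says that the window
  fraction of \<open>density_in_mean\<close> exceeds \<open>\<epsilon>\<close>, and Markov's
  inequality bounds the mass of such \<open>x\<close>.\<close>

lemma palm_disagree_tendsto:
  fixes \<mu> :: "(real^'n) measure"
  assumes E: "S_invariant_set E" "E \<in> sets Mstar_borel" and \<mu>: "\<mu> \<in> Mstar" and \<epsilon>: "0 < \<epsilon>" "\<epsilon> < \<top>"
  shows "(\<lambda>n. emeasure \<mu> {x \<in> box (- 1) 1. translate_star x \<mu> \<in>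
      {\<nu> \<in> Mstar0. \<epsilon> < disagree E (dilate_star (real n) \<nu>)}}) \<longlonglongrightarrow> 0"
proof -
  have rad: "\<mu> \<in> radon" and sets: "sets \<mu> = sets borel"
    using \<mu> by (auto simp: Mstar_def radon_def)
  define H where "H = {z. translate_star z \<mu> \<in> E}"
  have H: "H \<in> sets borel"
    unfolding H_def by (rule translate_star_section[OF E(2) \<mu>])
  \<comment> \<open>\<open>density_in_mean\<close> wants a finite measure; cutting off outside the
    doubled cube changes no window of a point of \<open>B1\<close>.\<close>
  define \<nu> where "\<nu> = density \<mu> (indicator (cbox (- 2) 2))"
  have em: "emeasure \<nu> A = emeasure \<mu> (cbox (- 2) 2 \<inter> A)" if "A \<in> sets borel" for A
    unfolding \<nu>_def using that by (intro emeasure_restricted) (auto simp: sets)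
  have \<nu>sets: "sets \<nu> = sets borel"
    by (simp add: \<nu>_def sets)
  have \<nu>fin: "finite_measure \<nu>"
  proof
    have "emeasure \<nu> (space \<nu>) = emeasure \<mu> (cbox (- 2) 2)"
      using em[of UNIV] sets_eq_imp_space_eq[OF \<nu>sets] by simp
    also have "\<dots> \<noteq> \<infinity>"
      using emeasure_radon_bounded[OF rad, of "cbox (- 2) 2"] by simp
    finally show "emeasure \<nu> (space \<nu>) \<noteq> \<infinity>" .
  qed
  define f where "f n x = emeasure \<nu> {z. in_window (real n) x z \<and> (z \<in> H) \<noteq> (x \<in> H)} /
    emeasure \<nu> {z. in_window (real n) x z}" for n x
  have lim: "(\<lambda>n. \<integral>\<^sup>+x. f n x \<partial>\<nu>) \<longlonglongrightarrow> 0"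
    unfolding f_def by (rule density_in_mean[OF \<nu>fin \<nu>sets H])
  have bound: "emeasure \<mu> {x \<in> box (- 1) 1. translate_star x \<mu> \<in>
      {\<nu> \<in> Mstar0. \<epsilon> < disagree E (dilate_star (real n) \<nu>)}} \<le> inverse \<epsilon> * (\<integral>\<^sup>+x. f n x \<partial>\<nu>)" for n
  proof -
    let ?X = "{x \<in> box (- 1) 1. translate_star x \<mu> \<in> {\<nu> \<in> Mstar0. \<epsilon> < disagree E (dilate_star (real n) \<nu>)}}"
    have X: "x \<in> cbox (- 2) 2" "\<epsilon> \<le> f n x" if x: "x \<in> ?X" for x
    proof -
      have xB: "x \<in> B1"
        using x box_subset_cbox by (auto simp: B1_def)
      then show "x \<in> cbox (- 2) 2"
        using dilated_B1_subset[of x n x] by (simp add: B1_def mem_box_cart)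
      have xs: "x \<in> supp \<mu>"
        using x by (simp add: translate_star_Mstar0_iff[OF rad])
      have [measurable]: "Measurable.pred borel (\<lambda>z. z \<in> H)"
        using H by simp
      have "emeasure \<nu> {z. in_window (real n) x z \<and> (z \<in> H) \<noteq> (x \<in> H)} =
          emeasure \<mu> {z. in_window (real n) x z \<and> (z \<in> H) \<noteq> (x \<in> H)}"
        using dilated_B1_subset[OF xB, of n] by (subst em) (auto intro!: arg_cong[where f = "emeasure \<mu>"])
      moreover have "emeasure \<nu> {z. in_window (real n) x z} = emeasure \<mu> {z. in_window (real n) x z}"
        using dilated_B1_subset[OF xB, of n] by (subst em) (auto intro!: arg_cong[where f = "emeasure \<mu>"])
      ultimately have "f n x = disagree E (dilate_star (real n) (translate_star x \<mu>))"
        by (simp add: f_def disagree_dilate_translate[OF E \<mu> xs] H_def)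
      then show "\<epsilon> \<le> f n x"
        using x by (simp add: less_imp_le)
    qed
    have [measurable]: "Measurable.pred borel (\<lambda>z. z \<in> H)"
      using H by simp
    have \<nu>rad: "\<nu> \<in> radon"
      using \<nu>sets finite_measure.emeasure_finite[OF \<nu>fin] by (simp add: radon_def less_top[symmetric])
    have f [measurable]: "f n \<in> borel_measurable borel"
      unfolding f_def
      using local_emeasure_measurable[OF \<nu>rad, of "\<lambda>_ _. True" "real n"]
      by (intro borel_measurable_divide_ennreal local_emeasure_measurable[OF \<nu>rad]) simp_all
    have f_sets: "{x. \<epsilon> \<le> f n x} \<in> sets borel"
      by measurable
    have "emeasure \<mu> ?X \<le> emeasure \<mu> (cbox (- 2) 2 \<inter> {x. \<epsilon> \<le> f n x})"
      using X f_sets by (intro emeasure_mono) (auto simp: sets)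
    also have "\<dots> = emeasure \<nu> {x. \<epsilon> \<le> f n x}"
      by (rule em[OF f_sets, symmetric])
    also have "\<dots> \<le> emeasure \<nu> {x \<in> space \<nu>. 1 \<le> inverse \<epsilon> * f n x}"
    proof (rule emeasure_mono)
      have "1 \<le> inverse \<epsilon> * f n x" if "\<epsilon> \<le> f n x" for x
      proof -
        have "1 = inverse \<epsilon> * \<epsilon>"
          using \<epsilon> ennreal_divide_self[of \<epsilon>] by (simp add: divide_ennreal_def mult.commute)
        also have "\<dots> \<le> inverse \<epsilon> * f n x"
          by (intro mult_left_mono that) simp
        finally show ?thesis .
      qed
      then show "{x. \<epsilon> \<le> f n x} \<subseteq> {x \<in> space \<nu>. 1 \<le> inverse \<epsilon> * f n x}"
        using sets_eq_imp_space_eq[OF \<nu>sets] by auto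
      have "{x. 1 \<le> inverse \<epsilon> * f n x} \<in> sets borel"
        by measurable
      then show "{x \<in> space \<nu>. 1 \<le> inverse \<epsilon> * f n x} \<in> sets \<nu>"
        using sets_eq_imp_space_eq[OF \<nu>sets] by (simp add: \<nu>sets)
    qed
    also have "\<dots> \<le> inverse \<epsilon> * (\<integral>\<^sup>+x. f n x * indicator (space \<nu>) x \<partial>\<nu>)"
      by (rule nn_integral_Markov_inequality) (simp_all add: measurable_cong_sets[OF \<nu>sets refl] \<nu>sets sets_eq_imp_space_eq[OF \<nu>sets] f)
    also have "\<dots> = inverse \<epsilon> * (\<integral>\<^sup>+x. f n x \<partial>\<nu>)"
      by (intro arg_cong2[where f = "(*)"] refl nn_integral_cong) simp
    finally show ?thesis .
  qed
  have "(\<lambda>n. inverse \<epsilon> * (\<integral>\<^sup>+x. f n x \<partial>\<nu>)) \<longlonglongrightarrow> inverse \<epsilon> * 0"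
    using \<epsilon> by (intro ennreal_tendsto_cmult lim) (simp add: less_top[symmetric])
  then have "(\<lambda>n. inverse \<epsilon> * (\<integral>\<^sup>+x. f n x \<partial>\<nu>)) \<longlonglongrightarrow> 0"
    by simp
  then show ?thesis
  proof (rule tendsto_sandwich[OF _ _ tendsto_const, rotated 2])
    show "\<forall>\<^sub>F n in sequentially. emeasure \<mu> {x \<in> box (- 1) 1. translate_star x \<mu> \<in>
        {\<nu> \<in> Mstar0. \<epsilon> < disagree E (dilate_star (real n) \<nu>)}} \<le> inverse \<epsilon> * (\<integral>\<^sup>+x. f n x \<partial>\<nu>)"
      by (intro always_eventually allI bound)
  qed simp
qed

lemma AE_null_sets_mono:
  assumes "null_sets Q \<subseteq> null_sets P" "space Q = space P" "AE x in Q. \<phi> x"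
  shows "AE x in P. \<phi> x"
  using assms unfolding eventually_ae_filter by auto

lemma fractal_distribution_AE_disagree:
  fixes P :: "(real^'n) measure measure"
  assumes fd: "fractal_distribution P" and E: "S_invariant_set E" "E \<in> sets Mstar_borel"
    and \<epsilon>: "0 < \<epsilon>" "\<epsilon> < \<top>"
  shows "AE \<mu> in P. \<not> \<epsilon> < disagree E \<mu>"
proof -
  have P: "prob_space P" and setsP: "sets P = sets Mstar_borel" and "S_invariant P"
    and qp: "quasi_palm P"
    using fd by (auto simp: fractal_distribution_def distribution_def)
  note inv_facts = S_invariant_restrict_space[OF setsP \<open>S_invariant P\<close>]
  note M0 = inv_facts(1) and spP = inv_facts(2) and spN = inv_facts(3) and AE0 = inv_facts(4)
    and idN = inv_facts(5) and dil = inv_facts(6) and inv = inv_facts(7)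
  interpret P: prob_space P by (rule P)
  let ?N = "restrict_space P Mstar0"
  have dil': "dilate_star t \<in> ?N \<rightarrow>\<^sub>M Mstar_borel" for t
    using dil by (simp add: measurable_cong_sets[OF refl setsP])
  define D where "D n = {\<nu> \<in> Mstar0. \<epsilon> < disagree E (dilate_star (real n) \<nu>)}" for n
  define D' where "D' = {\<nu> \<in> Mstar0. \<epsilon> < disagree E \<nu>}"
  have N_sets: "A \<in> sets Mstar_borel" if "A \<in> sets ?N" for A
    using that M0 setsP by (simp add: sets_restrict_space_iff)
  have D: "D n \<in> sets Mstar_borel" for n
  proof -
    have "(\<lambda>\<nu>. disagree E (dilate_star (real n) \<nu>)) \<in> borel_measurable ?N"
      by (rule measurable_compose[OF dil' disagree_measurable[OF E(2)]])
    then have "{\<nu> \<in> space ?N. \<epsilon> < disagree E (dilate_star (real n) \<nu>)} \<in> sets ?N"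
      by measurable
    then show ?thesis
      unfolding D_def spN by (rule N_sets)
  qed
  have D': "D' \<in> sets Mstar_borel"
  proof -
    have "(\<lambda>\<nu>. disagree E \<nu>) \<in> borel_measurable ?N"
      by (rule measurable_compose[OF idN disagree_measurable[OF E(2)]])
    then have "{\<nu> \<in> space ?N. \<epsilon> < disagree E \<nu>} \<in> sets ?N"
      by measurable
    then show ?thesis
      unfolding D'_def spN by (rule N_sets)
  qed
  have PD: "measure P (D n) = measure P D'" for n
  proof -
    have "dilate_star (real n) -` D' \<inter> space ?N = D n"
      using dilate_star_Mstar0 by (auto simp: D_def D'_def spN)
    then have "measure P D' = measure ?N (D n)"
      using measure_distr[OF dil, of D' "real n"] D' by (simp add: inv setsP)
    also have "\<dots> = measure P (D n)"
      using M0 by (intro measure_restrict_space) (auto simp: D_def)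
    finally show ?thesis ..
  qed
  \<comment> \<open>An admissible neighbourhood contained in \<open>B1\<close>, so that the inner
    masses are at most \<open>1\<close>: this makes \<open>?Q\<close> finite and gives the
    dominating constant below.\<close>
  let ?U = "box (- 1) 1 :: (real^'n) set"
  let ?Q = "mixture Mstar_borel P (palm_average ?U)"
  have U: "?U \<in> sets borel"
    by simp
  have U_B1: "?U \<subseteq> B1"
    using box_subset_cbox by (auto simp: B1_def)
  have "open ?U" "bounded ?U" "0 \<in> ?U"
    by (auto simp: mem_box_cart)
  then have null: "null_sets P = null_sets ?Q"
    using qp by (simp add: quasi_palm_def)
  have Q: "emeasure ?Q A = (\<integral>\<^sup>+\<mu>. emeasure \<mu> {x \<in> ?U. translate_star x \<mu> \<in> A} \<partial>P)" if "A \<in> sets Mstar_borel" for A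
    by (rule emeasure_palm_mixture[OF U setsP that])
  have le1: "emeasure \<mu> {x \<in> ?U. translate_star x \<mu> \<in> A} \<le> 1" if "\<mu> \<in> Mstar" for \<mu> A
  proof -
    have "emeasure \<mu> {x \<in> ?U. translate_star x \<mu> \<in> A} \<le> emeasure \<mu> B1"
      using U_B1 that by (intro emeasure_mono) (auto simp: Mstar_def sets_radon)
    then show ?thesis
      using that by (simp add: Mstar_def)
  qed
  have finQ: "finite_measure ?Q"
  proof
    have "emeasure ?Q (space ?Q) \<le> (\<integral>\<^sup>+\<mu>. 1 \<partial>P)"
      unfolding space_mixture Q[OF sets.top] by (intro nn_integral_mono le1) (simp add: spP)
    then show "emeasure ?Q (space ?Q) \<noteq> \<infinity>"
      by (auto simp: P.emeasure_space_1 top_unique)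
  qed
  interpret Q: finite_measure ?Q by (rule finQ)
  have QD: "(\<lambda>n. emeasure ?Q (D n)) \<longlonglongrightarrow> 0"
  proof -
    have "(\<lambda>n. \<integral>\<^sup>+\<mu>. emeasure \<mu> {x \<in> ?U. translate_star x \<mu> \<in> D n} \<partial>P) \<longlonglongrightarrow> (\<integral>\<^sup>+\<mu>. 0 \<partial>P)"
    proof (rule nn_integral_dominated_convergence[where w = "\<lambda>_. 1"])
      show "(\<lambda>\<mu>. emeasure \<mu> {x \<in> ?U. translate_star x \<mu> \<in> D n}) \<in> borel_measurable P" for n
        by (rule palm_average_measurable[OF U setsP D])
      show "AE \<mu> in P. emeasure \<mu> {x \<in> ?U. translate_star x \<mu> \<in> D n} \<le> 1" for n
        by (intro AE_I2 le1) (simp add: spP)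
      show "AE \<mu> in P. (\<lambda>n. emeasure \<mu> {x \<in> ?U. translate_star x \<mu> \<in> D n}) \<longlonglongrightarrow> 0"
        unfolding D_def by (intro AE_I2 palm_disagree_tendsto[OF E _ \<epsilon>]) (simp add: spP)
    qed (auto simp: P.emeasure_space_1)
    then show ?thesis
      by (simp add: Q[OF D])
  qed
  define u where "u n = (indicator (D n) :: (real^'n) measure \<Rightarrow> real)" for n
  \<comment> \<open>Convergence in \<open>?Q\<close>-mean becomes almost sure along
    \<open>r\<close>, the form that passes to \<open>P\<close> through the common null sets.\<close>
  have "\<exists>r. strict_mono r \<and> (AE x in ?Q. (\<lambda>n. u (r n) x) \<longlonglongrightarrow> 0)"
  proof (rule tendsto_L1_AE_subseq)
    show "integrable ?Q (u n)" for n
      unfolding u_def using D by (intro integrable_real_indicator) (auto simp: less_top[symmetric])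
    have "(\<integral>x. norm (u n x) \<partial>?Q) = measure ?Q (D n)" for n
      using sets.sets_into_space[OF D[of n]] by (simp add: u_def Int_absorb2)
    moreover have "(\<lambda>n. measure ?Q (D n)) \<longlonglongrightarrow> 0"
      using tendsto_enn2real[of "\<lambda>n. emeasure ?Q (D n)" 0] QD by (simp add: measure_def)
    ultimately show "(\<lambda>n. \<integral>x. norm (u n x) \<partial>?Q) \<longlonglongrightarrow> 0"
      by simp
  qed
  then obtain r where r: "AE x in ?Q. (\<lambda>n. u (r n) x) \<longlonglongrightarrow> 0"
    by auto
  have "AE x in P. (\<lambda>n. u (r n) x) \<longlonglongrightarrow> 0"
    by (rule AE_null_sets_mono[OF _ _ r]) (simp_all add: null spP)
  \<comment> \<open>Back to means, now under \<open>P\<close>, where every \<open>D (r n)\<close>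
    has the measure of \<open>D'\<close>.\<close>
  then have "(\<lambda>n. \<integral>x. u (r n) x \<partial>P) \<longlonglongrightarrow> (\<integral>x. 0 \<partial>P)"
    using D setsP by (intro integral_dominated_convergence[where w = "\<lambda>_. 1"])
      (auto simp: u_def intro!: borel_measurable_indicator split: split_indicator)
  then have "(\<lambda>n. measure P D') \<longlonglongrightarrow> 0"
    using sets.sets_into_space[OF D] by (simp add: u_def spP Int_absorb2 PD)
  then have "measure P D' = 0"
    by (simp add: LIMSEQ_const_iff)
  then have "D' \<in> null_sets P"
    using D' setsP by (simp add: null_sets_def P.emeasure_eq_measure)
  then have "AE \<mu> in P. \<mu> \<notin> D'"
    by (rule AE_not_in)
  then show ?thesis
    using AE0 by eventually_elim (simp add: D'_def)
qed

text \<open>By invariance of \<open>P\<close>, \<open>disagree E\<close> vanishes almost surely also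
  at the zoomed-out measures \<open>dilate_star (- n) \<mu>\<close>. So, up to a null set, no point
  of \<open>exp n * B1\<close> disagrees with \<open>\<mu>\<close>, and these cubes exhaust the
  space.\<close>

lemma fractal_distribution_AE_translate:
  fixes P :: "(real^'n) measure measure"
  assumes fd: "fractal_distribution P" and E: "S_invariant_set E" "E \<in> sets Mstar_borel"
  shows "AE \<mu> in P. AE x in \<mu>. translate_star x \<mu> \<in> E \<longleftrightarrow> \<mu> \<in> E"
proof -
  have setsP: "sets P = sets Mstar_borel" and "S_invariant P"
    using fd by (auto simp: fractal_distribution_def distribution_def)
  note inv_facts = S_invariant_restrict_space[OF this]
  note M0 = inv_facts(1) and AE0 = inv_facts(4) and dil = inv_facts(6) and inv = inv_facts(7)
  let ?N = "restrict_space P Mstar0"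
  have "AE \<mu> in P. \<forall>k::nat. \<not> ennreal (1 / real (Suc k)) < disagree E \<mu>"
    unfolding AE_all_countable by (intro allI fractal_distribution_AE_disagree[OF fd E]) auto
  then have AE_0: "AE \<mu> in P. disagree E \<mu> = 0"
  proof eventually_elim
    case (elim \<mu>)
    show ?case
    proof (rule ccontr)
      assume "disagree E \<mu> \<noteq> 0"
      then obtain b where b: "0 < b" "b < disagree E \<mu>"
        using dense[of 0 "disagree E \<mu>"] by (auto simp: zero_less_iff_neq_zero)
      then obtain s where s: "b = ennreal s" "0 < s"
        by (cases b) auto
      obtain k where "1 / real (Suc k) < s"
        using nat_approx_posE[OF s(2)] by auto
      then have "ennreal (1 / real (Suc k)) < b"
        using s by (simp add: ennreal_less_iff del: of_nat_Suc)
      then show False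
        using elim b(2) by (meson less_trans)
    qed
  qed
  have "AE \<mu> in P. disagree E (dilate_star t \<mu>) = 0" for t
  proof -
    have "AE \<mu> in distr ?N P (dilate_star t). disagree E \<mu> = 0"
      unfolding inv by (rule AE_0)
    then have "AE \<mu> in ?N. disagree E (dilate_star t \<mu>) = 0"
      by (rule AE_distrD[OF dil])
    then have "AE \<mu> in P. \<mu> \<in> Mstar0 \<longrightarrow> disagree E (dilate_star t \<mu>) = 0"
      using M0 by (subst (asm) AE_restrict_space_iff) auto
    then show ?thesis
      using AE0 by eventually_elim simp
  qed
  then have "AE \<mu> in P. \<forall>n::nat. disagree E (dilate_star (- real n) \<mu>) = 0"
    unfolding AE_all_countable by blast
  then show ?thesis
    using AE0
  proof eventually_elim
    case (elim \<mu>)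
    have \<mu>: "\<mu> \<in> Mstar" "0 \<in> supp \<mu>" "\<mu> \<in> radon"
      using elim(2) by (auto simp: Mstar0_def Mstar_def)
    define H where "H = {z. translate_star z \<mu> \<in> E}"
    have H: "H \<in> sets borel"
      unfolding H_def by (rule translate_star_section[OF E(2) \<mu>(1)])
    have B: "{z. exp (- real n) *\<^sub>R z \<in> B1} \<in> sets borel" for n
      by measurable
    have null: "{z. exp (- real n) *\<^sub>R z \<in> B1 \<and> (z \<in> H) \<noteq> (\<mu> \<in> E)} \<in> null_sets \<mu>" for n
    proof -
      \<comment> \<open>The trivial translation by \<open>0\<close> brings the term into the form of
        \<open>disagree_dilate_translate\<close>.\<close>
      have "0 = disagree E (dilate_star (- real n) (translate_star 0 \<mu>))"
        using elim(1) by (simp add: translate_star_0[OF \<mu>(1)])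
      also have "\<dots> = emeasure \<mu> {z. exp (- real n) *\<^sub>R z \<in> B1 \<and> (z \<in> H) \<noteq> (\<mu> \<in> E)} /
          emeasure \<mu> {z. exp (- real n) *\<^sub>R z \<in> B1}"
        using disagree_dilate_translate[OF E \<mu>(1,2), of "- real n"]
        by (simp add: translate_star_0[OF \<mu>(1)] H_def)
      \<comment> \<open>A quotient in \<open>ennreal\<close> also vanishes when its denominator is
        infinite; local finiteness excludes that case.\<close>
      finally have "emeasure \<mu> {z. exp (- real n) *\<^sub>R z \<in> B1 \<and> (z \<in> H) \<noteq> (\<mu> \<in> E)} = 0 \<or>
          emeasure \<mu> {z. exp (- real n) *\<^sub>R z \<in> B1} = \<top>"
        by simp
      moreover have "emeasure \<mu> {z. exp (- real n) *\<^sub>R z \<in> B1} < \<top>"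
        using radon0_B1(2)[OF dilate_radon0[OF Mstar0_radon0[OF elim(2)]], of "- real n"]
        by (simp add: emeasure_dilate[OF \<mu>(3)])
      moreover have "{z. exp (- real n) *\<^sub>R z \<in> B1 \<and> (z \<in> H) \<noteq> (\<mu> \<in> E)} =
          (if \<mu> \<in> E then {z. exp (- real n) *\<^sub>R z \<in> B1} - H else {z. exp (- real n) *\<^sub>R z \<in> B1} \<inter> H)"
        by auto
      ultimately show ?thesis
        using H B[of n] by (auto simp: null_sets_def sets_radon[OF \<mu>(3)])
    qed
    have "AE z in \<mu>. \<forall>n. z \<notin> {z. exp (- real n) *\<^sub>R z \<in> B1 \<and> (z \<in> H) \<noteq> (\<mu> \<in> E)}"
      unfolding AE_all_countable by (intro allI AE_not_in null)
    then show ?case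
    proof eventually_elim
      case (elim z)
      obtain n :: nat where n: "norm z < real n"
        using reals_Archimedean2 by blast
      have "norm z < exp (real n)"
        using n exp_ge_add_one_self[of "real n"] by linarith
      then have "exp (- real n) *\<^sub>R z \<in> ball 0 1"
        by (simp add: exp_minus field_simps)
      then have "exp (- real n) *\<^sub>R z \<in> B1"
        using ball_subset_B1 by blast
      then show ?case
        using elim by (auto simp: H_def)
    qed
  qed
qed


section \<open>Weak convergence of sceneries\<close>

text \<open>The number of integers \<open>i\<close> with \<open>1 \<le> i < k * y\<close> lies
  between \<open>k * y - 1\<close> and \<open>k * y\<close>, and \<open>y \<le> 1\<close> confines
  them to \<open>{1..k}\<close>. This is the layer-cake formula discretised to \<open>k\<close>
  levels.\<close>

lemma equidistant_levels_bounds: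
  fixes y :: real
  assumes "0 \<le> y" "y \<le> 1" "0 < k"
  shows "y - 1 / real k \<le> (\<Sum>i\<in>{1..k}. of_bool (real i / real k < y)) / real k"
    and "(\<Sum>i\<in>{1..k}. of_bool (real i / real k < y)) / real k \<le> y"
proof -
  let ?I = "{i \<in> {1..k}. real i / real k < y}"
  have sum: "(\<Sum>i\<in>{1..k}. of_bool (real i / real k < y)) = real (card ?I)"
    by (simp add: sum.If_cases of_bool_def Int_def)
  have iff: "real i / real k < y \<longleftrightarrow> real i < real k * y" for i
    using assms(3) by (simp add: field_simps)
  have ky: "0 \<le> real k * y"
    using assms by simp
  have "?I \<subseteq> {1..nat \<lfloor>real k * y\<rfloor>}"
    using ky by (auto simp: iff le_nat_floor)
  then have "card ?I \<le> nat \<lfloor>real k * y\<rfloor>"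
    using card_mono[of "{1..nat \<lfloor>real k * y\<rfloor>}" ?I] by simp
  then have "real (card ?I) \<le> real k * y"
    using ky by linarith
  then show "(\<Sum>i\<in>{1..k}. of_bool (real i / real k < y)) / real k \<le> y"
    using assms(3) unfolding sum by (simp add: field_simps)
  have "{1..<nat \<lceil>real k * y\<rceil>} \<subseteq> ?I"
  proof
    fix i assume i: "i \<in> {1..<nat \<lceil>real k * y\<rceil>}"
    then have lt: "real i < real k * y"
      by (simp add: zless_nat_eq_int_zless less_ceiling_iff)
    also have "real k * y \<le> real k * 1"
      using assms by (intro mult_left_mono) auto
    finally have "i \<le> k"
      by simp
    then show "i \<in> ?I"
      using lt i by (simp add: iff)
  qed
  then have "nat \<lceil>real k * y\<rceil> - 1 \<le> card ?I"
    using card_mono[of ?I "{1..<nat \<lceil>real k * y\<rceil>}"] by simp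
  then have "real k * y - 1 \<le> real (card ?I)"
    using ky by linarith
  then have "(real k * y - 1) / real k \<le> real (card ?I) / real k"
    by (rule divide_right_mono) simp
  then show "y - 1 / real k \<le> (\<Sum>i\<in>{1..k}. of_bool (real i / real k < y)) / real k"
    using assms(3) unfolding sum by (simp add: diff_divide_distrib)
qed

context
  fixes \<nu> :: "'a measure" and X and \<nu>s :: "'i \<Rightarrow> 'a measure" and F :: "'i filter"
  assumes \<nu>: "prob_space \<nu>" "sets \<nu> = sets (borel_of X)"
    and \<nu>s: "\<forall>\<^sub>F T in F. prob_space (\<nu>s T) \<and> sets (\<nu>s T) = sets (borel_of X)"
    and op: "\<And>G c. openin X G \<Longrightarrow> c < measure \<nu> G \<Longrightarrow> \<forall>\<^sub>F T in F. c < measure (\<nu>s T) G"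
begin

text \<open>Up to \<open>1 / k\<close>, \<open>f\<close> is the average of the indicators of the
  open sets \<open>G i\<close> where \<open>f\<close> exceeds \<open>i / k\<close>, and
  \<open>op\<close> controls these finitely many sets from below. Half of \<open>e\<close> pays for
  the discretisation, half for \<open>op\<close>.\<close>

lemma portmanteau_lower_unit:
  assumes f: "continuous_map X euclideanreal f" "\<And>x. x \<in> topspace X \<Longrightarrow> 0 \<le> f x \<and> f x \<le> 1"
    and e: "0 < e"
  shows "\<forall>\<^sub>F T in F. integral\<^sup>L \<nu> f - e < integral\<^sup>L (\<nu>s T) f"
proof -
  obtain k :: nat where k: "2 / e < real k"
    using reals_Archimedean2 by blast
  have "0 < 2 / e"
    using e by simp
  then have k_pos: "0 < real k"
    using k by linarith
  have "2 < e * real k"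
    using k e by (simp add: field_simps)
  then have k0: "0 < k" "1 / real k < e / 2"
    using k_pos by (simp_all add: field_simps)
  define G where "G i = {x \<in> topspace X. f x \<in> {real i / real k<..}}" for i
  have G: "openin X (G i)" for i
    unfolding G_def using f(1) by (rule openin_continuous_map_preimage) simp
  define \<phi> where "\<phi> x = (\<Sum>i\<in>{1..k}. indicator (G i) x) / real k" for x
  have \<phi>: "f x - 1 / real k \<le> \<phi> x" "\<phi> x \<le> f x" if "x \<in> topspace X" for x
    using equidistant_levels_bounds[of "f x" k] f(2)[OF that] k0(1) that
    by (simp_all add: \<phi>_def G_def indicator_def of_bool_def)
  have props: "integrable \<kappa> f" "integrable \<kappa> \<phi>" "integral\<^sup>L \<kappa> \<phi> = (\<Sum>i\<in>{1..k}. measure \<kappa> (G i)) / real k"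
    "space \<kappa> = topspace X"
    if \<kappa>: "prob_space \<kappa>" "sets \<kappa> = sets (borel_of X)" for \<kappa>
  proof -
    interpret prob_space \<kappa> by fact
    show "integrable \<kappa> f"
      using f by (intro bounded_continuous_integrable[OF \<kappa>]) (auto simp: bounded_iff intro!: exI[of _ 1])
    have Gs: "G i \<in> sets \<kappa>" for i
      using openin_in_borel_of[OF G] by (simp add: \<kappa>(2))
    then have int: "integrable \<kappa> (indicator (G i) :: 'a \<Rightarrow> real)" for i
      by (intro integrable_real_indicator) (auto simp: less_top[symmetric])
    show "integrable \<kappa> \<phi>"
      unfolding \<phi>_def using int by (intro integrable_divide_zero Bochner_Integration.integrable_sum) auto
    show "integral\<^sup>L \<kappa> \<phi> = (\<Sum>i\<in>{1..k}. measure \<kappa> (G i)) / real k"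
      unfolding \<phi>_def using int Gs by (simp add: Bochner_Integration.integral_sum)
    show "space \<kappa> = topspace X"
      using sets_eq_imp_space_eq[OF \<kappa>(2)] by simp
  qed
  have "\<forall>\<^sub>F T in F. \<forall>i\<in>{1..k}. measure \<nu> (G i) - e / 2 < measure (\<nu>s T) (G i)"
    using e by (intro eventually_ball_finite ballI op G) auto
  then show ?thesis
    using \<nu>s
  proof eventually_elim
    case (elim T)
    interpret N: prob_space \<nu> by fact
    have "integral\<^sup>L \<nu> f - 1 / real k = (\<integral>x. f x - 1 / real k \<partial>\<nu>)"
      using props(1)[OF \<nu>] by (simp add: N.prob_space)
    also have "\<dots> \<le> integral\<^sup>L \<nu> \<phi>"
      using props[OF \<nu>] \<phi>(1) by (intro integral_mono) auto
    also have "\<dots> = (\<Sum>i\<in>{1..k}. measure \<nu> (G i)) / real k"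
      by (rule props(3)[OF \<nu>])
    also have "\<dots> \<le> (\<Sum>i\<in>{1..k}. measure (\<nu>s T) (G i) + e / 2) / real k"
      using elim(1) by (intro divide_right_mono sum_mono) (auto intro!: less_imp_le simp: algebra_simps)
    also have "\<dots> = integral\<^sup>L (\<nu>s T) \<phi> + e / 2"
      using props(3)[of "\<nu>s T"] elim(2) k0(1) by (simp add: sum.distrib add_divide_distrib)
    also have "integral\<^sup>L (\<nu>s T) \<phi> \<le> integral\<^sup>L (\<nu>s T) f"
      using props[of "\<nu>s T"] elim(2) \<phi>(2) by (intro integral_mono) auto
    finally show ?case
      using k0(2) by linarith
  qed
qed

text \<open>An affine change brings the values of \<open>f\<close> into \<open>[0, 1]\<close> and
  scales the error to \<open>e / (2 * m)\<close>.\<close>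

lemma portmanteau_lower:
  assumes f: "continuous_map X euclideanreal f" "bounded (f ` topspace X)"
    and e: "0 < e"
  shows "\<forall>\<^sub>F T in F. integral\<^sup>L \<nu> f - e < integral\<^sup>L (\<nu>s T) f"
proof -
  obtain m where m: "0 < m" "\<And>x. x \<in> topspace X \<Longrightarrow> \<bar>f x\<bar> \<le> m"
    using f(2) unfolding bounded_pos by (metis imageI real_norm_def)
  define g where "g x = f x / (2 * m) + 1 / 2" for x
  have g: "continuous_map X euclideanreal g"
    unfolding g_def using f(1) m(1) by (intro continuous_intros) auto
  have g01: "0 \<le> g x \<and> g x \<le> 1" if "x \<in> topspace X" for x
  proof -
    have "- m \<le> f x" "f x \<le> m"
      using m(2)[OF that] by (auto simp: abs_le_iff)
    then show ?thesis
      using m(1) by (simp add: g_def field_simps)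
  qed
  have int_g: "integral\<^sup>L \<kappa> g = integral\<^sup>L \<kappa> f / (2 * m) + 1 / 2"
    if \<kappa>: "prob_space \<kappa>" "sets \<kappa> = sets (borel_of X)" for \<kappa>
  proof -
    interpret prob_space \<kappa> by fact
    show ?thesis
      using bounded_continuous_integrable[OF \<kappa> f] by (simp add: g_def[abs_def] prob_space)
  qed
  have "\<forall>\<^sub>F T in F. integral\<^sup>L \<nu> g - e / (2 * m) < integral\<^sup>L (\<nu>s T) g"
    by (rule portmanteau_lower_unit[OF g g01]) (use e m in auto)
  then show ?thesis
    using \<nu>s
  proof eventually_elim
    case (elim T)
    then have "integral\<^sup>L \<nu> f / (2 * m) - e / (2 * m) < integral\<^sup>L (\<nu>s T) f / (2 * m)"
      by (simp add: int_g \<nu>)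
    then have "(integral\<^sup>L \<nu> f - e) / (2 * m) < integral\<^sup>L (\<nu>s T) f / (2 * m)"
      by (simp add: diff_divide_distrib)
    then show ?case
      using m(1) by (simp add: divide_less_cancel)
  qed
qed

text \<open>The lower bound for \<open>- f\<close> is the missing upper bound for
  \<open>f\<close>.\<close>

lemma portmanteau:
  assumes f: "continuous_map X euclideanreal f" "bounded (f ` topspace X)"
  shows "((\<lambda>T. integral\<^sup>L (\<nu>s T) f) \<longlongrightarrow> integral\<^sup>L \<nu> f) F"
proof (rule tendstoI)
  fix e :: real assume e: "0 < e"
  have 1: "\<forall>\<^sub>F T in F. integral\<^sup>L \<nu> f - e < integral\<^sup>L (\<nu>s T) f"
    by (rule portmanteau_lower[OF f e])
  have neg1: "continuous_map X euclideanreal (\<lambda>x. - f x)"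
    using f(1) by (intro continuous_intros)
  have neg2: "bounded ((\<lambda>x. - f x) ` topspace X)"
    using f(2) bounded_uminus[of "f ` topspace X"] by (simp add: image_image)
  have 2: "\<forall>\<^sub>F T in F. integral\<^sup>L \<nu> (\<lambda>x. - f x) - e < integral\<^sup>L (\<nu>s T) (\<lambda>x. - f x)"
    by (rule portmanteau_lower[OF neg1 neg2 e])
  show "\<forall>\<^sub>F T in F. dist (integral\<^sup>L (\<nu>s T) f) (integral\<^sup>L \<nu> f) < e"
    using 1 2 by eventually_elim (simp add: dist_real_def abs_less_iff)
qed

end

section \<open>Scenery averages and their limits\<close>

lemma limitin_weak_topologyI:
  assumes "\<nu> \<in> A" "\<forall>\<^sub>F T in Fl. \<nu>s T \<in> A"
    and "\<And>f. f \<in> F \<Longrightarrow> ((\<lambda>T. integral\<^sup>L (\<nu>s T) f) \<longlongrightarrow> integral\<^sup>L \<nu> f) Fl"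
  shows "limitin (weak_topology A F) \<nu>s \<nu> Fl"
  unfolding limitin_def
proof (intro conjI allI impI)
  let ?\<phi> = "\<lambda>\<nu>. \<lambda>f\<in>F. integral\<^sup>L \<nu> f"
  fix U assume U: "openin (weak_topology A F) U \<and> \<nu> \<in> U"
  then obtain W where W: "openin (powertop_real F) W" "U = ?\<phi> -` W \<inter> A"
    by (auto simp: weak_topology_def openin_pullback_topology)
  have "limitin (powertop_real F) (\<lambda>T. ?\<phi> (\<nu>s T)) (?\<phi> \<nu>) Fl"
    unfolding limitin_componentwise using assms(3) by simp
  then have "\<forall>\<^sub>F T in Fl. ?\<phi> (\<nu>s T) \<in> W"
    using W U by (auto simp: limitin_def)
  then show "\<forall>\<^sub>F T in Fl. \<nu>s T \<in> U"
    using assms(2) by eventually_elim (auto simp: W(2))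
qed (simp add: assms(1))

lemma scenery_average_emeasure:
  fixes \<mu> :: "(real^'n) measure"
  assumes \<mu>: "\<mu> \<in> Mstar" "x \<in> supp \<mu>" and A: "A \<in> sets (borel_of Msquare)"
  shows "emeasure (scenery_average \<mu> x T) A =
      ennreal (1 / T) * emeasure lborel {t \<in> {0..T}. scenery \<mu> x t \<in> A}"
    and "(\<lambda>t. scenery \<mu> x t) \<in> borel \<rightarrow>\<^sub>M borel_of Msquare"
proof -
  have rad: "\<mu> \<in> radon"
    using \<mu>(1) by (rule Mstar_radon)
  have tr: "translate_star x \<mu> \<in> Mstar0"
    using \<mu>(2) by (simp add: translate_star_Mstar0_iff[OF rad])
  have "(\<lambda>t. dilate_square t (translate_star x \<mu>)) \<in> borel \<rightarrow>\<^sub>M borel_of Msquare"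
    using tr by (intro dilate_square_measurable) (auto simp: Mstar0_def)
  then show meas: "(\<lambda>t. scenery \<mu> x t) \<in> borel \<rightarrow>\<^sub>M borel_of Msquare"
    by (simp add: scenery_eq[OF rad \<mu>(2)])
  have sec: "{t. scenery \<mu> x t \<in> B} \<in> sets borel" if "B \<in> sets (borel_of Msquare)" for B
    using measurable_sets[OF meas that] by (simp add: vimage_def)
  have "emeasure (mixture (borel_of Msquare) (restrict_space lborel {0..T})
      (\<lambda>t. return (borel_of Msquare) (scenery \<mu> x t))) A =
      (\<integral>\<^sup>+t. emeasure (return (borel_of Msquare) (scenery \<mu> x t)) A \<partial>restrict_space lborel {0..T})"
  proof (rule emeasure_mixture[OF _ _ A])
    fix B assume B: "B \<in> sets (borel_of Msquare :: (real^'n) measure measure)"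
    have "indicator {t. scenery \<mu> x t \<in> B} \<in> borel_measurable (restrict_space lborel {0..T})"
      by (intro measurable_restrict_space1 borel_measurable_indicator) (simp add: sec[OF B])
    then show "(\<lambda>t. emeasure (return (borel_of Msquare) (scenery \<mu> x t)) B) \<in> borel_measurable (restrict_space lborel {0..T})"
      by (rule measurable_congI) (simp add: B indicator_def)
  qed simp
  also have "\<dots> = (\<integral>\<^sup>+t. indicator {t. scenery \<mu> x t \<in> A} t \<partial>restrict_space lborel {0..T})"
    by (intro nn_integral_cong) (simp add: A indicator_def)
  also have "\<dots> = (\<integral>\<^sup>+t. indicator {t \<in> {0..T}. scenery \<mu> x t \<in> A} t \<partial>lborel)"
    by (subst nn_integral_restrict_space) (auto intro!: nn_integral_cong split: split_indicator)
  also have "\<dots> = emeasure lborel {t \<in> {0..T}. scenery \<mu> x t \<in> A}"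
    using sec[OF A] by (intro nn_integral_indicator) (simp add: Collect_conj_eq sets.Int)
  finally show "emeasure (scenery_average \<mu> x T) A =
      ennreal (1 / T) * emeasure lborel {t \<in> {0..T}. scenery \<mu> x t \<in> A}"
    by (simp add: scenery_average_def)
qed

lemma sets_scenery_average [simp]: "sets (scenery_average \<mu> x T) = sets (borel_of Msquare)"
  by (simp add: scenery_average_def)

lemma prob_space_scenery_average:
  assumes "\<mu> \<in> Mstar" "x \<in> supp \<mu>" "0 < T"
  shows "prob_space (scenery_average \<mu> x T)"
proof
  have "space (scenery_average \<mu> x T) = space (borel_of Msquare)"
    by (rule sets_eq_imp_space_eq) simp
  moreover have "{t \<in> {0..T}. scenery \<mu> x t \<in> space (borel_of Msquare)} = {0..T}"
    using measurable_space[OF scenery_average_emeasure(2)[OF assms(1,2) sets.top]] by auto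
  ultimately show "emeasure (scenery_average \<mu> x T) (space (scenery_average \<mu> x T)) = 1"
    using assms(3) scenery_average_emeasure(1)[OF assms(1,2) sets.top, of T]
    by (simp add: ennreal_mult[symmetric])
qed

text \<open>\<open>frequent\<close> speaks of integer times; for real \<open>T\<close> its integer
  part is used, which loses at most one unit of time. A rate \<open>r\<close> strictly between
  \<open>c\<close> and \<open>q\<close> pays for the loss.\<close>

lemma scenery_average_frequent:
  fixes \<mu> :: "(real^'n) measure"
  assumes \<mu>: "\<mu> \<in> Mstar" "x \<in> supp \<mu>" and V: "V \<in> sets (borel_of Msquare)"
    and fr: "translate_star x \<mu> \<in> frequent V q" and cq: "c < q"
  shows "\<forall>\<^sub>F T in at_top. c < measure (scenery_average \<mu> x T) V"
proof (cases "c < 0")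
  case True
  then show ?thesis
    by (intro always_eventually allI) (meson less_le_trans measure_nonneg)
next
  case False
  have rad: "\<mu> \<in> radon"
    using \<mu>(1) by (rule Mstar_radon)
  have tr: "translate_star x \<mu> \<in> Mstar0"
    using \<mu>(2) by (simp add: translate_star_Mstar0_iff[OF rad])
  obtain r :: rat where r: "c < of_rat r" "of_rat r < q"
    using of_rat_dense[OF cq] by auto
  obtain N where N: "\<And>n. n \<ge> N \<Longrightarrow> of_rat r * real n \<le> sojourn V (translate_star x \<mu>) 0 (real n)"
    using fr r(2) unfolding frequent_def by blast
  let ?r = "of_rat r :: real"
  \<comment> \<open>\<open>N + 1\<close> puts the integer part of \<open>T\<close> beyond
    \<open>N\<close>; the second bound is what \<open>c * T < r * (T - 1)\<close> asks for.\<close>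
  define T0 where "T0 = max (real N + 1) (?r / (?r - c) + 1)"
  show ?thesis
  proof (rule eventually_at_top_linorderI[of T0])
    fix T assume T: "T \<ge> T0"
    have T_pos: "0 < T" and TN: "real N + 1 \<le> T" and Tr: "?r / (?r - c) < T"
      using T by (auto simp: T0_def)
    define n where "n = nat \<lfloor>T\<rfloor>"
    have n: "real n \<le> T" "T - 1 \<le> real n" "N \<le> n"
      unfolding n_def using T_pos TN by linarith+
    have sec: "{t \<in> {0..T}. scenery \<mu> x t \<in> V} \<in> sets lborel"
      using measurable_sets[OF scenery_average_emeasure(2)[OF \<mu> V] V]
      by (simp add: Collect_conj_eq sets.Int vimage_def)
    have "{t \<in> {0..T}. scenery \<mu> x t \<in> V} \<in> fmeasurable lborel"
      by (rule fmeasurableI2[of "{0..T}"]) (use sec T_pos in \<open>auto intro: fmeasurableI\<close>)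
    then have "sojourn V (translate_star x \<mu>) 0 (real n) \<le> measure lborel {t \<in> {0..T}. scenery \<mu> x t \<in> V}"
      unfolding sojourn_def scenery_eq[OF rad \<mu>(2)]
      by (intro measure_mono_fmeasurable fmeasurableD[OF sojourn_fmeasurable[OF V tr]]) (use n in auto)
    moreover have "measure (scenery_average \<mu> x T) V = measure lborel {t \<in> {0..T}. scenery \<mu> x t \<in> V} / T"
      using scenery_average_emeasure(1)[OF \<mu> V, of T] T_pos by (simp add: measure_def enn2real_mult)
    moreover have "c * T < ?r * real n"
    proof -
      have "?r < T * (?r - c)"
        using Tr r(1) by (simp add: field_simps)
      then have "c * T < ?r * (T - 1)"
        by (simp add: algebra_simps)
      \<comment> \<open>The case assumption \<open>c \<ge> 0\<close> enters here: it makes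
        \<open>r\<close> positive.\<close>
      also have "\<dots> \<le> ?r * real n"
        using r(1) False by (intro mult_left_mono n(2)) linarith
      finally show ?thesis .
    qed
    ultimately show "c < measure (scenery_average \<mu> x T) V"
      using N[OF n(3)] T_pos by (simp add: pos_less_divide_eq)
  qed
qed

text \<open>An arbitrary open \<open>G\<close> is an increasing union of members of
  \<open>\<B>\<close>, so some \<open>V i \<subseteq> G\<close> already has measure above
  \<open>c\<close>, and the frequency bound for \<open>V i\<close> serves for \<open>G\<close>. This
  supplies the hypothesis \<open>op\<close> of \<open>portmanteau\<close>.\<close>

lemma generates_at_frequent:
  fixes \<mu> :: "(real^'n) measure"
  assumes \<mu>: "\<mu> \<in> Mstar" "x \<in> supp \<mu>"
    and R: "prob_space R" "sets R = sets Mstar_borel"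
    and \<B>: "\<And>V. V \<in> \<B> \<Longrightarrow> openin Msquare V"
      "\<And>U. openin Msquare U \<Longrightarrow> \<exists>V. range V \<subseteq> \<B> \<and> incseq V \<and> U = (\<Union>i::nat. V i)"
    and fr: "\<And>V q. V \<in> \<B> \<Longrightarrow> real_of_rat q < measure R {\<nu> \<in> space R. square \<nu> \<in> V} \<Longrightarrow>
      translate_star x \<mu> \<in> frequent V (of_rat q)"
  shows "generates_at \<mu> x R"
proof -
  interpret R: prob_space R by fact
  let ?\<nu> = "square_distr R"
  have sq: "square \<in> R \<rightarrow>\<^sub>M borel_of Msquare"
    using square_measurable by (simp add: measurable_cong_sets[OF R(2) refl])
  have \<nu>: "prob_space ?\<nu>" "sets ?\<nu> = sets (borel_of Msquare)"
    unfolding square_distr_def by (auto intro: R.prob_space_distr sq)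
  interpret N: prob_space ?\<nu> by (rule \<nu>(1))
  have ev: "\<forall>\<^sub>F T in at_top. prob_space (scenery_average \<mu> x T) \<and>
      sets (scenery_average \<mu> x T) = sets (borel_of Msquare)"
    using eventually_gt_at_top[of "0::real"]
    by eventually_elim (simp add: prob_space_scenery_average[OF \<mu>])
  have op: "\<forall>\<^sub>F T in at_top. c < measure (scenery_average \<mu> x T) G"
    if G: "openin Msquare G" "c < measure ?\<nu> G" for G c
  proof -
    obtain V where V: "range V \<subseteq> \<B>" "incseq V" "G = (\<Union>i::nat. V i)"
      using \<B>(2)[OF G(1)] by blast
    have VB: "V i \<in> \<B>" for i
      using V(1) by auto
    have Vs: "V i \<in> sets (borel_of Msquare)" for i
      by (rule openin_in_borel_of[OF \<B>(1)[OF VB]])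
    have "(\<lambda>i. measure ?\<nu> (V i)) \<longlonglongrightarrow> measure ?\<nu> G"
      unfolding V(3) using Vs V(2) by (intro N.finite_Lim_measure_incseq) (auto simp: \<nu>(2))
    then have "\<forall>\<^sub>F i in sequentially. c < measure ?\<nu> (V i)"
      using G(2) by (rule order_tendstoD)
    then obtain i where i: "c < measure ?\<nu> (V i)"
      by (auto simp: eventually_sequentially)
    obtain q :: rat where q: "c < of_rat q" "of_rat q < measure ?\<nu> (V i)"
      using of_rat_dense[OF i] by auto
    have "measure ?\<nu> (V i) = measure R {\<nu> \<in> space R. square \<nu> \<in> V i}"
      unfolding square_distr_def using Vs
      by (subst measure_distr[OF sq]) (auto simp: vimage_def Int_def conj_commute)
    then have "translate_star x \<mu> \<in> frequent (V i) (of_rat q)"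
      using q(2) by (intro fr[OF VB]) simp
    from scenery_average_frequent[OF \<mu> Vs this q(1)]
    show ?thesis
      using ev
    proof eventually_elim
      case (elim T)
      then interpret S: prob_space "scenery_average \<mu> x T"
        by simp
      have "measure (scenery_average \<mu> x T) (V i) \<le> measure (scenery_average \<mu> x T) G"
        using openin_in_borel_of[OF G(1)] V(3) by (intro S.finite_measure_mono) auto
      then show ?case
        using elim by simp
    qed
  qed
  have "limitin (prob_topology Msquare) (scenery_average \<mu> x) ?\<nu> at_top"
    unfolding prob_topology_def
  proof (rule limitin_weak_topologyI)
    show "?\<nu> \<in> {\<nu>. prob_space \<nu> \<and> sets \<nu> = sets (borel_of Msquare)}"
      using \<nu> by simp
    show "\<forall>\<^sub>F T in at_top. scenery_average \<mu> x T \<in> {\<nu>. prob_space \<nu> \<and> sets \<nu> = sets (borel_of Msquare)}"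
      using ev by simp
    fix f :: "(real^'n) measure \<Rightarrow> real"
    assume "f \<in> Cb Msquare"
    then show "((\<lambda>T. integral\<^sup>L (scenery_average \<mu> x T) f) \<longlongrightarrow> integral\<^sup>L ?\<nu> f) at_top"
      by (intro portmanteau[OF \<nu> ev op]) auto
  qed
  then show ?thesis
    using \<mu>(2) by (simp add: generates_at_def)
qed

text \<open>\<open>ergodic_frequent\<close> concerns one fixed component, whereas here
  \<open>\<mu>\<close> and \<open>K \<mu>\<close> vary together. Since
  \<open>K \<nu> = K \<mu>\<close> for \<open>K \<mu>\<close>-a.e. \<open>\<nu>\<close>, the bad set
  \<open>?B\<close> is null for almost every component, hence for their mixture
  \<open>P\<close>.\<close>

lemma ergodic_decomposition_AE_frequent:
  fixes P :: "(real^'n) measure measure"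
  assumes fd: "fractal_distribution P" and ed: "ergodic_decomposition P K"
    and V: "V \<in> sets (borel_of Msquare)"
  shows "AE \<mu> in P. q < measure (K \<mu>) {\<nu> \<in> Mstar. square \<nu> \<in> V} \<longrightarrow> \<mu> \<in> frequent V q"
proof -
  have setsP: "sets P = sets Mstar_borel"
    using fd by (auto simp: fractal_distribution_def distribution_def)
  have spP: "space P = Mstar"
    using sets_eq_imp_space_eq[OF setsP] by simp
  have K: "K \<in> P \<rightarrow>\<^sub>M prob_algebra Mstar_borel"
    and erg: "AE \<mu> in P. S_ergodic (K \<mu>)" and mix: "P = mixture Mstar_borel P K"
    and const: "AE \<mu> in P. AE \<nu> in K \<mu>. K \<nu> = K \<mu>"
    using ed by (auto simp: ergodic_decomposition_def)
  have K_prob: "prob_space (K \<mu>)" "sets (K \<mu>) = sets Mstar_borel" if "\<mu> \<in> space P" for \<mu>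
    using measurable_space[OF K that] by (auto simp: space_prob_algebra)
  let ?S = "{\<nu> \<in> Mstar. square \<nu> \<in> V}"
  have S: "?S \<in> sets Mstar_borel"
    using measurable_sets[OF square_measurable V] by (simp add: vimage_def Int_def conj_commute)
  let ?B = "{\<mu> \<in> space P. q < measure (K \<mu>) ?S} - frequent V q"
  have "(\<lambda>\<mu>. measure (K \<mu>) ?S) \<in> borel_measurable P"
    by (rule measurable_compose[OF measurable_prob_algebraD[OF K] measurable_measure_subprob_algebra[OF S]])
  then have "{\<mu> \<in> space P. q < measure (K \<mu>) ?S} \<in> sets P"
    by measurable
  then have B: "?B \<in> sets Mstar_borel"
    using frequent_sets[OF V] by (auto simp: setsP)
  have "AE \<mu> in P. emeasure (K \<mu>) ?B = 0"
    using erg const AE_space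
  proof eventually_elim
    case (elim \<mu>)
    have sp: "space (K \<mu>) = Mstar"
      using sets_eq_imp_space_eq[OF K_prob(2)[OF elim(3)]] by simp
    have "AE \<nu> in K \<mu>. q < measure (K \<mu>) ?S \<longrightarrow> \<nu> \<in> frequent V q"
    proof (cases "q < measure (K \<mu>) ?S")
      case True
      then show ?thesis
        using ergodic_frequent[OF V K_prob(1)[OF elim(3)] K_prob(2)[OF elim(3)] elim(1), of q]
        by (simp add: sp)
    qed simp
    then have "AE \<nu> in K \<mu>. \<nu> \<notin> ?B"
      using elim(2) by eventually_elim auto
    moreover have "?B \<in> sets (K \<mu>)"
      using B K_prob(2)[OF elim(3)] by simp
    ultimately have "?B \<in> null_sets (K \<mu>)"
      by (simp only: AE_iff_null_sets)
    then show ?case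
      by (rule null_setsD1)
  qed
  then have "(\<integral>\<^sup>+\<mu>. emeasure (K \<mu>) ?B \<partial>P) = (\<integral>\<^sup>+\<mu>. 0 \<partial>P)"
    by (rule nn_integral_cong_AE)
  moreover have "emeasure P ?B = (\<integral>\<^sup>+\<mu>. emeasure (K \<mu>) ?B \<partial>P)"
  proof -
    have "emeasure (mixture Mstar_borel P K) ?B = (\<integral>\<^sup>+\<mu>. emeasure (K \<mu>) ?B \<partial>P)"
    proof (rule emeasure_mixture[OF K_prob(2) _ B])
      show "(\<lambda>\<mu>. emeasure (K \<mu>) A) \<in> borel_measurable P" if "A \<in> sets Mstar_borel" for A
        by (rule measurable_compose[OF measurable_prob_algebraD[OF K] measurable_emeasure_subprob_algebra[OF that]])
    qed
    then show ?thesis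
      by (simp only: mix[symmetric])
  qed
  ultimately have "?B \<in> null_sets P"
    using B setsP by (simp add: null_sets_def)
  then have "AE \<mu> in P. \<mu> \<notin> ?B"
    by (rule AE_not_in)
  then show ?thesis
    using AE_space by eventually_elim auto
qed

theorem theorem1p6:
  fixes P :: "(real^'n) measure measure"
    and P_comp :: "(real^'n) measure \<Rightarrow> (real^'n) measure measure"
  assumes "fractal_distribution P"
    and "ergodic_decomposition P P_comp"
  shows "AE \<mu> in P. USM_generating \<mu> (P_comp \<mu>)"
proof -
  have setsP: "sets P = sets Mstar_borel"
    using assms(1) by (auto simp: fractal_distribution_def distribution_def)
  have spP: "space P = Mstar"
    using sets_eq_imp_space_eq[OF setsP] by simp
  have K: "P_comp \<in> P \<rightarrow>\<^sub>M prob_algebra Mstar_borel"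
    using assms(2) by (auto simp: ergodic_decomposition_def)
  obtain \<B> :: "(real^'n) measure set set" where \<B>: "countable \<B>"
    "\<And>V. V \<in> \<B> \<Longrightarrow> openin Msquare V"
    "\<And>U. openin Msquare U \<Longrightarrow> \<exists>V. range V \<subseteq> \<B> \<and> incseq V \<and> U = (\<Union>i::nat. V i)"
    using prob_topology_countable_base[of "B1 :: (real^'n) set", folded Msquare_def] by blast
  have Vs: "V \<in> sets (borel_of Msquare)" if "V \<in> \<B>" for V
    by (rule openin_in_borel_of[OF \<B>(2)[OF that]])
  \<comment> \<open>There are only countably many pairs \<open>(V, q)\<close>, so one exceptional
    null set serves for all of them.\<close>
  have "AE \<mu> in P. \<forall>V\<in>\<B>. \<forall>q::rat. AE x in \<mu>.
      translate_star x \<mu> \<in> frequent V (of_rat q) \<longleftrightarrow> \<mu> \<in> frequent V (of_rat q)"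
    by (intro AE_ball_countable' \<B>(1) AE_all_countable[THEN iffD2] allI
        fractal_distribution_AE_translate[OF assms(1)] frequent_invariant frequent_sets Vs)
  moreover have "AE \<mu> in P. \<forall>V\<in>\<B>. \<forall>q::rat.
      of_rat q < measure (P_comp \<mu>) {\<nu> \<in> Mstar. square \<nu> \<in> V} \<longrightarrow> \<mu> \<in> frequent V (of_rat q)"
    by (intro AE_ball_countable' \<B>(1) AE_all_countable[THEN iffD2] allI
        ergodic_decomposition_AE_frequent[OF assms] Vs)
  ultimately show ?thesis
    using AE_space
  proof eventually_elim
    case (elim \<mu>)
    have \<mu>: "\<mu> \<in> Mstar" "\<mu> \<in> radon"
      using elim(3) by (auto simp: spP Mstar_def)
    have R: "prob_space (P_comp \<mu>)" "sets (P_comp \<mu>) = sets Mstar_borel"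
      using measurable_space[OF K elim(3)] by (auto simp: space_prob_algebra)
    have spR: "space (P_comp \<mu>) = Mstar"
      using sets_eq_imp_space_eq[OF R(2)] by simp
    have "AE x in \<mu>. \<forall>V\<in>\<B>. \<forall>q::rat.
        translate_star x \<mu> \<in> frequent V (of_rat q) \<longleftrightarrow> \<mu> \<in> frequent V (of_rat q)"
      using elim(1) by (intro AE_ball_countable' \<B>(1) AE_all_countable[THEN iffD2] allI) auto
    then have "AE x in \<mu>. generates_at \<mu> x (P_comp \<mu>)"
      using AE_supp[OF \<mu>(2)]
    proof eventually_elim
      case (elim x)
      show ?case
        by (rule generates_at_frequent[OF \<mu>(1) elim(2) R \<B>(2,3)])
          (use elim(1) \<open>\<forall>V\<in>\<B>. \<forall>q::rat. of_rat q < measure (P_comp \<mu>) {\<nu> \<in> Mstar. square \<nu> \<in> V} \<longrightarrow> \<mu> \<in> frequent V (of_rat q)\<close>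
            in \<open>auto simp: spR\<close>)
    qed
    then show ?case
      using \<mu>(2) by (simp add: USM_generating_def)
  qed
qed

end
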